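(* Let $a,b,c\in\mathbb{R}\setminus\{0\}$ and let $J_{a,b,c}$ be the left-invariant almost complex structure on $KT^6$ determined by $$J\left(\tfrac{\partial}{\partial x_1}\right)=a\tfrac{\partial}{\partial x_2},\qquad J\left(\tfrac{\partial}{\partial y_1}+x_1\tfrac{\partial}{\partial z}\right)=b\left(\tfrac{\partial}{\partial y_2}+x_2\tfrac{\partial}{\partial z}\right),\qquad J\left(\tfrac{\partial}{\partial t}\right)=c\tfrac{\partial}{\partial z}.$$ Let $$\phi^1=dx_1+\tfrac{i}{a}dx_2,\qquad \phi^2=dy_1+\tfrac{i}{b}dy_2,\qquad \phi^3=dt+\tfrac{i}{c}\left(dz-x_1dy_1-x_2dy_2\right),$$ which is a global frame of $(1,0)$-forms. (1) If $ab\neq1$, then for any left-invariant Riemannian metric $g$ on $KT^6$ compatible with $J_{a,b,c}$, the space of Dolbeault harmonic $(0,1)$-forms is $\mathcal{H}^{0,1}_{\overline{\partial}}=\mathbb{C}\langle\overline{\phi^1},\overline{\phi^2}\rangle$. (2) If $ab=1$, i.e. $J_{a,b,c}$ is integrable, then on $(KT^6,J_{a,b,c})$ one has $\mathcal{H}^{0,1}_{\overline{\partial}}\simeq H^{0,1}_{\overline{\partial}}\simeq\mathbb{C}\langle\overline{\phi^1},\overline{\phi^2},\overline{\phi^3}\rangle$, where $H^{0,1}_{\overline{\partial}}$ is Dolbeault cohomology and $\mathcal{H}^{0,1}_{\overline{\partial}}$ is computed with respect to any left-invariant Riemannian metric compatible with $J_{a,b,c}$.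
   Context: $H_5(\mathbb{R})$ is the group of $4\times4$ real matrices $\begin{pmatrix}1&x&z\\0&I_2&y\\0&0&1\end{pmatrix}$ with $x=(x_1,x_2)$ a row, $y=(y_1,y_2)$ a column in $\mathbb{R}^2$, $z\in\mathbb{R}$, and $H_5(\mathbb{Z})$ is the subgroup with integer entries. $KT^6=(H_5(\mathbb{Z})\times\mathbb{Z})\backslash(H_5(\mathbb{R})\times\mathbb{R})$, with $t$ the coordinate on the last factor. Left-invariant vector fields on the group descend to $KT^6$; they are spanned by $\partial_{x_1},\partial_{x_2},\partial_{y_1}+x_1\partial_z,\partial_{y_2}+x_2\partial_z,\partial_z,\partial_t$. A tensor (metric, almost complex structure) is left-invariant if its coefficients in this frame are constant. A Riemannian metric $g$ is compatible with $J$ (almost Hermitian) if $g(J\cdot,J\cdot)=g$. On an almost complex manifold, $\overline{\partial}$ is the component of $d$ mapping $(p,q)$-forms to $(p,q+1)$-forms. Given an almost Hermitian metric on a compact manifold, $\overline{\partial}^*$ is the $L^2$-formal adjoint of $\overline{\partial}$, the Dolbeault Laplacian is $\Delta_{\overline{\partial}}=\overline{\partial}\,\overline{\partial}^*+\overline{\partial}^*\overline{\partial}$, and $\mathcal{H}^{p,q}_{\overline{\partial}}$ is the space of smooth complex $(p,q)$-forms $s$ with $\Delta_{\overline{\partial}}s=0$. When $J$ is integrable, $H^{p,q}_{\overline{\partial}}=\ker\overline{\partial}/\operatorname{im}\overline{\partial}$ in bidegree $(p,q)$. $\mathbb{C}\langle\cdot\rangle$ denotes the complex linear span. *)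

theory Defs
  imports "HOL-Analysis.Analysis" "HOL-Library.Function_Algebras"
begin

section \<open>Smooth functions\<close>

primrec continuously_differentiable ::
  "nat \<Rightarrow> ('a::real_normed_vector \<Rightarrow> 'b::real_normed_vector) \<Rightarrow> bool" where
  "continuously_differentiable 0 f \<longleftrightarrow> continuous_on UNIV f"
| "continuously_differentiable (Suc k) f \<longleftrightarrow>
     (\<forall>x. f differentiable (at x)) \<and>
     (\<forall>v. continuously_differentiable k (\<lambda>x. frechet_derivative f (at x) v))"

definition smooth :: "('a::real_normed_vector \<Rightarrow> 'b::real_normed_vector) \<Rightarrow> bool" where
  "smooth f \<longleftrightarrow> (\<forall>k. continuously_differentiable k f)"


section \<open>The group, the lattice, and the left-invariant frame\<close>

text \<open>
  The group \<open>H\<^sub>5(\<real>) \<times> \<real>\<close> is identified with \<open>\<real>\<^sup>6\<close> through the coordinates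
  \<open>(x\<^sub>1, x\<^sub>2, y\<^sub>1, y\<^sub>2, z, t)\<close>.
\<close>

datatype coord = Cx1 | Cx2 | Cy1 | Cy2 | Cz | Ct

lemma UNIV_coord: "UNIV = {Cx1, Cx2, Cy1, Cy2, Cz, Ct}"
  using coord.exhaust by auto

instance coord :: finite
  by standard (simp add: UNIV_coord)

type_synonym point = "real ^ coord"
type_synonym cvec = "complex ^ coord"

definition heis_matrix :: "point \<Rightarrow> real ^ 4 ^ 4" where
  "heis_matrix p = vector
     [vector [1, p $ Cx1, p $ Cx2, p $ Cz],
      vector [0, 1, 0, p $ Cy1],
      vector [0, 0, 1, p $ Cy2],
      vector [0, 0, 0, 1]]"

definition gmul :: "point \<Rightarrow> point \<Rightarrow> point" where
  "gmul p q = (\<chi> i. case i of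
       Cz \<Rightarrow> p $ Cz + q $ Cz + p $ Cx1 * q $ Cy1 + p $ Cx2 * q $ Cy2
     | _ \<Rightarrow> p $ i + q $ i)"

lemma vec4_nth:
  "(vector [u, v, w, x] :: 'a::zero ^ 4) $ 1 = u" "(vector [u, v, w, x] :: 'a ^ 4) $ 2 = v"
  "(vector [u, v, w, x] :: 'a ^ 4) $ 3 = w" "(vector [u, v, w, x] :: 'a ^ 4) $ 4 = x"
  by (simp_all add: vector_def)

lemma heis_matrix_gmul: "heis_matrix (gmul p q) = heis_matrix p ** heis_matrix q"
  by (simp add: vec_eq_iff forall_4 matrix_matrix_mult_def sum_4 heis_matrix_def vec4_nth gmul_def)

definition lattice :: "point set" where
  "lattice = {p. \<forall>i. p $ i \<in> \<int>}"

abbreviation dtrans :: "point \<Rightarrow> point \<Rightarrow> point \<Rightarrow> point" where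
  "dtrans \<gamma> p \<equiv> frechet_derivative (gmul \<gamma>) (at p)"

definition frame :: "coord \<Rightarrow> point \<Rightarrow> point" where
  "frame i p = (case i of
       Cy1 \<Rightarrow> axis Cy1 1 + p $ Cx1 *\<^sub>R axis Cz 1
     | Cy2 \<Rightarrow> axis Cy2 1 + p $ Cx2 *\<^sub>R axis Cz 1
     | _ \<Rightarrow> axis i 1)"

lemma has_derivative_gmul:
  "(gmul \<gamma> has_derivative
     (\<lambda>v. v + (\<gamma> $ Cx1 * v $ Cy1 + \<gamma> $ Cx2 * v $ Cy2) *\<^sub>R axis Cz 1)) (at p)"
proof -
  have eq: "gmul \<gamma> = (\<lambda>q. \<gamma> + (q + (\<gamma> $ Cx1 * q $ Cy1 + \<gamma> $ Cx2 * q $ Cy2) *\<^sub>R axis Cz 1))"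
    by (rule ext) (auto simp: gmul_def vec_eq_iff axis_def split: coord.split)
  show ?thesis unfolding eq
    by (auto intro!: derivative_eq_intros bounded_linear.has_derivative[OF bounded_linear_vec_nth])
qed

lemma frame_left_invariant: "dtrans \<gamma> p (frame i p) = frame i (gmul \<gamma> p)"
proof -
  have "dtrans \<gamma> p = (\<lambda>v. v + (\<gamma> $ Cx1 * v $ Cy1 + \<gamma> $ Cx2 * v $ Cy2) *\<^sub>R axis Cz 1)"
    using frechet_derivative_at[OF has_derivative_gmul] by simp
  then show ?thesis
    by (cases i) (auto simp: frame_def gmul_def axis_def vec_eq_iff)
qed

text \<open>
  Tensor fields on the quotient \<open>lattice \ G\<close> are represented by their pullbacks to \<open>G\<close>, that
  is, by smooth tensor fields on \<open>G\<close> invariant under left translation by the lattice.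
  A vector field, endomorphism field or bilinear form field has values in the standard
  coordinates of \<open>\<real>\<^sup>6\<close>.
\<close>

definition vector_field :: "(point \<Rightarrow> point) \<Rightarrow> bool" where
  "vector_field X \<longleftrightarrow> smooth X \<and> (\<forall>\<gamma>\<in>lattice. \<forall>p. X (gmul \<gamma> p) = dtrans \<gamma> p (X p))"

definition lie_bracket :: "(point \<Rightarrow> point) \<Rightarrow> (point \<Rightarrow> point) \<Rightarrow> point \<Rightarrow> point" where
  "lie_bracket X Y p =
     frechet_derivative Y (at p) (X p) - frechet_derivative X (at p) (Y p)"


section \<open>Almost complex structures and Riemannian metrics\<close>

definition almost_complex :: "(point \<Rightarrow> point \<Rightarrow> point) \<Rightarrow> bool" where
  "almost_complex J \<longleftrightarrow>
     (\<forall>p. linear (J p) \<and> (\<forall>v. J p (J p v) = - v)) \<and>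
     (\<forall>v. smooth (\<lambda>p. J p v)) \<and>
     (\<forall>\<gamma>\<in>lattice. \<forall>p v. J (gmul \<gamma> p) (dtrans \<gamma> p v) = dtrans \<gamma> p (J p v))"

definition left_invariant_endo :: "(point \<Rightarrow> point \<Rightarrow> point) \<Rightarrow> bool" where
  "left_invariant_endo J \<longleftrightarrow>
     (\<exists>M :: coord \<Rightarrow> coord \<Rightarrow> real. \<forall>p j. J p (frame j p) = (\<Sum>i\<in>UNIV. M i j *\<^sub>R frame i p))"

text \<open>The almost complex structures \<open>J\<^bsub>a,b,c\<^esub>\<close> exist.\<close>

lemma smooth_affine:
  assumes "bounded_linear L" and "\<And>x. f x = L x + d"
  shows "smooth f"
proof -
  interpret bounded_linear L by fact
  have f: "f = (\<lambda>x. L x + d)" using assms(2) by auto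
  have "(f has_derivative L) (at x)" for x
    unfolding f by (auto intro!: derivative_eq_intros has_derivative)
  then have der: "frechet_derivative f (at x) = L" and diff: "f differentiable at x" for x
    using frechet_derivative_at by (metis, auto simp: differentiable_def)
  have const: "continuously_differentiable k (\<lambda>x::'a. d::'b)" for k d
    by (induction k arbitrary: d) auto
  have "continuously_differentiable k f" for k
    using diff by (cases k)
      (auto simp: der const intro!: differentiable_imp_continuous_on simp: differentiable_on_eq_differentiable_at)
  then show ?thesis by (simp add: smooth_def)
qed

lemma acs_exists:
  assumes "a \<noteq> 0" "b \<noteq> 0" "c \<noteq> 0"
  shows "\<exists>J. almost_complex J \<and> left_invariant_endo J \<and>
    (\<forall>p. J p (frame Cx1 p) = a *\<^sub>R frame Cx2 p) \<and>
    (\<forall>p. J p (frame Cy1 p) = b *\<^sub>R frame Cy2 p) \<and>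
    (\<forall>p. J p (frame Ct p) = c *\<^sub>R frame Cz p)"
proof -
  define J :: "point \<Rightarrow> point \<Rightarrow> point" where
    "J = (\<lambda>p v. \<chi> i. case i of
       Cx1 \<Rightarrow> - v $ Cx2 / a | Cx2 \<Rightarrow> a * v $ Cx1
     | Cy1 \<Rightarrow> - v $ Cy2 / b | Cy2 \<Rightarrow> b * v $ Cy1
     | Cz \<Rightarrow> c * v $ Ct - p $ Cx1 * v $ Cy2 / b + p $ Cx2 * b * v $ Cy1
     | Ct \<Rightarrow> - (v $ Cz - p $ Cx1 * v $ Cy1 - p $ Cx2 * v $ Cy2) / c)"
  have dt: "dtrans \<gamma> p = (\<lambda>v. v + (\<gamma> $ Cx1 * v $ Cy1 + \<gamma> $ Cx2 * v $ Cy2) *\<^sub>R axis Cz 1)" for \<gamma> p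
    using frechet_derivative_at[OF has_derivative_gmul] by simp
  have "linear (J p)" for p
    by (rule linearI) (auto simp: J_def vec_eq_iff field_simps assms split: coord.split)
  moreover have "J p (J p v) = - v" for p v
    by (auto simp: J_def vec_eq_iff field_simps assms split: coord.split)
  moreover have "smooth (\<lambda>p. J p v)" for v
  proof (rule smooth_affine)
    show "bounded_linear (\<lambda>p. J p v - J 0 v)"
      by (intro linear_conv_bounded_linear[THEN iffD1] linearI)
        (auto simp: J_def vec_eq_iff field_simps assms split: coord.split)
  qed auto
  moreover have "J (gmul \<gamma> p) (dtrans \<gamma> p v) = dtrans \<gamma> p (J p v)" for \<gamma> p v
    unfolding dt
    by (auto simp: J_def vec_eq_iff field_simps assms gmul_def axis_def split: coord.split)
  moreover have "left_invariant_endo J"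
    unfolding left_invariant_endo_def
    by (rule exI[of _ "\<lambda>i j. case j of
           Cx1 \<Rightarrow> (if i = Cx2 then a else 0) | Cx2 \<Rightarrow> (if i = Cx1 then - 1 / a else 0)
         | Cy1 \<Rightarrow> (if i = Cy2 then b else 0) | Cy2 \<Rightarrow> (if i = Cy1 then - 1 / b else 0)
         | Ct \<Rightarrow> (if i = Cz then c else 0) | Cz \<Rightarrow> (if i = Ct then - 1 / c else 0)"])
      (auto simp: J_def vec_eq_iff UNIV_coord frame_def axis_def assms field_simps
        split: coord.split intro: coord.exhaust)
  ultimately show ?thesis
    by (intro exI[of _ J])
      (auto simp: almost_complex_def J_def vec_eq_iff frame_def axis_def assms split: coord.split)
qed

definition nijenhuis ::
  "(point \<Rightarrow> point \<Rightarrow> point) \<Rightarrow> (point \<Rightarrow> point) \<Rightarrow> (point \<Rightarrow> point) \<Rightarrow> point \<Rightarrow> point" where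
  "nijenhuis J X Y p =
     lie_bracket (\<lambda>q. J q (X q)) (\<lambda>q. J q (Y q)) p
     - J p (lie_bracket (\<lambda>q. J q (X q)) Y p)
     - J p (lie_bracket X (\<lambda>q. J q (Y q)) p)
     - lie_bracket X Y p"

definition integrable_acs :: "(point \<Rightarrow> point \<Rightarrow> point) \<Rightarrow> bool" where
  "integrable_acs J \<longleftrightarrow>
     (\<forall>X Y. vector_field X \<longrightarrow> vector_field Y \<longrightarrow> (\<forall>p. nijenhuis J X Y p = 0))"

definition riemannian_metric :: "(point \<Rightarrow> point \<Rightarrow> point \<Rightarrow> real) \<Rightarrow> bool" where
  "riemannian_metric g \<longleftrightarrow>
     (\<forall>p. bilinear (g p) \<and> (\<forall>v w. g p v w = g p w v) \<and> (\<forall>v. v \<noteq> 0 \<longrightarrow> g p v v > 0)) \<and>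
     (\<forall>v w. smooth (\<lambda>p. g p v w)) \<and>
     (\<forall>\<gamma>\<in>lattice. \<forall>p v w. g (gmul \<gamma> p) (dtrans \<gamma> p v) (dtrans \<gamma> p w) = g p v w)"

definition left_invariant_metric :: "(point \<Rightarrow> point \<Rightarrow> point \<Rightarrow> real) \<Rightarrow> bool" where
  "left_invariant_metric g \<longleftrightarrow>
     (\<exists>M :: coord \<Rightarrow> coord \<Rightarrow> real. \<forall>p i j. g p (frame i p) (frame j p) = M i j)"

definition compatible ::
  "(point \<Rightarrow> point \<Rightarrow> point \<Rightarrow> real) \<Rightarrow> (point \<Rightarrow> point \<Rightarrow> point) \<Rightarrow> bool" where
  "compatible g J \<longleftrightarrow> (\<forall>p v w. g p (J p v) (J p w) = g p v w)"


section \<open>Complex differential forms\<close>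

text \<open>
  A complex \<open>k\<close>-covector is an alternating complex-multilinear function of \<open>k\<close> vectors of the
  complexified tangent space \<open>\<complex>\<^sup>6\<close>. The arguments form a list; to make covectors
  extensional, they vanish on lists of any other length.
\<close>

type_synonym covector = "cvec list \<Rightarrow> complex"
type_synonym form = "point \<Rightarrow> covector"

definition of_real_vec :: "point \<Rightarrow> cvec" where
  "of_real_vec v = (\<chi> i. complex_of_real (v $ i))"

definition re_vec :: "cvec \<Rightarrow> point" where
  "re_vec v = (\<chi> i. Re (v $ i))"

definition im_vec :: "cvec \<Rightarrow> point" where
  "im_vec v = (\<chi> i. Im (v $ i))"

definition cnj_vec :: "cvec \<Rightarrow> cvec" where
  "cnj_vec v = (\<chi> i. cnj (v $ i))"

definition complexify :: "(point \<Rightarrow> point) \<Rightarrow> cvec \<Rightarrow> cvec" where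
  "complexify L v = of_real_vec (L (re_vec v)) + \<i> *s of_real_vec (L (im_vec v))"

definition covectors :: "nat \<Rightarrow> covector set" where
  "covectors k = {A.
     (\<forall>vs. length vs \<noteq> k \<longrightarrow> A vs = 0) \<and>
     (\<forall>vs i u w. length vs = k \<longrightarrow> i < k \<longrightarrow> A (vs[i := u + w]) = A (vs[i := u]) + A (vs[i := w])) \<and>
     (\<forall>vs i u c. length vs = k \<longrightarrow> i < k \<longrightarrow> A (vs[i := c *s u]) = c * A (vs[i := u])) \<and>
     (\<forall>vs i j. length vs = k \<longrightarrow> i < j \<longrightarrow> j < k \<longrightarrow> vs ! i = vs ! j \<longrightarrow> A vs = 0)}"

definition pullback :: "point \<Rightarrow> form \<Rightarrow> form" where
  "pullback \<gamma> \<omega> = (\<lambda>p vs. \<omega> (gmul \<gamma> p) (map (complexify (dtrans \<gamma> p)) vs))"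

definition forms :: "nat \<Rightarrow> form set" where
  "forms k = {\<omega>. (\<forall>p. \<omega> p \<in> covectors k) \<and> (\<forall>vs. smooth (\<lambda>p. \<omega> p vs)) \<and>
                 (\<forall>\<gamma>\<in>lattice. pullback \<gamma> \<omega> = \<omega>)}"

definition cderiv :: "(point \<Rightarrow> complex) \<Rightarrow> point \<Rightarrow> cvec \<Rightarrow> complex" where
  "cderiv f p v = frechet_derivative f (at p) (re_vec v) + \<i> * frechet_derivative f (at p) (im_vec v)"

text \<open>
  Cartan's formula for constant vector fields on \<open>\<real>\<^sup>6\<close>, whose brackets vanish; it is
  normalised so that \<open>d (f dx) = df \<and> dx\<close> with
  \<open>(\<alpha> \<and> \<beta>) (u, v) = \<alpha> u * \<beta> v - \<alpha> v * \<beta> u\<close>.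
\<close>

definition ext_d :: "form \<Rightarrow> form" where
  "ext_d \<omega> = (\<lambda>p vs. \<Sum>i<length vs.
     (-1) ^ i * cderiv (\<lambda>q. \<omega> q (take i vs @ drop (Suc i) vs)) p (vs ! i))"

definition covector_scale :: "complex \<Rightarrow> covector \<Rightarrow> covector" where
  "covector_scale c A = (\<lambda>vs. c * A vs)"

definition form_scale :: "complex \<Rightarrow> form \<Rightarrow> form" where
  "form_scale c \<omega> = (\<lambda>p vs. c * \<omega> p vs)"

interpretation cov: vector_space covector_scale
  by standard (auto simp: covector_scale_def algebra_simps fun_eq_iff)

interpretation cform: vector_space form_scale
  by standard (auto simp: form_scale_def algebra_simps fun_eq_iff)

definition form_cnj :: "form \<Rightarrow> form" where
  "form_cnj \<omega> = (\<lambda>p vs. cnj (\<omega> p (map cnj_vec vs)))"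

definition one_form :: "(point \<Rightarrow> cvec \<Rightarrow> complex) \<Rightarrow> form" where
  "one_form f = (\<lambda>p vs. case vs of [v] \<Rightarrow> f p v | _ \<Rightarrow> 0)"


section \<open>Bidegree and the Dolbeault operator\<close>

text \<open>
  In the following, \<open>j\<close> is the value of an almost complex structure at a point. The projections
  onto its \<open>\<i>\<close>- and \<open>-\<i>\<close>-eigenspaces on the complexified tangent space split each vector as
  \<open>v = proj10 j v + proj01 j v\<close>. Expanding a \<open>(p + q)\<close>-covector multilinearly, its
  \<open>(p, q)\<close>-component collects the terms with exactly \<open>p\<close> arguments in the \<open>\<i>\<close>-eigenspace.
\<close>

definition proj10 :: "(point \<Rightarrow> point) \<Rightarrow> cvec \<Rightarrow> cvec" where
  "proj10 j v = (1/2) *s (v - \<i> *s complexify j v)"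

definition proj01 :: "(point \<Rightarrow> point) \<Rightarrow> cvec \<Rightarrow> cvec" where
  "proj01 j v = (1/2) *s (v + \<i> *s complexify j v)"

definition pq_part :: "(point \<Rightarrow> point) \<Rightarrow> nat \<Rightarrow> nat \<Rightarrow> covector \<Rightarrow> covector" where
  "pq_part j p q A = (\<lambda>vs. if length vs = p + q
     then \<Sum>S | S \<subseteq> {..<p + q} \<and> card S = p.
       A (map (\<lambda>i. if i \<in> S then proj10 j (vs ! i) else proj01 j (vs ! i)) [0..<p + q])
     else 0)"

definition pq_covectors :: "(point \<Rightarrow> point) \<Rightarrow> nat \<Rightarrow> nat \<Rightarrow> covector set" where
  "pq_covectors j p q = {A \<in> covectors (p + q). pq_part j p q A = A}"

definition pq_forms :: "(point \<Rightarrow> point \<Rightarrow> point) \<Rightarrow> nat \<Rightarrow> nat \<Rightarrow> form set" where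
  "pq_forms J p q = {\<omega> \<in> forms (p + q). \<forall>x. \<omega> x \<in> pq_covectors (J x) p q}"

text \<open>The operator \<open>dbar J p q\<close> acts on forms of bidegree \<open>(p, q)\<close>.\<close>

definition dbar :: "(point \<Rightarrow> point \<Rightarrow> point) \<Rightarrow> nat \<Rightarrow> nat \<Rightarrow> form \<Rightarrow> form" where
  "dbar J p q \<omega> = (\<lambda>x. pq_part (J x) p (Suc q) (ext_d \<omega> x))"

definition global_frame :: "(point \<Rightarrow> point \<Rightarrow> point) \<Rightarrow> nat \<Rightarrow> nat \<Rightarrow> form list \<Rightarrow> bool" where
  "global_frame J p q \<Phi> \<longleftrightarrow> set \<Phi> \<subseteq> pq_forms J p q \<and>
     (\<forall>x. distinct (map (\<lambda>\<phi>. \<phi> x) \<Phi>) \<and>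
          cov.independent ((\<lambda>\<phi>. \<phi> x) ` set \<Phi>) \<and>
          cov.span ((\<lambda>\<phi>. \<phi> x) ` set \<Phi>) = pq_covectors (J x) p q)"


section \<open>The Dolbeault Laplacian\<close>

definition gram :: "(point \<Rightarrow> point \<Rightarrow> point \<Rightarrow> real) \<Rightarrow> point \<Rightarrow> real ^ coord ^ coord" where
  "gram g p = (\<chi> i j. g p (axis i 1) (axis j 1))"

text \<open>
  The Hermitian inner product induced by \<open>g\<close> on \<open>k\<close>-covectors: indices are raised with the
  inverse Gram matrix, and the factor \<open>1 / k!\<close> makes wedge products of \<open>g\<close>-orthonormal
  covectors orthonormal.
\<close>

definition covector_inner ::
  "(point \<Rightarrow> point \<Rightarrow> point \<Rightarrow> real) \<Rightarrow> point \<Rightarrow> nat \<Rightarrow> covector \<Rightarrow> covector \<Rightarrow> complex" where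
  "covector_inner g p k A B = (1 / fact k) *
     (\<Sum>I | length I = k. \<Sum>K | length K = k.
        complex_of_real (\<Prod>m<k. matrix_inv (gram g p) $ (I ! m) $ (K ! m)) *
        A (map (\<lambda>i. axis i 1) I) * cnj (B (map (\<lambda>i. axis i 1) K)))"

text \<open>
  The \<open>L\<^sup>2\<close> product on the quotient is computed on the unit cube, a fundamental domain for
  the left action of the lattice (up to a null set), against the Riemannian volume.
\<close>

definition l2_inner ::
  "(point \<Rightarrow> point \<Rightarrow> point \<Rightarrow> real) \<Rightarrow> nat \<Rightarrow> form \<Rightarrow> form \<Rightarrow> complex" where
  "l2_inner g k \<alpha> \<beta> = integral (cbox 0 1)
     (\<lambda>p. covector_inner g p k (\<alpha> p) (\<beta> p) * complex_of_real (sqrt (det (gram g p))))"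

text \<open>
  The formal adjoint, acting on forms of bidegree \<open>(p, q)\<close>; by convention it is zero for
  \<open>q = 0\<close>. It is unique because the \<open>L\<^sup>2\<close> product is definite on smooth forms.
\<close>

definition dbar_star ::
  "(point \<Rightarrow> point \<Rightarrow> point \<Rightarrow> real) \<Rightarrow> (point \<Rightarrow> point \<Rightarrow> point) \<Rightarrow> nat \<Rightarrow> nat \<Rightarrow> form \<Rightarrow> form" where
  "dbar_star g J p q \<beta> = (case q of 0 \<Rightarrow> 0 | Suc r \<Rightarrow>
     (THE \<alpha>. \<alpha> \<in> pq_forms J p r \<and>
        (\<forall>\<eta>\<in>pq_forms J p r. l2_inner g (p + q) (dbar J p r \<eta>) \<beta> = l2_inner g (p + r) \<eta> \<alpha>)))"

definition dolbeault_laplacian ::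
  "(point \<Rightarrow> point \<Rightarrow> point \<Rightarrow> real) \<Rightarrow> (point \<Rightarrow> point \<Rightarrow> point) \<Rightarrow> nat \<Rightarrow> nat \<Rightarrow> form \<Rightarrow> form" where
  "dolbeault_laplacian g J p q s =
     (case q of 0 \<Rightarrow> 0 | Suc r \<Rightarrow> dbar J p r (dbar_star g J p q s))
     + dbar_star g J p (Suc q) (dbar J p q s)"

definition harmonic_forms ::
  "(point \<Rightarrow> point \<Rightarrow> point \<Rightarrow> real) \<Rightarrow> (point \<Rightarrow> point \<Rightarrow> point) \<Rightarrow> nat \<Rightarrow> nat \<Rightarrow> form set" where
  "harmonic_forms g J p q = {s \<in> pq_forms J p q. dolbeault_laplacian g J p q s = 0}"


section \<open>Dolbeault cohomology\<close>

definition dbar_closed :: "(point \<Rightarrow> point \<Rightarrow> point) \<Rightarrow> nat \<Rightarrow> nat \<Rightarrow> form set" where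
  "dbar_closed J p q = {\<omega> \<in> pq_forms J p q. dbar J p q \<omega> = 0}"

definition dbar_exact :: "(point \<Rightarrow> point \<Rightarrow> point) \<Rightarrow> nat \<Rightarrow> nat \<Rightarrow> form set" where
  "dbar_exact J p q = (case q of 0 \<Rightarrow> {0} | Suc r \<Rightarrow> dbar J p r ` pq_forms J p r)"

definition cohomologous :: "(point \<Rightarrow> point \<Rightarrow> point) \<Rightarrow> nat \<Rightarrow> nat \<Rightarrow> (form \<times> form) set" where
  "cohomologous J p q =
     {(\<alpha>, \<beta>). \<alpha> \<in> dbar_closed J p q \<and> \<beta> \<in> dbar_closed J p q \<and> \<alpha> - \<beta> \<in> dbar_exact J p q}"

definition dolbeault_class ::
  "(point \<Rightarrow> point \<Rightarrow> point) \<Rightarrow> nat \<Rightarrow> nat \<Rightarrow> form \<Rightarrow> form set" where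
  "dolbeault_class J p q \<omega> = cohomologous J p q `` {\<omega>}"

definition dolbeault_cohomology ::
  "(point \<Rightarrow> point \<Rightarrow> point) \<Rightarrow> nat \<Rightarrow> nat \<Rightarrow> form set set" where
  "dolbeault_cohomology J p q = dbar_closed J p q // cohomologous J p q"

definition class_add ::
  "(point \<Rightarrow> point \<Rightarrow> point) \<Rightarrow> nat \<Rightarrow> nat \<Rightarrow> form set \<Rightarrow> form set \<Rightarrow> form set" where
  "class_add J p q A B = (\<Union>\<alpha>\<in>A. \<Union>\<beta>\<in>B. dolbeault_class J p q (\<alpha> + \<beta>))"

definition class_scale ::
  "(point \<Rightarrow> point \<Rightarrow> point) \<Rightarrow> nat \<Rightarrow> nat \<Rightarrow> complex \<Rightarrow> form set \<Rightarrow> form set" where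
  "class_scale J p q c A = (\<Union>\<alpha>\<in>A. dolbeault_class J p q (form_scale c \<alpha>))"

text \<open>
  A complex-linear isomorphism from a linear subspace \<open>V\<close> of the space of forms onto the
  Dolbeault cohomology.
\<close>

definition iso_to_cohomology ::
  "(point \<Rightarrow> point \<Rightarrow> point) \<Rightarrow> nat \<Rightarrow> nat \<Rightarrow> form set \<Rightarrow> (form \<Rightarrow> form set) \<Rightarrow> bool" where
  "iso_to_cohomology J p q V f \<longleftrightarrow>
     cform.subspace V \<and> bij_betw f V (dolbeault_cohomology J p q) \<and>
     (\<forall>\<alpha>\<in>V. \<forall>\<beta>\<in>V. f (\<alpha> + \<beta>) = class_add J p q (f \<alpha>) (f \<beta>)) \<and>
     (\<forall>c. \<forall>\<alpha>\<in>V. f (form_scale c \<alpha>) = class_scale J p q c (f \<alpha>))"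


section \<open>The forms of the theorem\<close>

definition phi1 :: "real \<Rightarrow> form" where
  "phi1 a = one_form (\<lambda>p v. v $ Cx1 + \<i> / a * v $ Cx2)"

definition phi2 :: "real \<Rightarrow> form" where
  "phi2 b = one_form (\<lambda>p v. v $ Cy1 + \<i> / b * v $ Cy2)"

definition phi3 :: "real \<Rightarrow> form" where
  "phi3 c = one_form (\<lambda>p v. v $ Ct + \<i> / c * (v $ Cz - p $ Cx1 * v $ Cy1 - p $ Cx2 * v $ Cy2))"

end

theory Submission
  imports Defs
begin

text \<open>
  Write \<open>V\<^sub>i\<close> for the left-invariant \<open>(1, 0)\<close>-fields dual to \<open>\<phi>\<^sup>i\<close>, and \<open>s = \<Sum> f\<^sub>i cnj \<phi>\<^sup>i\<close>.
  A harmonic \<open>s\<close> is closed and coclosed, by pairing the Laplacian with \<open>s\<close>. The first-order equations and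
  the centrality of \<open>V\<^sub>3\<close> show that the constant-coefficient operator
  \<open>L = \<Sum> h\<^sub>i\<^sub>j V\<^sub>j cnj V\<^sub>i\<close> annihilates \<open>f\<^sub>3\<close>, and an energy estimate (integration by parts over a
  fundamental cube) makes \<open>f\<^sub>3\<close> constant. Then \<open>f\<^sub>1, f\<^sub>2\<close> do not depend on \<open>z, t\<close>;
  integrating \<open>cnj V\<^sub>1 f\<^sub>2 - cnj V\<^sub>2 f\<^sub>1 + i (1 - a b) / (4 c) f\<^sub>3 = 0\<close> kills \<open>f\<^sub>3\<close> when \<open>a b \<noteq> 1\<close>,
  and \<open>L\<close> annihilates \<open>f\<^sub>1, f\<^sub>2\<close> as well.

  For \<open>a b = 1\<close> the fields \<open>cnj V\<^sub>i\<close> commute. A closed form is reduced to a constant one by solving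
  \<open>(\<partial>\<^bsub>e\<^sub>1\<^esub> + i c \<partial>\<^bsub>e\<^sub>2\<^esub>) u = F - mean F\<close> on two-dimensional tori, successively in the \<open>(t, z)\<close>, \<open>(x\<^sub>1, x\<^sub>2)\<close> and
  \<open>(y\<^sub>1, y\<^sub>2)\<close> directions. The solution is the integral of
  \<open>F - \<partial>\<^bsub>e\<^sub>2\<^esub>\<^sup>2 F / (4 \<pi>\<^sup>2)\<close> against an explicit continuous kernel, hence smooth in all variables.
\<close>

section \<open>Calculus of smooth functions\<close>

text \<open>The fibre has to be treated first. Left translation by a lattice element shears z by
  multiples of the y-coordinates, so a function on the quotient need not be periodic in the
  x-directions, and the lattice translations do not commute with translations along y. Both
  obstructions disappear for functions that do not depend on z, while the central directions t and z
  meet neither. The correction of F in the kernel integral is dictated by convergence. The exact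
  kernel has Fourier coefficients that are bounded in the mode n, but its series does not converge
  uniformly. Dividing them by 1 + n^2 cures this, and the corrected function has n-th coefficient 1
  + n^2 times that of F, so the two changes cancel. Every derivative of the solution falls on F,
  never on the kernel. What remains is uniqueness: a function whose nonzero coefficients vanish must
  equal its mean, and this is needed at one interior point only, since translations move that point
  anywhere.\<close>

definition dird :: "'a::real_normed_vector \<Rightarrow> ('a \<Rightarrow> 'b::real_normed_vector) \<Rightarrow> 'a \<Rightarrow> 'b" where
  "dird v f = (\<lambda>x. frechet_derivative f (at x) v)"

abbreviation cdiff :: "nat \<Rightarrow> ('a::real_normed_vector \<Rightarrow> 'b::real_normed_vector) \<Rightarrow> bool" where
  "cdiff \<equiv> continuously_differentiable"

lemma has_derivative_dird: "(f has_derivative D) (at x) \<Longrightarrow> dird v f x = D v"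
  unfolding dird_def using frechet_derivative_at by metis

lemma dird_eqI: "(\<And>x. (f has_derivative D x) (at x)) \<Longrightarrow> dird v f = (\<lambda>x. D x v)"
  by (rule ext) (rule has_derivative_dird)

lemma cdiff_Suc: "cdiff (Suc k) f \<longleftrightarrow> (\<forall>x. f differentiable (at x)) \<and> (\<forall>v. cdiff k (dird v f))"
  by (simp add: dird_def)

declare continuously_differentiable.simps(2) [simp del]

lemma differentiable_has_derivative_dird:
  "f differentiable (at x) \<Longrightarrow> (f has_derivative (\<lambda>v. dird v f x)) (at x)"
  unfolding dird_def using frechet_derivative_works by fastforce

lemma cdiff_imp_continuous: "cdiff k f \<Longrightarrow> continuous_on UNIV f"
  by (cases k) (auto intro!: differentiable_imp_continuous_on
      simp: differentiable_on_eq_differentiable_at cdiff_Suc)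

lemma cdiff_SucD: "cdiff (Suc k) f \<Longrightarrow> cdiff k f"
proof (induction k arbitrary: f)
  case 0
  then show ?case using cdiff_imp_continuous[OF 0] by simp
next
  case (Suc k)
  then show ?case unfolding cdiff_Suc[of "Suc k"] cdiff_Suc[of k f] by blast
qed

text \<open>All closure properties below are proved by this rule: the derivative of a sum, product
  or composite is an expression of the same shape, so the induction hypothesis applies to
  it.\<close>

lemma cdiff_SucI:
  assumes "\<And>x. (f has_derivative D x) (at x)" "\<And>v. cdiff k (\<lambda>x. D x v)"
  shows "cdiff (Suc k) f"
proof -
  have "dird v f = (\<lambda>x. D x v)" for v by (rule dird_eqI) (rule assms(1))
  then show ?thesis using assms by (auto simp: cdiff_Suc differentiable_def)
qed

lemma cdiff_Suc_has_derivative: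
  "cdiff (Suc k) f \<Longrightarrow> (f has_derivative (\<lambda>v. dird v f x)) (at x)"
  using cdiff_Suc differentiable_has_derivative_dird by blast

lemma cdiff_const: "cdiff k (\<lambda>x. c)"
proof (induction k arbitrary: c)
  case (Suc k)
  show ?case by (rule cdiff_SucI[where D = "\<lambda>x v. 0"]) (auto intro: Suc)
qed simp

lemma cdiff_add: "cdiff k f \<Longrightarrow> cdiff k g \<Longrightarrow> cdiff k (\<lambda>x. f x + g x)"
proof (induction k arbitrary: f g)
  case (Suc k)
  show ?case
  proof (rule cdiff_SucI[where D = "\<lambda>x v. dird v f x + dird v g x"])
    show "((\<lambda>x. f x + g x) has_derivative (\<lambda>v. dird v f x + dird v g x)) (at x)" for x
      by (intro has_derivative_add cdiff_Suc_has_derivative[OF Suc.prems(1)]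
          cdiff_Suc_has_derivative[OF Suc.prems(2)])
    show "cdiff k (\<lambda>x. dird v f x + dird v g x)" for v
      using Suc.prems by (intro Suc.IH) (auto simp: cdiff_Suc)
  qed
qed (auto intro: continuous_intros)

lemma (in bounded_bilinear) cdiff_prod:
  "cdiff k f \<Longrightarrow> cdiff k g \<Longrightarrow> cdiff k (\<lambda>x. prod (f x) (g x))"
proof (induction k arbitrary: f g)
  case (Suc k)
  show ?case
  proof (rule cdiff_SucI[where D = "\<lambda>x v. prod (f x) (dird v g x) + prod (dird v f x) (g x)"])
    show "((\<lambda>x. prod (f x) (g x)) has_derivative
        (\<lambda>v. prod (f x) (dird v g x) + prod (dird v f x) (g x))) (at x)" for x
      by (intro FDERIV cdiff_Suc_has_derivative[OF Suc.prems(1)]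
          cdiff_Suc_has_derivative[OF Suc.prems(2)])
    show "cdiff k (\<lambda>x. prod (f x) (dird v g x) + prod (dird v f x) (g x))" for v
      using Suc.prems cdiff_SucD[OF Suc.prems(1)] cdiff_SucD[OF Suc.prems(2)]
      by (intro Suc.IH cdiff_add) (auto simp: cdiff_Suc)
  qed
qed (auto intro: continuous_on)

lemma (in bounded_linear) cdiff_linear: "cdiff k g \<Longrightarrow> cdiff k (\<lambda>x. f (g x))"
proof (induction k arbitrary: g)
  case (Suc k)
  show ?case
  proof (rule cdiff_SucI[where D = "\<lambda>x v. f (dird v g x)"])
    show "((\<lambda>x. f (g x)) has_derivative (\<lambda>v. f (dird v g x))) (at x)" for x
      by (intro has_derivative cdiff_Suc_has_derivative[OF Suc.prems(1)])
    show "cdiff k (\<lambda>x. f (dird v g x))" for v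
      using Suc.prems by (intro Suc.IH) (auto simp: cdiff_Suc)
  qed
qed (auto intro: continuous_on)

lemma has_derivative_affine:
  assumes "bounded_linear L" "\<And>x. h x = L x + d"
  shows "(h has_derivative L) (at x)"
proof -
  have h: "h = (\<lambda>x. L x + d)" using assms(2) by auto
  show ?thesis
    unfolding h using bounded_linear.has_derivative[OF assms(1) has_derivative_ident]
    by (auto intro!: derivative_eq_intros)
qed

text \<open>With an affine inner map the derivative is again a composite with the same inner map,
  with \<open>f\<close> replaced by one of its directional derivatives, so the induction closes
  without a product rule.\<close>

lemma cdiff_compose_affine:
  assumes L: "bounded_linear L" "\<And>x. h x = L x + d"
  shows "cdiff k f \<Longrightarrow> cdiff k (\<lambda>x. f (h x))"
proof (induction k arbitrary: f)
  case 0
  have "continuous_on UNIV h"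
    using has_derivative_affine[OF L, THEN has_derivative_continuous]
    by (simp add: continuous_at_imp_continuous_on)
  then show ?case using 0 by (auto intro: continuous_on_compose2[where t = UNIV and g = f])
next
  case (Suc k)
  show ?case
  proof (rule cdiff_SucI[where D = "\<lambda>x v. dird (L v) f (h x)"])
    show "((\<lambda>x. f (h x)) has_derivative (\<lambda>v. dird (L v) f (h x))) (at x)" for x
      by (rule has_derivative_compose[OF has_derivative_affine[OF L]
            cdiff_Suc_has_derivative[OF Suc.prems]])
    show "cdiff k (\<lambda>x. dird (L v) f (h x))" for v
      using Suc.prems by (intro Suc.IH) (auto simp: cdiff_Suc)
  qed
qed

lemma smooth_has_derivative: "smooth f \<Longrightarrow> (f has_derivative (\<lambda>v. dird v f x)) (at x)"
  using cdiff_Suc_has_derivative smooth_def by blast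

lemma smooth_continuous: "smooth f \<Longrightarrow> continuous_on S f"
  using cdiff_imp_continuous smooth_def continuous_on_subset subset_UNIV by metis

lemma smooth_dird: "smooth f \<Longrightarrow> smooth (dird v f)"
  using smooth_def cdiff_Suc by blast

lemma smooth_const: "smooth (\<lambda>x. c)"
  by (simp add: smooth_def cdiff_const)

lemma smooth_add: "smooth f \<Longrightarrow> smooth g \<Longrightarrow> smooth (\<lambda>x. f x + g x)"
  by (simp add: smooth_def cdiff_add)

lemma (in bounded_bilinear) smooth_prod:
  "smooth f \<Longrightarrow> smooth g \<Longrightarrow> smooth (\<lambda>x. prod (f x) (g x))"
  by (simp add: smooth_def cdiff_prod)

lemma (in bounded_linear) smooth_linear: "smooth g \<Longrightarrow> smooth (\<lambda>x. f (g x))"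
  by (simp add: smooth_def cdiff_linear)

lemma smooth_compose_affine:
  "bounded_linear L \<Longrightarrow> (\<And>x. h x = L x + d) \<Longrightarrow> smooth f \<Longrightarrow> smooth (\<lambda>x. f (h x))"
  using cdiff_compose_affine smooth_def by metis

lemma smooth_ident: "smooth (\<lambda>x. x)"
  by (rule smooth_affine[where L = "\<lambda>x. x" and d = 0]) (simp_all add: bounded_linear_ident)

lemmas smooth_mult = bounded_bilinear.smooth_prod[OF bounded_bilinear_mult]
lemmas smooth_scaleR = bounded_bilinear.smooth_prod[OF bounded_bilinear_scaleR]
lemmas smooth_cnj = bounded_linear.smooth_linear[OF bounded_linear_cnj]
lemmas smooth_uminus = bounded_linear.smooth_linear[OF bounded_linear_minus[OF bounded_linear_ident]]

lemma smooth_of_real: "smooth f \<Longrightarrow> smooth (\<lambda>x. complex_of_real (f x))"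
  by (rule bounded_linear.smooth_linear[OF bounded_linear_of_real])

lemma smooth_vec_nth: "smooth (\<lambda>x::real^'n. x $ i)"
  by (rule bounded_linear.smooth_linear[OF bounded_linear_vec_nth smooth_ident])

lemma smooth_diff: "smooth f \<Longrightarrow> smooth g \<Longrightarrow> smooth (\<lambda>x. f x - g x)"
  using smooth_add[OF _ smooth_uminus, of f g] by simp

lemma smooth_sum: "(\<And>i. i \<in> I \<Longrightarrow> smooth (f i)) \<Longrightarrow> smooth (\<lambda>x. \<Sum>i\<in>I. f i x)"
  by (induction I rule: infinite_finite_induct) (auto intro: smooth_const smooth_add)

lemma smooth_translate: "smooth f \<Longrightarrow> smooth (\<lambda>x. f (x + d))"
  by (rule smooth_compose_affine[OF bounded_linear_ident]) auto

lemmas smooth_intros = smooth_const smooth_add smooth_diff smooth_mult smooth_scaleR smooth_cnj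
  smooth_uminus smooth_of_real smooth_vec_nth smooth_sum smooth_dird smooth_ident

lemma dird_const [simp]: "dird v (\<lambda>x. c) = (\<lambda>x. 0)"
  by (rule dird_eqI[where D = "\<lambda>x v. 0"]) simp

lemma dird_add: "smooth f \<Longrightarrow> smooth g \<Longrightarrow> dird v (\<lambda>x. f x + g x) = (\<lambda>x. dird v f x + dird v g x)"
  by (rule dird_eqI[where D = "\<lambda>x v. dird v f x + dird v g x"])
    (intro has_derivative_add smooth_has_derivative)

lemma dird_diff: "smooth f \<Longrightarrow> smooth g \<Longrightarrow> dird v (\<lambda>x. f x - g x) = (\<lambda>x. dird v f x - dird v g x)"
  by (rule dird_eqI[where D = "\<lambda>x v. dird v f x - dird v g x"])
    (intro has_derivative_diff smooth_has_derivative)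

lemma dird_sum:
  "(\<And>i. i \<in> I \<Longrightarrow> smooth (f i)) \<Longrightarrow> dird v (\<lambda>x. \<Sum>i\<in>I. f i x) = (\<lambda>x. \<Sum>i\<in>I. dird v (f i) x)"
  by (rule dird_eqI[where D = "\<lambda>x v. \<Sum>i\<in>I. dird v (f i) x"])
    (intro has_derivative_sum smooth_has_derivative)

lemma (in bounded_bilinear) dird_prod:
  "smooth f \<Longrightarrow> smooth g \<Longrightarrow>
    dird v (\<lambda>x. prod (f x) (g x)) = (\<lambda>x. prod (f x) (dird v g x) + prod (dird v f x) (g x))"
  by (rule dird_eqI[where D = "\<lambda>x v. prod (f x) (dird v g x) + prod (dird v f x) (g x)"])
    (intro FDERIV smooth_has_derivative)

lemma (in bounded_linear) dird_linear: "smooth g \<Longrightarrow> dird v (\<lambda>x. f (g x)) = (\<lambda>x. f (dird v g x))"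
  by (rule dird_eqI[where D = "\<lambda>x v. f (dird v g x)"]) (intro has_derivative smooth_has_derivative)

lemmas dird_mult = bounded_bilinear.dird_prod[OF bounded_bilinear_mult]
lemmas dird_cnj = bounded_linear.dird_linear[OF bounded_linear_cnj]

lemma dird_cmult:
  fixes f :: "'a::real_normed_vector \<Rightarrow> complex"
  shows "smooth f \<Longrightarrow> dird v (\<lambda>x. k * f x) = (\<lambda>x. k * dird v f x)"
  by (simp add: dird_mult[OF smooth_const])

lemma dird_affine:
  assumes "bounded_linear L" "\<And>x. h x = L x + d"
  shows "dird v h x = L v"
  by (rule has_derivative_dird[OF has_derivative_affine[OF assms]])

lemma dird_compose_affine:
  assumes "bounded_linear L" "\<And>x. h x = L x + d" "smooth f"
  shows "dird v (\<lambda>x. f (h x)) x = dird (L v) f (h x)"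
  by (rule has_derivative_dird)
    (rule has_derivative_compose[OF has_derivative_affine[OF assms(1,2)] smooth_has_derivative[OF assms(3)]])

lemma dird_translate: "smooth f \<Longrightarrow> dird v (\<lambda>x. f (x + d)) x = dird v f (x + d)"
  by (rule dird_compose_affine[OF bounded_linear_ident]) auto

lemma linear_dird: "smooth f \<Longrightarrow> linear (\<lambda>v. dird v f x)"
  using smooth_has_derivative has_derivative_linear by blast

lemma dird_direction_add: "smooth f \<Longrightarrow> dird (v + w) f x = dird v f x + dird w f x"
  by (simp add: linear_add[OF linear_dird])

lemma dird_direction_scaleR: "smooth f \<Longrightarrow> dird (r *\<^sub>R v) f x = r *\<^sub>R dird v f x"
  by (simp add: linear_scale[OF linear_dird])

section \<open>Calculus along straight lines\<close>

lemma smooth_along_line: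
  assumes "smooth f"
  shows "((\<lambda>s. f (p + s *\<^sub>R v)) has_vector_derivative dird v f (p + s *\<^sub>R v)) (at s within S)"
proof -
  have "((\<lambda>s. p + s *\<^sub>R v) has_derivative (\<lambda>h. h *\<^sub>R v)) (at s within S)"
    by (auto intro!: derivative_eq_intros)
  then have "((\<lambda>s. f (p + s *\<^sub>R v)) has_derivative (\<lambda>h. dird (h *\<^sub>R v) f (p + s *\<^sub>R v))) (at s within S)"
    by (rule has_derivative_compose[OF _ smooth_has_derivative[OF assms]])
  then show ?thesis
    by (simp add: has_vector_derivative_def dird_direction_scaleR[OF assms])
qed

lemma integral_dird:
  fixes f :: "'a::real_normed_vector \<Rightarrow> 'b::banach"
  assumes "smooth f" "a \<le> b"
  shows "integral {a..b} (\<lambda>s. dird v f (p + s *\<^sub>R v)) = f (p + b *\<^sub>R v) - f (p + a *\<^sub>R v)"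
  by (intro integral_unique fundamental_theorem_of_calculus smooth_along_line assms)

lemma dird_zero_imp_constant:
  assumes "smooth f" "\<And>v p. dird v f p = 0"
  shows "f p = f q"
proof -
  have "(f has_derivative (\<lambda>v. 0)) (at x within UNIV)" for x
    using smooth_has_derivative[OF assms(1), of x] assms(2) by simp
  then show ?thesis by (metis has_derivative_zero_unique_connected UNIV_I connected_UNIV open_UNIV
        has_derivative_zero_constant convex_UNIV)
qed

subsection \<open>Parameter integrals\<close>

text \<open>A weighted average of translates of \<open>F\<close>: the parameter enters through
  \<open>F\<close> alone, so the weight \<open>G\<close> and the shift \<open>l\<close> need only be
  continuous. All later integrals (Fourier coefficients, averages over a fibre, the torus kernel)
  have this form.\<close>

lemma parameter_integral_has_derivative:
  fixes F :: "'a::euclidean_space \<Rightarrow> complex" and G :: "'c::euclidean_space \<Rightarrow> complex"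
  assumes G: "continuous_on (cbox a b) G" and l: "continuous_on UNIV l"
    and F: "\<And>x. (F has_derivative D x) (at x)" and D: "\<And>v. continuous_on UNIV (\<lambda>x. D x v)"
  shows "((\<lambda>p. integral (cbox a b) (\<lambda>s. G s * F (p + l s))) has_derivative
      (\<lambda>v. integral (cbox a b) (\<lambda>s. G s * D (p + l s) v))) (at p)"
proof -
  \<comment> \<open>The Leibniz rule asks for continuity of the derivative as a bounded linear map;
    in finite dimension it may be checked on each direction \<open>v\<close> separately.\<close>
  define B where "B = (\<lambda>p s. Blinfun (\<lambda>v. G s * D (p + l s) v))"
  have bl: "bounded_linear (\<lambda>v. G s * D (p + l s) v)" for p s
    by (intro bounded_linear_const_mult has_derivative_bounded_linear[OF F])
  have B: "blinfun_apply (B p s) = (\<lambda>v. G s * D (p + l s) v)" for p s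
    unfolding B_def by (rule bounded_linear_Blinfun_apply[OF bl])
  have Fc: "continuous_on UNIV F"
    using F has_derivative_continuous continuous_at_imp_continuous_on by blast
  have c: "continuous_on (UNIV \<times> cbox a b) (\<lambda>x. H (fst x + l (snd x)))"
    if "continuous_on UNIV H" for H :: "'a \<Rightarrow> complex"
    by (intro continuous_on_compose2[OF that] continuous_intros continuous_on_compose2[OF l]) auto
  have G': "continuous_on (UNIV \<times> cbox a b) (\<lambda>x. G (snd x))"
    by (intro continuous_on_compose2[OF G] continuous_intros) auto
  have cB: "continuous_on (UNIV \<times> cbox a b) (\<lambda>(p, s). B p s)"
    by (rule continuous_on_blinfun_componentwise)
      (auto simp: B split_beta intro!: continuous_intros c D G')
  have int: "(\<lambda>s. G s * F (p + l s)) integrable_on cbox a b" for p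
    by (intro integrable_continuous continuous_intros G continuous_on_compose2[OF Fc]
        continuous_on_subset[OF l]) auto
  have "((\<lambda>p. integral (cbox a b) (\<lambda>s. G s * F (p + l s))) has_derivative
      blinfun_apply (integral (cbox a b) (B p))) (at p within UNIV)"
  proof (rule leibniz_rule[where fx = B])
    show "((\<lambda>p. G s * F (p + l s)) has_derivative blinfun_apply (B p s)) (at p within UNIV)" for p s
    proof -
      have "((\<lambda>p. p + l s) has_derivative (\<lambda>v. v)) (at p)"
        by (auto intro!: derivative_eq_intros)
      then have "((\<lambda>p. F (p + l s)) has_derivative D (p + l s)) (at p)"
        by (rule has_derivative_compose[OF _ F])
      then show ?thesis unfolding B by (intro has_derivative_mult_right) simp
    qed
  qed (use int cB in auto)
  moreover have "blinfun_apply (integral (cbox a b) (B p)) v = integral (cbox a b) (\<lambda>s. G s * D (p + l s) v)" for v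
  proof -
    have "B p integrable_on cbox a b"
      using continuous_on_compose2[OF cB, of "cbox a b" "\<lambda>s. (p, s)"]
      by (intro integrable_continuous) (auto simp: continuous_on_Pair)
    then have "((\<lambda>s. blinfun_apply (B p s) v) has_integral blinfun_apply (integral (cbox a b) (B p)) v) (cbox a b)"
      using has_integral_linear[OF integrable_integral blinfun.bounded_linear_left[of v], of "B p" "cbox a b"]
      by (simp add: o_def)
    then show ?thesis by (simp add: B integral_unique)
  qed
  then have "blinfun_apply (integral (cbox a b) (B p)) = (\<lambda>v. integral (cbox a b) (\<lambda>s. G s * D (p + l s) v))"
    by (rule ext)
  ultimately show ?thesis by simp
qed

lemma
  fixes F :: "'a::euclidean_space \<Rightarrow> complex" and G :: "'c::euclidean_space \<Rightarrow> complex"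
  assumes G: "continuous_on (cbox a b) G" and l: "continuous_on UNIV l" and F: "smooth F"
  shows dird_parameter_integral:
      "dird v (\<lambda>p. integral (cbox a b) (\<lambda>s. G s * F (p + l s))) =
        (\<lambda>p. integral (cbox a b) (\<lambda>s. G s * dird v F (p + l s)))"
    and smooth_parameter_integral: "smooth (\<lambda>p. integral (cbox a b) (\<lambda>s. G s * F (p + l s)))"
proof -
  have der: "((\<lambda>p. integral (cbox a b) (\<lambda>s. G s * F (p + l s))) has_derivative
      (\<lambda>v. integral (cbox a b) (\<lambda>s. G s * dird v F (p + l s)))) (at p)" if "smooth F" for F p
    by (rule parameter_integral_has_derivative[OF G l])
      (use that in \<open>auto intro: smooth_has_derivative smooth_continuous smooth_dird\<close>)
  show "dird v (\<lambda>p. integral (cbox a b) (\<lambda>s. G s * F (p + l s))) =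
        (\<lambda>p. integral (cbox a b) (\<lambda>s. G s * dird v F (p + l s)))"
    by (rule dird_eqI[OF der[OF F]])
  have "cdiff k (\<lambda>p. integral (cbox a b) (\<lambda>s. G s * F (p + l s)))" if "smooth F" for k F
    using that
  proof (induction k arbitrary: F)
    case 0
    then show ?case
      using has_derivative_continuous[OF der[OF 0]] by (simp add: continuous_at_imp_continuous_on)
  next
    case (Suc k)
    show ?case by (rule cdiff_SucI[OF der[OF Suc.prems]]) (intro Suc.IH smooth_dird Suc.prems)
  qed
  then show "smooth (\<lambda>p. integral (cbox a b) (\<lambda>s. G s * F (p + l s)))"
    using F by (auto simp: smooth_def)
qed

lemma
  fixes F :: "'a::euclidean_space \<Rightarrow> complex"
  assumes F: "smooth F" and G: "continuous_on {a..b} G"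
  shows dird_line_integral:
      "dird v (\<lambda>p. integral {a..b} (\<lambda>s. G s * F (p + s *\<^sub>R e))) =
        (\<lambda>p. integral {a..b} (\<lambda>s. G s * dird v F (p + s *\<^sub>R e)))"
    and smooth_line_integral: "smooth (\<lambda>p. integral {a..b} (\<lambda>s. G s * F (p + s *\<^sub>R e)))"
  using dird_parameter_integral[of a b G "\<lambda>s. s *\<^sub>R e" F v]
    smooth_parameter_integral[of a b G "\<lambda>s. s *\<^sub>R e" F] F G
  by (simp_all add: continuous_intros)

text \<open>Differentiate \<open>f (p + t v) - f p\<close>, written as the integral of
  \<open>dird v f\<close> over the segment, in direction \<open>w\<close> under the integral sign;
  the derivative in \<open>t\<close> at 0 then gives both mixed derivatives.\<close>

lemma dird_commute:
  fixes f :: "'a::euclidean_space \<Rightarrow> complex"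
  assumes f: "smooth f"
  shows "dird v (dird w f) = dird w (dird v f)"
proof
  fix p
  have *: "integral {0..t} (\<lambda>s. dird w (dird v f) (p + s *\<^sub>R v)) = dird w f (p + t *\<^sub>R v) - dird w f p"
    if "t \<ge> 0" for t
  proof -
    have "(\<lambda>p. integral {0..t} (\<lambda>s. 1 * dird v f (p + s *\<^sub>R v))) = (\<lambda>p. f (p + t *\<^sub>R v) - f p)"
      using integral_dird[OF f that] by simp
    then have "dird w (\<lambda>p. f (p + t *\<^sub>R v) - f p) = (\<lambda>p. integral {0..t} (\<lambda>s. 1 * dird w (dird v f) (p + s *\<^sub>R v)))"
      using dird_line_integral[OF smooth_dird[OF f], of 0 t "\<lambda>_. 1" w v v] by simp
    then show ?thesis
      by (simp add: dird_diff[OF smooth_translate[OF f] f] dird_translate[OF f] fun_eq_iff)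
  qed
  have c: "continuous_on {0..1} (\<lambda>s. dird w (dird v f) (p + s *\<^sub>R v))"
    by (intro continuous_on_compose2[OF smooth_continuous[OF smooth_dird[OF smooth_dird[OF f]], of UNIV]]
        continuous_intros) auto
  have "((\<lambda>t. integral {0..t} (\<lambda>s. dird w (dird v f) (p + s *\<^sub>R v))) has_vector_derivative
      dird w (dird v f) (p + 0 *\<^sub>R v)) (at 0 within {0..1})"
    by (rule integral_has_vector_derivative[OF c]) simp
  then have "((\<lambda>t. dird w f (p + t *\<^sub>R v) - dird w f p) has_vector_derivative
      dird w (dird v f) p) (at 0 within {0..1})"
    using has_vector_derivative_transform[of "0::real" "{0..1}" "\<lambda>t. dird w f (p + t *\<^sub>R v) - dird w f p"
        "\<lambda>t. integral {0..t} (\<lambda>s. dird w (dird v f) (p + s *\<^sub>R v))"] by (simp add: *)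
  moreover have "((\<lambda>t. dird w f (p + t *\<^sub>R v) - dird w f p) has_vector_derivative
      dird v (dird w f) p) (at 0 within {0..1})"
    using has_vector_derivative_diff[OF smooth_along_line[OF smooth_dird[OF f], of w p v 0 "{0..1}"]
        has_vector_derivative_const[of "dird w f p"]]
    by simp
  ultimately show "dird v (dird w f) p = dird w (dird v f) p"
    by (metis vector_derivative_within_cbox[of 0 1 0] cbox_interval atLeastAtMost_iff zero_less_one
        order_refl zero_le_one)
qed


section \<open>Fourier coefficients of periodic functions\<close>

lemma periodic_integral_shift:
  fixes \<phi> :: "real \<Rightarrow> 'b::banach"
  assumes c: "continuous_on UNIV \<phi>" and per: "\<And>x. \<phi> (x + 1) = \<phi> x" and t: "0 \<le> t" "t \<le> 1"
  shows "integral {0..1} (\<lambda>x. \<phi> (x + t)) = integral {0..1} \<phi>"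
proof -
  have i: "\<phi> integrable_on {x..y}" for x y
    by (intro integrable_continuous_interval continuous_on_subset[OF c]) auto
  have "integral {0..1} (\<lambda>x. \<phi> (x + t)) = integral {t..1 + t} \<phi>"
    using integral_shift_real_ivl[of t t "1 + t" \<phi>] by simp
  also have "\<dots> = integral {t..1} \<phi> + integral {1..1 + t} \<phi>"
    using t by (intro Henstock_Kurzweil_Integration.integral_combine[symmetric] i) auto
  also have "integral {1..1 + t} \<phi> = integral {0..t} \<phi>"
    using integral_shift_real_ivl[of 1 1 "1 + t" \<phi>] by (simp add: per)
  also have "integral {t..1} \<phi> + integral {0..t} \<phi> = integral {0..1} \<phi>"
    using t Henstock_Kurzweil_Integration.integral_combine[of 0 t 1 \<phi>] i by (simp add: add.commute)
  finally show ?thesis .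
qed

lemma periodic_of_int:
  fixes \<phi> :: "real \<Rightarrow> 'b"
  assumes per: "\<And>x. \<phi> (x + 1) = \<phi> x"
  shows "\<phi> (x + of_int n) = \<phi> x"
proof (induction n rule: int_induct[where k = 0])
  case (step1 n)
  then show ?case using per[of "x + of_int n"] by (simp add: add.assoc)
next
  case (step2 n)
  then show ?case using per[of "x + of_int (n - 1)"] by (simp add: add.assoc)
qed simp

lemma periodic_integral_translate:
  fixes \<phi> :: "real \<Rightarrow> 'b::banach"
  assumes c: "continuous_on UNIV \<phi>" and per: "\<And>x. \<phi> (x + 1) = \<phi> x"
  shows "integral {0..1} (\<lambda>x. \<phi> (x + t)) = integral {0..1} \<phi>"
proof -
  have "\<phi> (x + t) = \<phi> (x + frac t)" for x
    using periodic_of_int[of \<phi> "x + frac t" "\<lfloor>t\<rfloor>"] per by (simp add: frac_def)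
  then show ?thesis
    using periodic_integral_shift[OF c per, of "frac t"] by (simp add: frac_lt_1 less_imp_le)
qed

lemma cis_line_has_vector_derivative:
  "((\<lambda>x. cis (k * (x - d))) has_vector_derivative (\<i> * k * cis (k * (x - d)))) (at x within S)"
proof -
  have "((\<lambda>z. exp (\<i> * (of_real k * (z - of_real d)))) has_field_derivative
      \<i> * k * exp (\<i> * (of_real k * (of_real x - of_real d)))) (at (of_real x))"
    by (auto intro!: derivative_eq_intros)
  from has_vector_derivative_real_field[OF this, of S] show ?thesis
    by (simp add: cis_conv_exp)
qed

lemma continuous_on_cis_mult [continuous_intros]:
  "continuous_on S f \<Longrightarrow> continuous_on S (\<lambda>x. cis (f x))"
  unfolding cis_conv_exp by (intro continuous_intros)

lemma integral_cis:
  fixes n :: int and d :: real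
  shows "integral {0..1} (\<lambda>x. cis (2 * pi * real_of_int n * (x - d))) = (if n = 0 then 1 else 0)"
proof (cases "n = 0")
  case False
  define k where "k = 2 * pi * n"
  have k: "k \<noteq> 0" using False by (simp add: k_def)
  have "((\<lambda>x. \<i> * k * cis (k * (x - d))) has_integral cis (k * (1 - d)) - cis (k * (0 - d))) {0..1}"
    by (intro fundamental_theorem_of_calculus cis_line_has_vector_derivative) auto
  then have "((\<lambda>x. (1 / (\<i> * k)) * (\<i> * k * cis (k * (x - d)))) has_integral
      (1 / (\<i> * k)) * (cis (k * (1 - d)) - cis (k * (0 - d)))) {0..1}"
    by (rule has_integral_mult_right)
  then have "((\<lambda>x. cis (k * (x - d))) has_integral
      (1 / (\<i> * k)) * (cis (k * (1 - d)) - cis (k * (0 - d)))) {0..1}"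
    using k by (simp only: mult.assoc[symmetric]) simp
  moreover have "cis (k * (1 - d)) = cis (k * (0 - d))"
  proof -
    have "cis (k * (1 - d)) = cis (k * (0 - d)) * cis k"
      by (simp add: cis_mult algebra_simps)
    also have "cis k = 1"
      unfolding k_def by (rule cis_multiple_2pi) simp
    finally show ?thesis by simp
  qed
  ultimately have "((\<lambda>x. cis (k * (x - d))) has_integral 0) {0..1}"
    by simp
  then show ?thesis using False by (simp add: integral_unique k_def)
qed simp

text \<open>Bessel's inequality for the first \<open>N\<close> functions of the orthonormal family
  reads \<open>N * |k|^2 \<le> E\<close>, where \<open>E\<close> is the squared norm of
  \<open>h\<close>, and it holds for every \<open>N\<close>.\<close>

lemma bessel_constant_coefficients:
  fixes h :: "real \<Rightarrow> complex" and ch :: "nat \<Rightarrow> real \<Rightarrow> complex"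
  assumes h: "continuous_on {0..1} h" and ch: "\<And>n. continuous_on {0..1} (ch n)"
    and orth: "\<And>m n. integral {0..1} (\<lambda>x. ch m x * cnj (ch n x)) = (if m = n then 1 else 0)"
    and k: "\<And>n. integral {0..1} (\<lambda>x. h x * cnj (ch n x)) = k"
  shows "k = 0"
proof -
  have ci: "f integrable_on {0..1}" if "continuous_on {0..1} f" for f :: "real \<Rightarrow> complex"
    using that by (rule integrable_continuous_interval)
  define E where "E = integral {0..1} (\<lambda>x. h x * cnj (h x))"
  have bound: "real N * (cmod k)\<^sup>2 \<le> Re E" for N
  proof -
    define S where "S = (\<lambda>x. \<Sum>n<N. ch n x)"
    have S: "continuous_on {0..1} S" unfolding S_def by (intro continuous_intros ch)
    have 1: "integral {0..1} (\<lambda>x. h x * cnj (S x)) = of_nat N * k"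
    proof -
      have "integral {0..1} (\<lambda>x. h x * cnj (S x)) = integral {0..1} (\<lambda>x. \<Sum>n<N. h x * cnj (ch n x))"
        by (simp add: S_def sum_distrib_left)
      also have "\<dots> = (\<Sum>n<N. integral {0..1} (\<lambda>x. h x * cnj (ch n x)))"
        by (intro integral_sum ci continuous_intros h ch) auto
      finally show ?thesis by (simp add: k)
    qed
    have 2: "integral {0..1} (\<lambda>x. S x * cnj (h x)) = of_nat N * cnj k"
      using arg_cong[OF 1, of cnj] by (simp add: integral_cnj mult.commute)
    have 3: "integral {0..1} (\<lambda>x. S x * cnj (S x)) = of_nat N"
    proof -
      have "integral {0..1} (\<lambda>x. S x * cnj (S x)) =
          integral {0..1} (\<lambda>x. \<Sum>m<N. \<Sum>n<N. ch m x * cnj (ch n x))"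
        by (simp add: S_def sum_product)
      also have "\<dots> = (\<Sum>m<N. integral {0..1} (\<lambda>x. \<Sum>n<N. ch m x * cnj (ch n x)))"
        by (intro integral_sum ci continuous_intros h ch) auto
      also have "\<dots> = (\<Sum>m<N. \<Sum>n<N. integral {0..1} (\<lambda>x. ch m x * cnj (ch n x)))"
        by (intro sum.cong integral_sum ci continuous_intros h ch) auto
      finally show ?thesis by (simp add: orth)
    qed
    \<comment> \<open>The squared distance from \<open>h\<close> to \<open>k\<close> times the sum
      \<open>S\<close> of the first \<open>N\<close> functions is expanded; the cross terms and the
      square together contribute minus \<open>N * |k|^2\<close>.\<close>
    have "(\<lambda>x. (h x - k * S x) * cnj (h x - k * S x)) =
        (\<lambda>x. h x * cnj (h x) - cnj k * (h x * cnj (S x)) - k * (S x * cnj (h x)) + k * cnj k * (S x * cnj (S x)))"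
      by (auto simp: fun_eq_iff algebra_simps)
    moreover have "((\<lambda>x. h x * cnj (h x) - cnj k * (h x * cnj (S x)) - k * (S x * cnj (h x)) + k * cnj k * (S x * cnj (S x)))
        has_integral (E - cnj k * (of_nat N * k) - k * (of_nat N * cnj k) + k * cnj k * of_nat N)) {0..1}"
    proof (intro has_integral_add has_integral_diff has_integral_mult_right)
      have int: "((\<lambda>x. u x * cnj (v x)) has_integral integral {0..1} (\<lambda>x. u x * cnj (v x))) {0..1}"
        if "continuous_on {0..1} u" "continuous_on {0..1} v" for u v :: "real \<Rightarrow> complex"
        by (intro integrable_integral ci continuous_on_mult continuous_on_cnj that)
      show "((\<lambda>x. h x * cnj (h x)) has_integral E) {0..1}"
        using int[OF h h] unfolding E_def .
      show "((\<lambda>x. h x * cnj (S x)) has_integral of_nat N * k) {0..1}"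
        using int[OF h S] unfolding 1 .
      show "((\<lambda>x. S x * cnj (h x)) has_integral of_nat N * cnj k) {0..1}"
        using int[OF S h] unfolding 2 .
      show "((\<lambda>x. S x * cnj (S x)) has_integral of_nat N) {0..1}"
        using int[OF S S] unfolding 3 .
    qed
    ultimately have "integral {0..1} (\<lambda>x. (h x - k * S x) * cnj (h x - k * S x)) =
        E - cnj k * (of_nat N * k) - k * (of_nat N * cnj k) + k * cnj k * of_nat N"
      by (simp add: integral_unique)
    also have "\<dots> = E - of_nat N * (k * cnj k)" by (simp add: algebra_simps)
    also have "\<dots> = E - of_real (real N * (cmod k)\<^sup>2)"
      using complex_norm_square[of k] by simp
    finally have "Re (integral {0..1} (\<lambda>x. (h x - k * S x) * cnj (h x - k * S x))) = Re E - real N * (cmod k)\<^sup>2"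
      by simp
    moreover have "Re (integral {0..1} (\<lambda>x. (h x - k * S x) * cnj (h x - k * S x))) =
        integral {0..1} (\<lambda>x. Re ((h x - k * S x) * cnj (h x - k * S x)))"
      by (rule integral_linear[OF _ bounded_linear_Re, unfolded o_def, symmetric])
        (intro ci continuous_intros h S)
    moreover have "\<dots> \<ge> 0"
    proof (rule integral_nonneg)
      show "(\<lambda>x. Re ((h x - k * S x) * cnj (h x - k * S x))) integrable_on {0..1}"
        by (intro integrable_continuous_interval continuous_intros h S)
      show "Re ((h x - k * S x) * cnj (h x - k * S x)) \<ge> 0" for x
        unfolding complex_mult_cnj by simp
    qed
    ultimately show ?thesis by simp
  qed
  show ?thesis
  proof (rule ccontr)
    assume "k \<noteq> 0"
    then have pos: "(cmod k)\<^sup>2 > 0" by simp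
    then obtain N where "Re E / (cmod k)\<^sup>2 < real N" using reals_Archimedean2 by blast
    then have "Re E < real N * (cmod k)\<^sup>2" using pos by (simp add: divide_less_eq)
    then show False using bound[of N] by simp
  qed
qed

text \<open>\<open>A x\<close> is the mean of \<open>g'\<close> over the segment from
  \<open>d\<close> to \<open>x\<close>, so dividing by the linear factor leaves a continuous
  function even at \<open>d\<close>.\<close>

lemma hadamard_factor:
  fixes g :: "real \<Rightarrow> complex"
  assumes g: "\<And>x. (g has_vector_derivative g' x) (at x)" and c: "continuous_on UNIV g'"
  obtains A where "continuous_on UNIV A" "\<And>x. g x - g d = of_real (x - d) * A x" "A d = g' d"
proof
  define A where "A = (\<lambda>x. integral (cbox 0 1) (\<lambda>s. g' (d + s * (x - d))))"
  show "continuous_on UNIV A"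
    unfolding A_def
    by (intro integral_continuous_on_param)
      (auto simp: split_beta intro!: continuous_intros continuous_on_compose2[OF c])
  show "A d = g' d" by (simp add: A_def)
  show "g x - g d = of_real (x - d) * A x" for x
  proof -
    have "((\<lambda>s. (x - d) *\<^sub>R g' (d + s * (x - d))) has_integral g (d + 1 * (x - d)) - g (d + 0 * (x - d))) {0..1}"
    proof (rule fundamental_theorem_of_calculus)
      fix s :: real
      have "((\<lambda>s. d + s * (x - d)) has_vector_derivative (x - d)) (at s within {0..1})"
        by (auto intro!: derivative_eq_intros)
      then show "((\<lambda>s. g (d + s * (x - d))) has_vector_derivative (x - d) *\<^sub>R g' (d + s * (x - d))) (at s within {0..1})"
        using vector_diff_chain_within[of "\<lambda>s. d + s * (x - d)" "x - d" s "{0..1}" g]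
          has_vector_derivative_at_within[OF g] by (simp add: o_def)
    qed simp
    then have "((\<lambda>s. (x - d) *\<^sub>R g' (d + s * (x - d))) has_integral g x - g d) {0..1}"
      by simp
    then have "integral {0..1} (\<lambda>s. (x - d) *\<^sub>R g' (d + s * (x - d))) = g x - g d"
      by (rule integral_unique)
    then show ?thesis by (simp add: A_def scaleR_conv_of_real)
  qed
qed

text \<open>Chernoff's argument: dividing \<open>g - g (1/2)\<close> by \<open>exp (2 \<pi> i (x - 1/2)) - 1\<close> makes the Fourier
  coefficients of \<open>g\<close> differences of consecutive coefficients of the quotient, so the latter are constant
  on either side of \<open>0\<close> and vanish by Bessel's inequality.\<close>

lemma only_constant_fourier_coefficient:
  fixes g :: "real \<Rightarrow> complex"
  assumes g: "\<And>x. (g has_vector_derivative g' x) (at x)" and c: "continuous_on UNIV g'"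
    and coeff: "\<And>n::int. n \<noteq> 0 \<Longrightarrow> integral {0..1} (\<lambda>x. g x * cis (- (2 * pi * real_of_int n * x))) = 0"
  shows "g (1/2) = integral {0..1} g"
proof -
  \<comment> \<open>The characters are centred at 1/2 because \<open>ch 1 - 1\<close> then has
    exactly one zero in the closed unit interval; centred at an endpoint it would vanish at both
    ends.\<close>
  define ch :: "int \<Rightarrow> real \<Rightarrow> complex" where "ch = (\<lambda>n x. cis (2 * pi * real_of_int n * (x - 1/2)))"
  have gc: "continuous_on S g" for S
    using g by (metis continuous_at_imp_continuous_on has_vector_derivative_continuous)
  have chc: "continuous_on S (ch n)" for S n
    unfolding ch_def by (intro continuous_intros)
  have ch_mult: "ch m x * cnj (ch n x) = ch (m - n) x" for m n x
    by (simp add: ch_def cis_cnj cis_mult algebra_simps)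
  have ch_int: "integral {0..1} (ch n) = (if n = 0 then 1 else 0)" for n
    unfolding ch_def by (rule integral_cis)
  have ch0: "ch 0 = (\<lambda>x. 1)" by (simp add: ch_def)
  obtain A where A: "continuous_on UNIV A" "\<And>x. g x - g (1/2) = of_real (x - 1/2) * A x"
    using hadamard_factor[OF g c] by metis
  have dch: "(ch 1 has_vector_derivative (\<i> * complex_of_real (2 * pi) * ch 1 x)) (at x)" for x
    using cis_line_has_vector_derivative[of "2 * pi" "1/2" x UNIV] by (simp add: ch_def)
  obtain B where B: "continuous_on UNIV B" "\<And>x. ch 1 x - ch 1 (1/2) = of_real (x - 1/2) * B x"
      "B (1/2) = \<i> * complex_of_real (2 * pi) * ch 1 (1/2)"
    using hadamard_factor[OF dch, of "1/2"] chc by (metis continuous_on_mult_left)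
  have B0: "B x \<noteq> 0" if x: "x \<in> {0..1}" for x
  proof (cases "x = 1/2")
    case True
    have "B (1/2) \<noteq> 0" using B(3) by (simp add: ch_def)
    then show ?thesis unfolding True .
  next
    case False
    have "ch 1 x \<noteq> 1"
    proof
      assume "ch 1 x = 1"
      then have "cos (2 * pi * (x - 1/2)) = 1" by (simp add: ch_def complex_eq_iff)
      then obtain n :: int where "2 * pi * (x - 1/2) = of_int n * 2 * pi" using cos_one_2pi_int by auto
      then have "x - 1/2 = of_int n" by simp
      moreover from this have "\<bar>of_int n :: real\<bar> < 1" using x by (auto simp: abs_if)
      then have "n = 0" by linarith
      ultimately show False using False by simp
    qed
    then show ?thesis using B(2)[of x] by (auto simp: ch_def)
  qed
  \<comment> \<open>This is \<open>(g - g (1/2)) / (ch 1 - 1)\<close> with the common linear factor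
    \<open>x - 1/2\<close> cancelled, hence continuous at the midpoint too.\<close>
  define h where "h = (\<lambda>x. A x / B x)"
  have hc: "continuous_on {0..1} h"
    unfolding h_def
    by (intro continuous_intros continuous_on_subset[OF A(1)] continuous_on_subset[OF B(1)]) (auto simp: B0)
  have hg: "h x * ch 1 x - h x = g x - g (1/2)" if "x \<in> {0..1}" for x
  proof -
    have "h x * (ch 1 x - ch 1 (1/2)) = h x * (of_real (x - 1/2) * B x)" by (simp only: B(2))
    also have "\<dots> = of_real (x - 1/2) * A x" using B0[OF that] by (simp add: h_def)
    finally show ?thesis by (simp add: A(2) ch_def algebra_simps)
  qed
  define k where "k = (\<lambda>n. integral {0..1} (\<lambda>x. h x * cnj (ch n x)))"
  have ci: "f integrable_on {0..1}" if "continuous_on {0..1} f" for f :: "real \<Rightarrow> complex"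
    using that by (rule integrable_continuous_interval)
  have step: "k (n - 1) - k n = integral {0..1} (\<lambda>x. g x * cnj (ch n x)) - g (1/2) * integral {0..1} (ch (- n))" for n
  proof -
    have "k (n - 1) - k n = integral {0..1} (\<lambda>x. h x * cnj (ch (n - 1) x) - h x * cnj (ch n x))"
      unfolding k_def by (intro integral_diff[symmetric] ci continuous_intros hc chc)
    also have "\<dots> = integral {0..1} (\<lambda>x. g x * cnj (ch n x) - g (1/2) * ch (- n) x)"
    proof (rule integral_cong)
      fix x :: real assume x: "x \<in> {0..1}"
      have "cnj (ch (n - 1) x) = ch 1 x * cnj (ch n x)"
        by (simp add: ch_def cis_cnj cis_mult algebra_simps)
      then have "h x * cnj (ch (n - 1) x) - h x * cnj (ch n x) = (h x * ch 1 x - h x) * cnj (ch n x)"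
        by (simp add: algebra_simps)
      also have "\<dots> = (g x - g (1/2)) * cnj (ch n x)" using hg[OF x] by simp
      also have "cnj (ch n x) = ch (- n) x" by (simp add: ch_def cis_cnj)
      finally show "h x * cnj (ch (n - 1) x) - h x * cnj (ch n x) = g x * cnj (ch n x) - g (1/2) * ch (- n) x"
        by (simp add: ch_def cis_cnj algebra_simps)
    qed
    also have "\<dots> = integral {0..1} (\<lambda>x. g x * cnj (ch n x)) - integral {0..1} (\<lambda>x. g (1/2) * ch (- n) x)"
      by (intro integral_diff ci continuous_intros gc chc)
    finally show ?thesis by simp
  qed
  \<comment> \<open>The recursion links neighbouring coefficients except across
    \<open>n = 0\<close>, so it yields two chains: \<open>k\<close> is constant on the indices from
    0 upwards and on those from -1 downwards.\<close>
  have gk: "k (n - 1) = k n" if "n \<noteq> 0" for n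
  proof -
    have "(\<lambda>x. g x * cnj (ch n x)) = (\<lambda>x. cis (pi * n) * (g x * cis (- (2 * pi * real_of_int n * x))))"
      by (auto simp: fun_eq_iff ch_def cis_cnj cis_mult algebra_simps)
    then have "integral {0..1} (\<lambda>x. g x * cnj (ch n x)) = 0" using coeff[OF that] by simp
    then show ?thesis using step[of n] that by (simp add: ch_int)
  qed
  have "k (int n) = k 0" for n
  proof (induction n)
    case (Suc n)
    have "k (int (Suc n) - 1) = k (int (Suc n))" by (rule gk) simp
    then show ?case using Suc by simp
  qed simp
  then have k0: "k 0 = 0"
    by (intro bessel_constant_coefficients[OF hc, of "\<lambda>n. ch (int n)"])
      (auto simp: chc ch_mult ch_int k_def)
  have "k (- 1 - int n) = k (- 1)" for n
  proof (induction n)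
    case (Suc n)
    have "k (- 1 - int n - 1) = k (- 1 - int n)" by (rule gk) simp
    then show ?case using Suc by (simp add: algebra_simps)
  qed simp
  then have "k (- 1) = 0"
    by (intro bessel_constant_coefficients[OF hc, of "\<lambda>n. ch (- 1 - int n)"])
      (auto simp: chc ch_mult ch_int k_def)
  \<comment> \<open>At the exceptional index the difference \<open>k (- 1) - k 0\<close> equals the
    integral of \<open>g\<close> minus \<open>g (1/2)\<close>, and both coefficients are 0.\<close>
  then show ?thesis using step[of 0] k0 by (simp add: ch_int ch0)
qed


section \<open>An elliptic equation on a two-dimensional torus\<close>

lemma summable_on_inverse_one_plus_square: "(\<lambda>n::int. 1 / (1 + (real_of_int n)\<^sup>2)) summable_on UNIV"
proof -
  have nat: "(\<lambda>k. 1 / (1 + (real k)\<^sup>2)) summable_on UNIV"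
  proof -
    have "summable (\<lambda>k. 1 / (1 + (real k)\<^sup>2))"
    proof (rule summable_comparison_test)
      show "summable (\<lambda>k. inverse ((real k)\<^sup>2))" using inverse_power_summable[of 2, where ?'a = real] by simp
      have "norm (1 / (1 + (real k)\<^sup>2)) \<le> inverse ((real k)\<^sup>2)" if "k \<ge> 1" for k
      proof -
        have "1 / (1 + (real k)\<^sup>2) \<le> 1 / (real k)\<^sup>2" using that
          by (intro divide_left_mono mult_pos_pos add_pos_nonneg) auto
        then show ?thesis by (simp add: divide_inverse)
      qed
      then show "\<exists>N. \<forall>k\<ge>N. norm (1 / (1 + (real k)\<^sup>2)) \<le> inverse ((real k)\<^sup>2)" by blast
    qed
    then show ?thesis by (simp add: summable_on_UNIV_nonneg_real_iff)
  qed
  have pos: "(\<lambda>n::int. 1 / (1 + (real_of_int n)\<^sup>2)) summable_on range int"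
    using nat by (subst summable_on_reindex) (auto simp: o_def)
  have neg: "(\<lambda>n::int. 1 / (1 + (real_of_int n)\<^sup>2)) summable_on range (\<lambda>k. - int k)"
    using nat by (subst summable_on_reindex) (auto simp: o_def inj_on_def)
  have "UNIV = range int \<union> range (\<lambda>k. - int k)"
    by (auto simp: image_iff) (metis int_cases2)
  then show ?thesis using summable_on_union[OF pos neg] by simp
qed

text \<open>The \<open>n\<close>-th Fourier coefficient along \<open>e\<^sub>2\<close> turns \<open>\<partial>\<^bsub>e\<^sub>1\<^esub> + i c \<partial>\<^bsub>e\<^sub>2\<^esub>\<close> into the operator
  \<open>\<partial>\<^sub>s - 2 \<pi> c n\<close> on periodic functions, which is inverted by convolution with this kernel; for
  \<open>n = 0\<close> it is inverted up to the mean value.\<close>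

definition resolvent :: "real \<Rightarrow> int \<Rightarrow> real \<Rightarrow> real" where
  "resolvent c n s = (if n = 0 then s - 1/2
     else exp (- (2 * pi * c * of_int n) * s) / (exp (- (2 * pi * c * of_int n)) - 1))"

lemma resolvent_has_derivative:
  "(resolvent c n has_real_derivative
     (if n = 0 then 1 else - (2 * pi * c * of_int n) * resolvent c n s)) (at s within S)"
proof (cases "n = 0")
  case True
  then have "resolvent c n = (\<lambda>s. s - 1/2)" by (auto simp: resolvent_def)
  then show ?thesis using True by (auto intro!: derivative_eq_intros)
next
  case False
  define m where "m = - (2 * pi * c * of_int n)"
  have r: "resolvent c n = (\<lambda>s. exp (m * s) / (exp m - 1))"
    using False by (auto simp: resolvent_def m_def)
  have "((\<lambda>s. exp (m * s) / (exp m - 1)) has_real_derivative m * (exp (m * s) / (exp m - 1))) (at s within S)"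
    by (rule DERIV_cdivide[where D = "m * exp (m * s)", THEN DERIV_cong]) (auto intro!: derivative_eq_intros)
  then show ?thesis using False unfolding r m_def[symmetric] by simp
qed

text \<open>The unit jump of the periodised kernel plays the part of the delta function: it is what
  leaves the boundary value \<open>\<psi> 0\<close> after integration by parts.\<close>

lemma resolvent_jump:
  assumes "c \<noteq> 0" shows "resolvent c n 1 - resolvent c n 0 = 1"
proof (cases "n = 0")
  case False
  define m where "m = - (2 * pi * c * of_int n)"
  have "m \<noteq> 0" using False assms by (simp add: m_def)
  then have "exp m - 1 \<noteq> 0" by simp
  moreover have "resolvent c n 1 = exp m / (exp m - 1)" "resolvent c n 0 = 1 / (exp m - 1)"
    using False by (auto simp: resolvent_def m_def)
  ultimately show ?thesis by (simp add: diff_divide_distrib[symmetric])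
qed (simp add: resolvent_def)

text \<open>For \<open>n \<noteq> 0\<close> the rate satisfies \<open>|m| \<ge> 2 pi |c|\<close>,
  which keeps the denominator away from 0. The bound is the same for all \<open>n\<close>, so the
  weights \<open>1 / (1 + n^2)\<close> alone dominate the kernel series.\<close>

lemma resolvent_bound:
  assumes "c \<noteq> 0" "s \<in> {0..1}"
  shows "\<bar>resolvent c n s\<bar> \<le> 1 / (1 - exp (- (2 * pi * \<bar>c\<bar>)))"
proof -
  define m0 where "m0 = 2 * pi * \<bar>c\<bar>"
  have m0: "m0 > 0" using assms by (simp add: m0_def)
  then have e0: "0 < exp (- m0)" "exp (- m0) < 1" by auto
  have one: "1 \<le> 1 / (1 - exp (- m0))" using e0 by (simp add: divide_simps)
  show ?thesis
  proof (cases "n = 0")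
    case True
    then have "\<bar>resolvent c n s\<bar> \<le> 1" using assms by (auto simp: resolvent_def abs_if)
    then show ?thesis using one unfolding m0_def by linarith
  next
    case False
    define m where "m = - (2 * pi * c * of_int n)"
    have r: "resolvent c n s = exp (m * s) / (exp m - 1)"
      using False by (auto simp: resolvent_def m_def)
    have "1 \<le> \<bar>real_of_int n\<bar>" using False by linarith
    then have m: "m0 \<le> \<bar>m\<bar>"
      using m0 mult_left_mono[of 1 "\<bar>real_of_int n\<bar>" m0] by (simp add: m_def m0_def abs_mult)
    show ?thesis
    proof (cases "m > 0")
      case True
      have "exp (m * s) \<le> exp m" using True assms by (simp add: mult_left_le)
      moreover have "exp m > 1" using True by simp
      ultimately have "\<bar>resolvent c n s\<bar> \<le> exp m / (exp m - 1)"
        unfolding r by (simp add: divide_right_mono)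
      also have "\<dots> = 1 / (1 - exp (- m))" using True by (simp add: exp_minus field_simps)
      also have "\<dots> \<le> 1 / (1 - exp (- m0))"
        using m True e0 by (intro divide_left_mono) (auto intro!: mult_pos_pos)
      finally show ?thesis by (simp add: m0_def)
    next
      case False
      then have neg: "m < 0" "m0 \<le> - m" using m m0 by auto
      have "exp (m * s) \<le> 1" using neg assms by (simp add: mult_nonpos_nonneg)
      moreover have "exp m \<le> exp (- m0)" using neg by simp
      moreover have "\<bar>resolvent c n s\<bar> = exp (m * s) / (1 - exp m)"
        using neg unfolding r by (simp add: abs_divide)
      ultimately have "\<bar>resolvent c n s\<bar> \<le> 1 / (1 - exp (- m0))"
        using e0 by (auto intro!: frac_le)
      then show ?thesis by (simp add: m0_def)
    qed
  qed
qed

lemma continuous_on_resolvent: "continuous_on S (resolvent c n)"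
  by (rule DERIV_continuous_on) (rule resolvent_has_derivative)

lemma one_plus_of_int_square_neq_0: "1 + (real_of_int n)\<^sup>2 \<noteq> 0" "1 + (complex_of_int n)\<^sup>2 \<noteq> 0"
proof -
  show r: "1 + (real_of_int n)\<^sup>2 \<noteq> 0"
    by (metis add_nonneg_eq_0_iff zero_le_one zero_le_power2 zero_neq_one)
  have "complex_of_real (1 + (of_int n)\<^sup>2) \<noteq> 0" using r by (simp only: of_real_eq_0_iff not_False_eq_True)
  then show "1 + (complex_of_int n)\<^sup>2 \<noteq> 0" by simp
qed

text \<open>The weight \<open>1 / (1 + n^2)\<close> is there for uniform convergence only and is
  undone by \<open>sharpen\<close>. The character carries a minus sign because translating a
  function by \<open>r\<close> along \<open>e2\<close> multiplies its \<open>n\<close>-th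
  coefficient by the opposite character.\<close>

definition torus_term :: "real \<Rightarrow> int \<Rightarrow> real \<times> real \<Rightarrow> complex" where
  "torus_term c n x =
     of_real (resolvent c n (fst x) / (1 + (of_int n)\<^sup>2)) * cis (- (2 * pi * of_int n * snd x))"

definition torus_kernel :: "real \<Rightarrow> real \<times> real \<Rightarrow> complex" where
  "torus_kernel c x = (\<Sum>\<^sub>\<infinity>n. torus_term c n x)"

lemma norm_torus_term_le:
  assumes "c \<noteq> 0" "fst x \<in> {0..1}"
  shows "cmod (torus_term c n x) \<le> 1 / (1 - exp (- (2 * pi * \<bar>c\<bar>))) * (1 / (1 + (of_int n)\<^sup>2))"
proof -
  have "cmod (torus_term c n x) = \<bar>resolvent c n (fst x)\<bar> * (1 / (1 + (of_int n)\<^sup>2))"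
    by (simp add: torus_term_def norm_mult abs_divide del: of_real_divide)
  also have "\<dots> \<le> 1 / (1 - exp (- (2 * pi * \<bar>c\<bar>))) * (1 / (1 + (of_int n)\<^sup>2))"
    by (intro mult_right_mono resolvent_bound assms) auto
  finally show ?thesis .
qed

lemma continuous_on_torus_term: "continuous_on S (torus_term c n)"
  unfolding torus_term_def[abs_def]
  by (intro continuous_intros continuous_on_compose2[OF continuous_on_resolvent[of UNIV]])
    (auto simp: one_plus_of_int_square_neq_0)

text \<open>A uniform limit of continuous functions on the closed square. Periodic extension would
  destroy continuity, since every resolvent jumps between \<open>s = 1\<close> and
  \<open>s = 0\<close>.\<close>

lemma continuous_on_torus_kernel:
  assumes "c \<noteq> 0" shows "continuous_on (cbox (0, 0) (1, 1)) (torus_kernel c)"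
proof -
  have "uniform_limit (cbox (0, 0) (1, 1)) (\<lambda>X x. \<Sum>n\<in>X. torus_term c n x)
      (\<lambda>x. \<Sum>\<^sub>\<infinity>n. torus_term c n x) (finite_subsets_at_top UNIV)"
    by (rule Weierstrass_m_test_general[OF norm_torus_term_le[OF assms]
          summable_on_cmult_right[OF summable_on_inverse_one_plus_square]])
      (auto simp: cbox_Pair_eq)
  then show ?thesis
    unfolding torus_kernel_def[abs_def]
    by (rule uniform_limit_theorem[rotated])
      (auto intro!: always_eventually continuous_intros continuous_on_torus_term)
qed

text \<open>Uniform convergence permits integration term by term, and orthogonality of the
  characters keeps the term \<open>n = m\<close> only.\<close>

lemma torus_kernel_coefficient:
  assumes "c \<noteq> 0" "s \<in> {0..1}"
  shows "integral {0..1} (\<lambda>r. torus_kernel c (s, r) * cis (2 * pi * of_int m * r)) =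
    of_real (resolvent c m s / (1 + (of_int m)\<^sup>2))"
proof -
  define f where "f = (\<lambda>n r. torus_term c n (s, r) * cis (2 * pi * of_int m * r))"
  have lim: "uniform_limit {0..1} (\<lambda>X r. \<Sum>n\<in>X. f n r) (\<lambda>r. \<Sum>\<^sub>\<infinity>n. f n r) (finite_subsets_at_top UNIV)"
  proof (rule Weierstrass_m_test_general[OF _
        summable_on_cmult_right[OF summable_on_inverse_one_plus_square]])
    show "cmod (f n r) \<le> 1 / (1 - exp (- (2 * pi * \<bar>c\<bar>))) * (1 / (1 + (of_int n)\<^sup>2))" for n r
      using norm_torus_term_le[OF assms(1), of "(s, r)" n] assms(2) by (simp add: f_def norm_mult)
  qed
  have fc: "continuous_on {0..1} (f n)" for n
    unfolding f_def
    by (intro continuous_intros continuous_on_compose2[OF continuous_on_torus_term[of UNIV]]) auto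
  have fi: "integral {0..1} (f n) = (if n = m then of_real (resolvent c m s / (1 + (of_int m)\<^sup>2)) else 0)" for n
  proof -
    have "f n = (\<lambda>r. of_real (resolvent c n s / (1 + (of_int n)\<^sup>2)) * cis (2 * pi * real_of_int (m - n) * (r - 0)))"
      by (auto simp: f_def torus_term_def fun_eq_iff cis_mult algebra_simps)
    then show ?thesis using integral_cis[of "m - n" 0] by simp
  qed
  obtain I J where I: "\<And>X. ((\<lambda>r. \<Sum>n\<in>X. f n r) has_integral I X) {0..1}"
    and J: "((\<lambda>r. \<Sum>\<^sub>\<infinity>n. f n r) has_integral J) {0..1}" "(I \<longlongrightarrow> J) (finite_subsets_at_top UNIV)"
    using uniform_limit_integral[OF lim continuous_on_sum[OF fc]] finite_subsets_at_top_neq_bot by blast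
  \<comment> \<open>The integrals are already equal to the limit for every finite index set that
    contains \<open>m\<close>.\<close>
  have "eventually (\<lambda>X. I X = of_real (resolvent c m s / (1 + (of_int m)\<^sup>2))) (finite_subsets_at_top UNIV)"
    unfolding eventually_finite_subsets_at_top
  proof (intro exI[of _ "{m}"] conjI allI impI)
    fix X :: "int set" assume X: "finite X \<and> {m} \<subseteq> X \<and> X \<subseteq> UNIV"
    have "I X = integral {0..1} (\<lambda>r. \<Sum>n\<in>X. f n r)" by (rule integral_unique[OF I, symmetric])
    also have "\<dots> = (\<Sum>n\<in>X. integral {0..1} (f n))"
      using X by (intro integral_sum integrable_continuous_interval fc) auto
    also have "\<dots> = of_real (resolvent c m s / (1 + (of_int m)\<^sup>2))" using X by (simp add: fi)
    finally show "I X = of_real (resolvent c m s / (1 + (of_int m)\<^sup>2))" .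
  qed auto
  then have "J = of_real (resolvent c m s / (1 + (of_int m)\<^sup>2))"
    using J(2) by (metis tendsto_eventually tendsto_unique finite_subsets_at_top_neq_bot)
  moreover have "(\<lambda>r. \<Sum>\<^sub>\<infinity>n. f n r) = (\<lambda>r. torus_kernel c (s, r) * cis (2 * pi * of_int m * r))"
    by (simp add: f_def torus_kernel_def infsum_cmult_left')
  ultimately show ?thesis using J(1) by (simp add: integral_unique)
qed

section \<open>Inverting the first-order operator along a torus\<close>

lemma integral_by_parts_periodic:
  fixes \<psi> :: "real \<Rightarrow> complex" and \<kappa> :: "real \<Rightarrow> real"
  assumes \<kappa>: "\<And>s. (\<kappa> has_real_derivative \<kappa>' s) (at s)" "continuous_on UNIV \<kappa>'" "\<kappa> 1 - \<kappa> 0 = 1"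
    and \<psi>: "\<And>s. (\<psi> has_vector_derivative \<psi>' s) (at s)" "continuous_on UNIV \<psi>'" "\<psi> 1 = \<psi> 0"
  shows "integral {0..1} (\<lambda>s. \<kappa> s *\<^sub>R \<psi>' s + \<kappa>' s *\<^sub>R \<psi> s) = \<psi> 0"
proof -
  have "((\<lambda>s. \<kappa> s *\<^sub>R \<psi>' s + \<kappa>' s *\<^sub>R \<psi> s) has_integral \<kappa> 1 *\<^sub>R \<psi> 1 - \<kappa> 0 *\<^sub>R \<psi> 0) {0..1}"
    by (intro fundamental_theorem_of_calculus has_vector_derivative_scaleR
        has_vector_derivative_at_within[OF \<psi>(1)] has_field_derivative_at_within[OF \<kappa>(1)]) auto
  moreover have "\<kappa> 1 *\<^sub>R \<psi> 1 - \<kappa> 0 *\<^sub>R \<psi> 0 = \<psi> 0"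
    using \<kappa>(3) \<psi>(3) by (simp add: scaleR_diff_left[symmetric])
  ultimately show ?thesis by (simp add: integral_unique)
qed

text \<open>The torus is swept out by two translation directions inside a larger space. The
  remaining coordinates are mere parameters, so smoothness in them is part of the same statement as
  smoothness along the torus.\<close>

locale torus_directions =
  fixes e1 e2 :: "'a::euclidean_space"
begin

definition coeff2 :: "int \<Rightarrow> ('a \<Rightarrow> complex) \<Rightarrow> 'a \<Rightarrow> complex" where
  "coeff2 n F p = integral {0..1} (\<lambda>r. cis (- (2 * pi * of_int n * r)) * F (p + r *\<^sub>R e2))"

lemma continuous_translate_line: "smooth F \<Longrightarrow> continuous_on S (\<lambda>r. F (p + r *\<^sub>R v))"
  by (intro continuous_on_compose2[OF smooth_continuous[of F UNIV]] continuous_intros) auto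

lemma smooth_coeff2: "smooth F \<Longrightarrow> smooth (coeff2 n F)"
  unfolding coeff2_def[abs_def] by (intro smooth_line_integral continuous_intros)

lemma dird_coeff2: "smooth F \<Longrightarrow> dird v (coeff2 n F) = coeff2 n (dird v F)"
  unfolding coeff2_def[abs_def] by (intro dird_line_integral continuous_intros)

lemma coeff2_linear:
  assumes "smooth F" "smooth G"
  shows "coeff2 n (\<lambda>p. F p + k * G p) p = coeff2 n F p + k * coeff2 n G p"
proof -
  have "coeff2 n (\<lambda>p. F p + k * G p) p = integral {0..1}
      (\<lambda>r. cis (- (2 * pi * of_int n * r)) * F (p + r *\<^sub>R e2)
        + k * (cis (- (2 * pi * of_int n * r)) * G (p + r *\<^sub>R e2)))"
    unfolding coeff2_def by (intro integral_cong) (simp add: algebra_simps)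
  also have "\<dots> = coeff2 n F p + k * coeff2 n G p"
    unfolding coeff2_def
    by (subst integral_add) (auto intro!: integrable_continuous_interval continuous_intros
        continuous_translate_line assms)
  finally show ?thesis .
qed

lemma coeff2_dird:
  assumes F: "smooth F" and per: "\<And>p. F (p + e2) = F p"
  shows "coeff2 n (dird e2 F) p = 2 * pi * \<i> * of_int n * coeff2 n F p"
proof -
  define k where "k = - (2 * pi * real_of_int n)"
  define E where "E = (\<lambda>r. cis (k * r))"
  have E': "(E has_vector_derivative (\<i> * k * E r)) (at r within S)" for r S
    using cis_line_has_vector_derivative[of k 0 r S] by (simp add: E_def)
  have Ec: "continuous_on S E" for S unfolding E_def by (intro continuous_intros)
  have "((\<lambda>r. E r * dird e2 F (p + r *\<^sub>R e2) + \<i> * k * E r * F (p + r *\<^sub>R e2)) has_integral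
      E 1 * F (p + 1 *\<^sub>R e2) - E 0 * F (p + 0 *\<^sub>R e2)) {0..1}"
    by (intro fundamental_theorem_of_calculus has_vector_derivative_mult E' smooth_along_line F) auto
  moreover have "E 1 = 1"
    using cis_multiple_2pi[of "- of_int n"] by (simp add: E_def k_def)
  moreover have "E 0 = 1" by (simp add: E_def)
  ultimately have "integral {0..1} (\<lambda>r. E r * dird e2 F (p + r *\<^sub>R e2) + \<i> * k * (E r * F (p + r *\<^sub>R e2))) = 0"
    by (simp add: integral_unique per mult.assoc)
  moreover have "integral {0..1} (\<lambda>r. E r * dird e2 F (p + r *\<^sub>R e2) + \<i> * k * (E r * F (p + r *\<^sub>R e2))) =
      coeff2 n (dird e2 F) p + \<i> * k * coeff2 n F p"
    by (subst integral_add)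
      (auto intro!: integrable_continuous_interval continuous_intros continuous_translate_line F smooth_dird Ec
        simp: coeff2_def E_def k_def)
  ultimately show ?thesis by (simp add: k_def algebra_simps eq_neg_iff_add_eq_0)
qed

lemma coeff2_shift:
  assumes F: "smooth F" and per: "\<And>p. F (p + e2) = F p" and r: "0 \<le> r" "r \<le> 1"
  shows "coeff2 n F (p + r *\<^sub>R e2) = cis (2 * pi * of_int n * r) * coeff2 n F p"
proof -
  define \<phi> where "\<phi> = (\<lambda>x. cis (- (2 * pi * of_int n * x)) * F (p + x *\<^sub>R e2))"
  have "cis (- (2 * pi * of_int n * (x + 1))) = cis (- (2 * pi * of_int n * x))" for x
  proof -
    have "cis (- (2 * pi * of_int n * (x + 1))) = cis (- (2 * pi * of_int n * x)) * cis (2 * pi * - of_int n)"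
      by (simp add: cis_mult algebra_simps)
    then show ?thesis using cis_multiple_2pi[of "- of_int n"] by simp
  qed
  moreover have "F (p + (x + 1) *\<^sub>R e2) = F (p + x *\<^sub>R e2)" for x
    using per[of "p + x *\<^sub>R e2"] by (simp add: algebra_simps)
  ultimately have "integral {0..1} (\<lambda>x. \<phi> (x + r)) = integral {0..1} \<phi>"
    using r by (intro periodic_integral_shift)
      (auto simp: \<phi>_def intro!: continuous_intros continuous_translate_line F)
  moreover have "coeff2 n F (p + r *\<^sub>R e2) = integral {0..1} (\<lambda>x. cis (2 * pi * of_int n * r) * \<phi> (x + r))"
    unfolding coeff2_def \<phi>_def by (intro integral_cong) (simp add: cis_mult algebra_simps)
  ultimately show ?thesis by (simp add: coeff2_def \<phi>_def)
qed

text \<open>An average of translates of \<open>F\<close>, so it inherits each symmetry of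
  \<open>F\<close> that commutes with translations along \<open>e1\<close> and \<open>e2\<close>; in
  particular it commutes with every directional derivative.\<close>

definition torus_op :: "real \<Rightarrow> ('a \<Rightarrow> complex) \<Rightarrow> 'a \<Rightarrow> complex" where
  "torus_op c F p =
     integral (cbox (0, 0) (1, 1)) (\<lambda>x. torus_kernel c x * F (p + (fst x *\<^sub>R e1 + snd x *\<^sub>R e2)))"

lemma
  assumes "c \<noteq> 0" "smooth F"
  shows smooth_torus_op: "smooth (torus_op c F)"
    and dird_torus_op: "dird v (torus_op c F) = torus_op c (dird v F)"
  unfolding torus_op_def[abs_def]
  by (intro smooth_parameter_integral dird_parameter_integral continuous_on_torus_kernel
      continuous_intros assms)+

text \<open>After exchanging the integrals, moving the base point along \<open>e2\<close> only
  multiplies the coefficient of \<open>F\<close> by a character. The integral over \<open>r\<close>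
  is then a Fourier coefficient of the kernel, and a convolution with the resolvent along
  \<open>e1\<close> remains.\<close>

lemma coeff2_torus_op:
  assumes c: "c \<noteq> 0" and F: "smooth F" and per: "\<And>p. F (p + e2) = F p"
  shows "coeff2 n (torus_op c F) p =
    integral {0..1} (\<lambda>s. of_real (resolvent c n s / (1 + (of_int n)\<^sup>2)) * coeff2 n F (p + s *\<^sub>R e1))"
proof -
  define E where "E = (\<lambda>r. cis (- (2 * pi * of_int n * r)))"
  have Ec: "continuous_on UNIV E" unfolding E_def by (intro continuous_intros)
  have "coeff2 n (torus_op c F) p = integral (cbox 0 1) (\<lambda>r. integral (cbox (0, 0) (1, 1))
      (\<lambda>x. E r * (torus_kernel c x * F (p + r *\<^sub>R e2 + (fst x *\<^sub>R e1 + snd x *\<^sub>R e2)))))"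
    by (simp add: coeff2_def torus_op_def E_def)
  also have "\<dots> = integral (cbox (0, 0) (1, 1)) (\<lambda>x. integral (cbox 0 1)
      (\<lambda>r. E r * (torus_kernel c x * F (p + r *\<^sub>R e2 + (fst x *\<^sub>R e1 + snd x *\<^sub>R e2)))))"
  proof (rule integral_swap_continuous)
    show "continuous_on (cbox (0, (0, 0)) (1, (1, 1))) (\<lambda>(r, x). E r * (torus_kernel c x *
        F (p + r *\<^sub>R e2 + (fst x *\<^sub>R e1 + snd x *\<^sub>R e2))))"
      unfolding split_beta
      by (intro continuous_intros continuous_on_compose2[OF Ec]
          continuous_on_compose2[OF continuous_on_torus_kernel[OF c]]
          continuous_on_compose2[OF smooth_continuous[OF F, of UNIV]])
        (auto simp: cbox_Pair_eq)
  qed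
  also have "\<dots> = integral (cbox (0, 0) (1, 1)) (\<lambda>x. torus_kernel c x *
      cis (2 * pi * of_int n * snd x) * coeff2 n F (p + fst x *\<^sub>R e1))"
  proof (rule integral_cong)
    fix x :: "real \<times> real" assume x: "x \<in> cbox (0, 0) (1, 1)"
    have "integral (cbox 0 1) (\<lambda>r. E r * (torus_kernel c x * F (p + r *\<^sub>R e2 + (fst x *\<^sub>R e1 + snd x *\<^sub>R e2)))) =
        integral {0..1} (\<lambda>r. torus_kernel c x * (E r * F (p + fst x *\<^sub>R e1 + snd x *\<^sub>R e2 + r *\<^sub>R e2)))"
      by (simp add: algebra_simps)
    also have "\<dots> = torus_kernel c x * coeff2 n F (p + fst x *\<^sub>R e1 + snd x *\<^sub>R e2)"
      by (simp add: coeff2_def E_def)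
    also have "coeff2 n F (p + fst x *\<^sub>R e1 + snd x *\<^sub>R e2) =
        cis (2 * pi * of_int n * snd x) * coeff2 n F (p + fst x *\<^sub>R e1)"
      using x by (intro coeff2_shift F per) (auto simp: cbox_Pair_eq mem_Times_iff)
    finally show "integral (cbox 0 1) (\<lambda>r. E r * (torus_kernel c x * F (p + r *\<^sub>R e2 + (fst x *\<^sub>R e1 + snd x *\<^sub>R e2)))) =
        torus_kernel c x * cis (2 * pi * of_int n * snd x) * coeff2 n F (p + fst x *\<^sub>R e1)"
      by (simp add: mult.assoc)
  qed
  also have "\<dots> = integral (cbox 0 1) (\<lambda>s. integral (cbox 0 1) (\<lambda>r. torus_kernel c (s, r) *
      cis (2 * pi * of_int n * r) * coeff2 n F (p + s *\<^sub>R e1)))"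
    by (subst integral_prod_continuous)
      (auto intro!: continuous_intros continuous_on_torus_kernel c
        continuous_on_compose2[OF smooth_continuous[OF smooth_coeff2[OF F], of UNIV]])
  also have "\<dots> = integral {0..1} (\<lambda>s. of_real (resolvent c n s / (1 + (of_int n)\<^sup>2)) * coeff2 n F (p + s *\<^sub>R e1))"
    unfolding cbox_interval
    by (intro integral_cong) (simp add: torus_kernel_coefficient[OF c])
  finally show ?thesis .
qed

text \<open>Two derivatives along \<open>e2\<close> multiply the \<open>n\<close>-th coefficient by
  \<open>- 4 pi^2 n^2\<close>; the constant is chosen so that the total multiplier is
  \<open>1 + n^2\<close>, the reciprocal of the weight in \<open>torus_term\<close>.\<close>

definition sharpen :: "('a \<Rightarrow> complex) \<Rightarrow> 'a \<Rightarrow> complex" where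
  "sharpen F = (\<lambda>p. F p + of_real (- 1 / (4 * pi\<^sup>2)) * dird e2 (dird e2 F) p)"

lemma smooth_sharpen: "smooth F \<Longrightarrow> smooth (sharpen F)"
  unfolding sharpen_def by (intro smooth_intros)

lemma dird_invariant:
  assumes F: "smooth F" and T: "\<And>p r. T (p + r *\<^sub>R v) = T p + r *\<^sub>R v" and inv: "\<And>p. F (T p) = F p"
  shows "dird v F (T p) = dird v F p"
proof -
  have "((\<lambda>r. F (T p + r *\<^sub>R v)) has_vector_derivative dird v F (T p + 0 *\<^sub>R v)) (at 0)"
    "((\<lambda>r. F (p + r *\<^sub>R v)) has_vector_derivative dird v F (p + 0 *\<^sub>R v)) (at 0)"
    by (rule smooth_along_line[OF F])+
  moreover have "(\<lambda>r. F (T p + r *\<^sub>R v)) = (\<lambda>r. F (p + r *\<^sub>R v))"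
    by (metis T inv)
  ultimately show ?thesis using vector_derivative_unique_at by fastforce
qed

lemma sharpen_invariant:
  assumes F: "smooth F" and T: "\<And>p r. T (p + r *\<^sub>R e2) = T p + r *\<^sub>R e2" and inv: "\<And>p. F (T p) = F p"
  shows "sharpen F (T p) = sharpen F p"
proof -
  have 1: "dird e2 F (T p) = dird e2 F p" for p by (rule dird_invariant[OF F T inv])
  have 2: "dird e2 (dird e2 F) (T p) = dird e2 (dird e2 F) p" for p
    by (rule dird_invariant[OF smooth_dird[OF F] T 1])
  show ?thesis by (simp add: sharpen_def inv 2)
qed

lemma coeff2_sharpen:
  assumes F: "smooth F" and per: "\<And>p. F (p + e2) = F p"
  shows "coeff2 n (sharpen F) p = (1 + (of_int n)\<^sup>2) * coeff2 n F p"
proof -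
  have per': "dird e2 F (p + e2) = dird e2 F p" for p
    by (rule dird_invariant[OF F _ per]) (simp add: algebra_simps)
  have "coeff2 n (sharpen F) p = coeff2 n F p + of_real (- 1 / (4 * pi\<^sup>2)) * coeff2 n (dird e2 (dird e2 F)) p"
    unfolding sharpen_def by (intro coeff2_linear smooth_dird F)
  also have "coeff2 n (dird e2 (dird e2 F)) p = (2 * pi * \<i> * of_int n)\<^sup>2 * coeff2 n F p"
    by (simp add: coeff2_dird[OF smooth_dird[OF F] per'] coeff2_dird[OF F per] power2_eq_square)
  also have "of_real (- 1 / (4 * pi\<^sup>2)) * ((2 * pi * \<i> * of_int n)\<^sup>2 * coeff2 n F p) = (of_int n)\<^sup>2 * coeff2 n F p"
    by (simp add: power_mult_distrib)
  finally show ?thesis by (simp add: algebra_simps)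
qed

text \<open>The residual \<open>g\<close> has no coefficient along \<open>e2\<close> except the
  zeroth, which is \<open>A\<close>, the mean over the torus; this is why both derivatives kill it.
  The clause on \<open>T\<close> transfers symmetries of \<open>F\<close> to \<open>u\<close> and is
  what later lets \<open>u\<close> descend to the quotient.\<close>

theorem torus_equation_solvable:
  assumes c: "c \<noteq> 0" and F: "smooth F" and per: "\<And>p. F (p + e1) = F p" "\<And>p. F (p + e2) = F p"
  obtains u where "smooth u"
    "\<And>p. dird e1 (\<lambda>p. F p - (dird e1 u p + \<i> * of_real c * dird e2 u p)) p = 0"
    "\<And>p. dird e2 (\<lambda>p. F p - (dird e1 u p + \<i> * of_real c * dird e2 u p)) p = 0"
    "\<And>T p. (\<And>p s r. T (p + s *\<^sub>R e1 + r *\<^sub>R e2) = T p + s *\<^sub>R e1 + r *\<^sub>R e2) \<Longrightarrow> (\<And>p. F (T p) = F p) \<Longrightarrow>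
      u (T p) = u p"
proof
  define H where "H = sharpen F"
  have H: "smooth H" unfolding H_def by (rule smooth_sharpen[OF F])
  have H2: "H (p + e2) = H p" for p
    unfolding H_def by (rule sharpen_invariant[OF F _ per(2)]) (simp add: algebra_simps)
  have H1: "H (p + e1) = H p" for p
    unfolding H_def by (rule sharpen_invariant[OF F _ per(1)]) (simp add: algebra_simps)
  define u where "u = torus_op c H"
  show u: "smooth u" unfolding u_def by (rule smooth_torus_op[OF c H])
  define D where "D = (\<lambda>p. dird e1 u p + \<i> * of_real c * dird e2 u p)"
  define g where "g = (\<lambda>p. F p - D p)"
  have D: "smooth D" unfolding D_def by (intro smooth_intros u)
  have g: "smooth g" unfolding g_def by (intro smooth_intros D F)
  have coeff_D: "coeff2 n D p = coeff2 n F p -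
      (if n = 0 then integral {0..1} (\<lambda>s. coeff2 0 F (p + s *\<^sub>R e1)) else 0)" for n p
  proof -
    define \<psi> where "\<psi> = (\<lambda>s. coeff2 n H (p + s *\<^sub>R e1))"
    define \<psi>' where "\<psi>' = (\<lambda>s. coeff2 n (dird e1 H) (p + s *\<^sub>R e1))"
    define \<kappa> where "\<kappa> = (\<lambda>s. of_real (resolvent c n s / (1 + (of_int n)\<^sup>2)) :: complex)"
    define m where "m = 2 * pi * c * real_of_int n"
    have \<psi>c: "continuous_on S \<psi>" "continuous_on S \<psi>'" for S
      unfolding \<psi>_def \<psi>'_def by (intro continuous_translate_line smooth_coeff2 smooth_dird H)+
    have \<kappa>c: "continuous_on S \<kappa>" for S
      unfolding \<kappa>_def by (intro continuous_intros continuous_on_resolvent)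
        (simp add: one_plus_of_int_square_neq_0)
    have d2H: "coeff2 n (dird e2 H) q = 2 * pi * \<i> * of_int n * coeff2 n H q" for q
      by (rule coeff2_dird[OF H H2])
    have dH2: "dird v H (p + e2) = dird v H p" for v p
      using dird_translate[OF H, of v e2 p] H2 by simp
    have \<kappa>\<psi>: "(\<lambda>s. \<kappa> s * \<psi> s) integrable_on {0..1}" "(\<lambda>s. \<kappa> s * \<psi>' s) integrable_on {0..1}"
      by (intro integrable_continuous_interval continuous_intros \<psi>c \<kappa>c)+
    have "coeff2 n D p = coeff2 n (dird e1 u) p + \<i> * of_real c * coeff2 n (dird e2 u) p"
      unfolding D_def by (intro coeff2_linear smooth_dird u)
    also have "\<dots> = integral {0..1} (\<lambda>s. \<kappa> s * \<psi>' s) + \<i> * of_real c *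
        integral {0..1} (\<lambda>s. \<kappa> s * (2 * pi * \<i> * of_int n * \<psi> s))"
      by (simp add: u_def dird_torus_op[OF c H] coeff2_torus_op[OF c smooth_dird[OF H] dH2] \<kappa>_def \<psi>_def \<psi>'_def d2H)
    also have "\<dots> = integral {0..1} (\<lambda>s. \<kappa> s * \<psi>' s) + integral {0..1} (\<lambda>s. (- m) *\<^sub>R (\<kappa> s * \<psi> s))"
    proof -
      have "(\<lambda>s. (- m) *\<^sub>R (\<kappa> s * \<psi> s)) = (\<lambda>s. \<i> * of_real c * (\<kappa> s * (2 * pi * \<i> * of_int n * \<psi> s)))"
        by (auto simp: m_def fun_eq_iff scaleR_conv_of_real algebra_simps)
      then show ?thesis by simp
    qed
    also have "\<dots> = integral {0..1} (\<lambda>s. \<kappa> s * \<psi>' s - m *\<^sub>R (\<kappa> s * \<psi> s))"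
      using \<kappa>\<psi> by (subst integral_add[symmetric]) (auto intro: integrable_cmul integrable_neg)
    also have "\<dots> = (1 / (1 + (of_int n)\<^sup>2)) * integral {0..1} (\<lambda>s. resolvent c n s *\<^sub>R \<psi>' s - (m * resolvent c n s) *\<^sub>R \<psi> s)"
      unfolding integral_mult_right[symmetric]
      by (intro integral_cong) (simp add: \<kappa>_def scaleR_conv_of_real diff_divide_distrib algebra_simps)
    also have "integral {0..1} (\<lambda>s. resolvent c n s *\<^sub>R \<psi>' s - (m * resolvent c n s) *\<^sub>R \<psi> s) =
        \<psi> 0 - (if n = 0 then integral {0..1} \<psi> else 0)"
    proof -
      \<comment> \<open>For \<open>n = 0\<close> the resolvent has derivative 1 whereas
        \<open>m\<close> is 0; the discrepancy produces the mean of \<open>\<psi>\<close>, the part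
        of the equation that cannot be solved.\<close>
      define \<kappa>' where "\<kappa>' = (\<lambda>s. if n = 0 then 1 else - (2 * pi * c * of_int n) * resolvent c n s)"
      have \<kappa>'c: "continuous_on S \<kappa>'" for S
        by (cases "n = 0") (auto simp: \<kappa>'_def intro!: continuous_intros continuous_on_resolvent)
      have "\<psi> 1 = \<psi> 0"
        using dird_translate[OF H, of 0 e1] by (simp add: \<psi>_def coeff2_def H1 add.commute[of p] add.assoc[of _ p])
          (metis (no_types, opaque_lifting) H1 add.assoc add.commute)
      moreover have "(\<psi> has_vector_derivative \<psi>' s) (at s)" for s
        unfolding \<psi>_def \<psi>'_def
        using smooth_along_line[OF smooth_coeff2[OF H], of n p e1] by (simp add: dird_coeff2[OF H])
      ultimately have "integral {0..1} (\<lambda>s. resolvent c n s *\<^sub>R \<psi>' s + \<kappa>' s *\<^sub>R \<psi> s) = \<psi> 0"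
        by (intro integral_by_parts_periodic \<psi>c \<kappa>'c resolvent_jump[OF c])
          (use resolvent_has_derivative in \<open>auto simp: \<kappa>'_def\<close>)
      moreover have "integral {0..1} (\<lambda>s. resolvent c n s *\<^sub>R \<psi>' s - (m * resolvent c n s) *\<^sub>R \<psi> s) =
          integral {0..1} (\<lambda>s. resolvent c n s *\<^sub>R \<psi>' s + \<kappa>' s *\<^sub>R \<psi> s) - (if n = 0 then integral {0..1} \<psi> else 0)"
      proof (cases "n = 0")
        case True
        have "integral {0..1} (\<lambda>s. resolvent c n s *\<^sub>R \<psi>' s + \<kappa>' s *\<^sub>R \<psi> s) =
            integral {0..1} (\<lambda>s. resolvent c n s *\<^sub>R \<psi>' s) + integral {0..1} \<psi>"
          using True by (subst integral_add[symmetric])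
            (auto simp: \<kappa>'_def intro!: integrable_continuous_interval continuous_intros \<psi>c continuous_on_resolvent)
        then show ?thesis using True by (simp add: m_def)
      qed (simp add: \<kappa>'_def m_def)
      ultimately show ?thesis by simp
    qed
    also have "(1 / (1 + (of_int n)\<^sup>2)) * (\<psi> 0 - (if n = 0 then integral {0..1} \<psi> else 0)) =
        coeff2 n F p - (if n = 0 then integral {0..1} (\<lambda>s. coeff2 0 F (p + s *\<^sub>R e1)) else 0)"
    proof -
      have n: "(1 + (of_int n)\<^sup>2 :: complex) \<noteq> 0" by (rule one_plus_of_int_square_neq_0)
      have "\<psi> = (\<lambda>s. (1 + (of_int n)\<^sup>2) * coeff2 n F (p + s *\<^sub>R e1))"
        unfolding \<psi>_def H_def by (simp add: coeff2_sharpen[OF F per(2)])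
      then show ?thesis using n by (cases "n = 0") simp_all
    qed
    finally show ?thesis .
  qed
  define A where "A = (\<lambda>p. integral {0..1} (\<lambda>s. 1 * coeff2 0 F (p + s *\<^sub>R e1)))"
  have coeff_g: "coeff2 n g p = (if n = 0 then A p else 0)" for n p
    using coeff2_linear[OF F D, of n "- 1" p] coeff_D[of n p] by (simp add: g_def A_def)
  \<comment> \<open>The uniqueness lemma gives the value at the midpoint of a unit segment, so
    \<open>p\<close> is taken as the midpoint of the segment that starts half a period
    earlier.\<close>
  have gA: "g p = A (p + (- (1/2)) *\<^sub>R e2)" for p
  proof -
    define q where "q = p + (- (1/2)) *\<^sub>R e2"
    have "g (q + (1/2) *\<^sub>R e2) = integral {0..1} (\<lambda>r. g (q + r *\<^sub>R e2))"
      using coeff_g[of _ q]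
      by (intro only_constant_fourier_coefficient[where g' = "\<lambda>r. dird e2 g (q + r *\<^sub>R e2)"]
          smooth_along_line continuous_translate_line smooth_dird g)
        (simp add: coeff2_def mult.commute)
    also have "\<dots> = A q" using coeff_g[of 0 q] by (simp add: coeff2_def)
    finally show ?thesis by (simp add: q_def)
  qed
  have cF: "smooth (coeff2 0 F)" by (rule smooth_coeff2[OF F])
  have A: "smooth A" unfolding A_def by (intro smooth_line_integral cF continuous_intros)
  have "dird e1 A p = 0" for p
  proof -
    have "dird e1 A p = integral {0..1} (\<lambda>s. dird e1 (coeff2 0 F) (p + s *\<^sub>R e1))"
      unfolding A_def by (subst dird_line_integral[OF cF]) (auto intro: continuous_intros)
    also have "\<dots> = coeff2 0 F (p + e1) - coeff2 0 F p" using integral_dird[OF cF, of 0 1 e1 p] by simp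
    also have "coeff2 0 F (p + e1) = coeff2 0 F p"
    proof -
      have "F (p + e1 + r *\<^sub>R e2) = F (p + r *\<^sub>R e2)" for r
        using per(1)[of "p + r *\<^sub>R e2"] by (simp add: algebra_simps)
      then show ?thesis by (simp add: coeff2_def)
    qed
    finally show ?thesis by simp
  qed
  moreover have "dird e2 A p = 0" for p
    unfolding A_def
    by (subst dird_line_integral[OF cF]) (auto intro: continuous_intros simp: dird_coeff2[OF F] coeff2_dird[OF F per(2)])
  moreover have "g = (\<lambda>p. A (p + (- (1/2)) *\<^sub>R e2))" by (rule ext) (rule gA)
  ultimately have "dird e1 g p = 0" "dird e2 g p = 0" for p
    by (simp_all only: dird_translate[OF A])
  then show "dird e1 (\<lambda>p. F p - (dird e1 u p + \<i> * of_real c * dird e2 u p)) p = 0"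
    "dird e2 (\<lambda>p. F p - (dird e1 u p + \<i> * of_real c * dird e2 u p)) p = 0" for p
    by (simp_all only: g_def D_def)
  show "u (T p) = u p" if T: "\<And>p s r. T (p + s *\<^sub>R e1 + r *\<^sub>R e2) = T p + s *\<^sub>R e1 + r *\<^sub>R e2"
    and inv: "\<And>p. F (T p) = F p" for T p
  proof -
    have "H (T p) = H p" for p
      unfolding H_def using T[of _ 0] by (intro sharpen_invariant F inv) simp
    moreover have "T p + (s *\<^sub>R e1 + r *\<^sub>R e2) = T (p + (s *\<^sub>R e1 + r *\<^sub>R e2))" for s r
      using T[of p s r] by (simp add: add.assoc)
    ultimately show ?thesis by (simp add: u_def torus_op_def)
  qed
qed

end


section \<open>Functions on the quotient\<close>

definition quotient_function :: "(point \<Rightarrow> complex) \<Rightarrow> bool" where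
  "quotient_function f \<longleftrightarrow> smooth f \<and> (\<forall>\<gamma>\<in>lattice. \<forall>p. f (gmul \<gamma> p) = f p)"

definition lder :: "coord \<Rightarrow> (point \<Rightarrow> complex) \<Rightarrow> point \<Rightarrow> complex" where
  "lder k f p = dird (frame k p) f p"

abbreviation cube_integral :: "(point \<Rightarrow> complex) \<Rightarrow> complex" where
  "cube_integral \<equiv> integral (cbox 0 1)"

lemma sum_coord: "(\<Sum>i\<in>UNIV. f i) = f Cx1 + f Cx2 + f Cy1 + f Cy2 + f Cz + (f Ct :: 'a::comm_monoid_add)"
  by (simp add: UNIV_coord add.assoc)

lemma forall_coord: "(\<forall>i. P i) \<longleftrightarrow> P Cx1 \<and> P Cx2 \<and> P Cy1 \<and> P Cy2 \<and> P Cz \<and> P Ct"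
  by (metis coord.exhaust)

lemma quotient_functionD:
  assumes "quotient_function f"
  shows quotient_function_smooth: "smooth f"
    and quotient_function_invariant: "\<gamma> \<in> lattice \<Longrightarrow> f (gmul \<gamma> p) = f p"
  using assms by (auto simp: quotient_function_def)

lemma dird_direction_of_real:
  fixes f :: "'a::real_normed_vector \<Rightarrow> complex"
  shows "smooth f \<Longrightarrow> dird (r *\<^sub>R v) f x = of_real r * dird v f x"
  by (simp add: dird_direction_scaleR scaleR_conv_of_real)

lemma lder_eq:
  assumes "smooth f"
  shows "lder k f = (case k of
      Cy1 \<Rightarrow> (\<lambda>p. dird (axis Cy1 1) f p + of_real (p $ Cx1) * dird (axis Cz 1) f p)
    | Cy2 \<Rightarrow> (\<lambda>p. dird (axis Cy2 1) f p + of_real (p $ Cx2) * dird (axis Cz 1) f p)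
    | _ \<Rightarrow> dird (axis k 1) f)"
  using assms
  by (cases k) (auto simp: lder_def frame_def fun_eq_iff dird_direction_add dird_direction_of_real)

lemma smooth_lder: "smooth f \<Longrightarrow> smooth (lder k f)"
  by (cases k) (auto simp: lder_eq intro!: smooth_intros)

lemma dtrans_eq: "dtrans \<gamma> p = (\<lambda>v. v + (\<gamma> $ Cx1 * v $ Cy1 + \<gamma> $ Cx2 * v $ Cy2) *\<^sub>R axis Cz 1)"
  using frechet_derivative_at[OF has_derivative_gmul] by simp

lemma lder_invariant:
  assumes f: "smooth f" and inv: "\<And>p. f (gmul \<gamma> p) = f p"
  shows "lder k f (gmul \<gamma> p) = lder k f p"
proof -
  have "(gmul \<gamma> has_derivative dtrans \<gamma> p) (at p)"
    unfolding dtrans_eq by (rule has_derivative_gmul)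
  then have "((\<lambda>q. f (gmul \<gamma> q)) has_derivative (\<lambda>v. dird (dtrans \<gamma> p v) f (gmul \<gamma> p))) (at p)"
    by (rule has_derivative_compose[OF _ smooth_has_derivative[OF f]])
  then have "dird v f p = dird (dtrans \<gamma> p v) f (gmul \<gamma> p)" for v
    unfolding inv by (rule has_derivative_dird)
  then show ?thesis by (simp add: lder_def frame_left_invariant)
qed

lemma quotient_function_lder: "quotient_function f \<Longrightarrow> quotient_function (lder k f)"
  unfolding quotient_function_def using smooth_lder lder_invariant by blast

lemma quotient_function_const: "quotient_function (\<lambda>p. c)"
  by (simp add: quotient_function_def smooth_const)

lemma quotient_function_add:
  "quotient_function f \<Longrightarrow> quotient_function g \<Longrightarrow> quotient_function (\<lambda>p. f p + g p)"
  by (simp add: quotient_function_def smooth_add)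

lemma quotient_function_diff:
  "quotient_function f \<Longrightarrow> quotient_function g \<Longrightarrow> quotient_function (\<lambda>p. f p - g p)"
  by (simp add: quotient_function_def smooth_diff)

lemma quotient_function_mult:
  "quotient_function f \<Longrightarrow> quotient_function g \<Longrightarrow> quotient_function (\<lambda>p. f p * g p)"
  by (simp add: quotient_function_def smooth_mult)

lemma quotient_function_cnj: "quotient_function f \<Longrightarrow> quotient_function (\<lambda>p. cnj (f p))"
  by (simp add: quotient_function_def smooth_cnj)

lemma quotient_function_sum:
  "(\<And>i. i \<in> I \<Longrightarrow> quotient_function (f i)) \<Longrightarrow> quotient_function (\<lambda>p. \<Sum>i\<in>I. f i p)"
  by (induction I rule: infinite_finite_induct) (auto intro: quotient_function_const quotient_function_add)

lemmas quotient_function_intros = quotient_function_const quotient_function_add quotient_function_diff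
  quotient_function_mult quotient_function_cnj quotient_function_sum quotient_function_lder

lemma lder_const [simp]: "lder k (\<lambda>p. c) = (\<lambda>p. 0)"
  by (simp add: lder_def fun_eq_iff)

lemma lder_add: "smooth f \<Longrightarrow> smooth g \<Longrightarrow> lder k (\<lambda>p. f p + g p) = (\<lambda>p. lder k f p + lder k g p)"
  by (simp add: lder_def fun_eq_iff dird_add)

lemma lder_diff: "smooth f \<Longrightarrow> smooth g \<Longrightarrow> lder k (\<lambda>p. f p - g p) = (\<lambda>p. lder k f p - lder k g p)"
  by (simp add: lder_def fun_eq_iff dird_diff)

lemma lder_mult:
  "smooth f \<Longrightarrow> smooth g \<Longrightarrow> lder k (\<lambda>p. f p * g p) = (\<lambda>p. f p * lder k g p + lder k f p * g p)"
  by (simp add: lder_def fun_eq_iff dird_mult)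

lemma lder_cnj: "smooth f \<Longrightarrow> lder k (\<lambda>p. cnj (f p)) = (\<lambda>p. cnj (lder k f p))"
  by (simp add: lder_def fun_eq_iff dird_cnj)

lemma lder_sum:
  "(\<And>i. i \<in> I \<Longrightarrow> smooth (f i)) \<Longrightarrow> lder k (\<lambda>p. \<Sum>i\<in>I. f i p) = (\<lambda>p. \<Sum>i\<in>I. lder k (f i) p)"
  by (simp add: lder_def fun_eq_iff dird_sum)

lemma dird_eq_lder:
  assumes "smooth f"
  shows "dird v f p = of_real (v $ Cx1) * lder Cx1 f p + of_real (v $ Cx2) * lder Cx2 f p
    + of_real (v $ Cy1) * lder Cy1 f p + of_real (v $ Cy2) * lder Cy2 f p
    + of_real (v $ Cz - p $ Cx1 * v $ Cy1 - p $ Cx2 * v $ Cy2) * lder Cz f p + of_real (v $ Ct) * lder Ct f p"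
proof -
  have v: "v = v $ Cx1 *\<^sub>R axis Cx1 1 + (v $ Cx2 *\<^sub>R axis Cx2 1 + (v $ Cy1 *\<^sub>R axis Cy1 1
      + (v $ Cy2 *\<^sub>R axis Cy2 1 + (v $ Cz *\<^sub>R axis Cz 1 + v $ Ct *\<^sub>R axis Ct 1))))"
    by (simp add: vec_eq_iff forall_coord axis_def)
  have "dird v f p = of_real (v $ Cx1) * dird (axis Cx1 1) f p + (of_real (v $ Cx2) * dird (axis Cx2 1) f p
      + (of_real (v $ Cy1) * dird (axis Cy1 1) f p + (of_real (v $ Cy2) * dird (axis Cy2 1) f p
      + (of_real (v $ Cz) * dird (axis Cz 1) f p + of_real (v $ Ct) * dird (axis Ct 1) f p))))"
    by (subst v) (simp only: dird_direction_add[OF assms] dird_direction_of_real[OF assms])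
  then show ?thesis by (simp add: lder_eq[OF assms] algebra_simps)
qed

text \<open>The Heisenberg relations [X_i, Y_i] = Z, the only nonzero brackets of the left-invariant
  frame.\<close>

definition bracket_coeff :: "coord \<Rightarrow> coord \<Rightarrow> complex" where
  "bracket_coeff k l =
    (if (k, l) \<in> {(Cx1, Cy1), (Cx2, Cy2)} then 1 else if (k, l) \<in> {(Cy1, Cx1), (Cy2, Cx2)} then - 1 else 0)"

lemma dird_coordinate_mult:
  fixes f :: "point \<Rightarrow> complex"
  assumes "smooth f"
  shows "dird v (\<lambda>p. complex_of_real (p $ i) * f p) = (\<lambda>p. of_real (p $ i) * dird v f p + of_real (v $ i) * f p)"
proof -
  have "dird v (\<lambda>p::point. complex_of_real (p $ i)) = (\<lambda>p. of_real (v $ i))"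
    by (rule ext, rule dird_affine[where d = 0])
      (auto intro: bounded_linear_compose[OF bounded_linear_of_real bounded_linear_vec_nth])
  then show ?thesis by (simp add: dird_mult[OF _ assms] smooth_intros)
qed

lemma lder_commute:
  assumes f: "smooth f"
  shows "lder k (lder l f) p - lder l (lder k f) p = bracket_coeff k l * lder Cz f p"
  by (cases k; cases l)
    (simp_all add: lder_eq smooth_intros f dird_add dird_coordinate_mult dird_commute[OF f] bracket_coeff_def axis_def
      algebra_simps)

subsection \<open>Integration over the unit cube\<close>

text \<open>The translated cube is cut along the face where coordinate \<open>i\<close> equals 1,
  and the overhanging slab is moved back by one period, where it completes the unit cube.\<close>

lemma cube_integral_shift:
  fixes f :: "real^'n \<Rightarrow> complex"
  assumes c: "continuous_on UNIV f" and per: "\<And>p. f (p + axis i 1) = f p" and s: "0 \<le> s" "s \<le> 1"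
  shows "integral (cbox 0 1) (\<lambda>p. f (p + s *\<^sub>R axis i 1)) = integral (cbox 0 1) f"
proof -
  define e :: "real^'n" where "e = axis i 1"
  have split: "(\<forall>j. P j) \<longleftrightarrow> P i \<and> (\<forall>j. j \<noteq> i \<longrightarrow> P j)" for P :: "'n \<Rightarrow> bool" by metis
  have int: "f integrable_on cbox x y" for x y
    by (intro integrable_continuous continuous_on_subset[OF c]) auto
  have e: "e \<in> Basis" by (simp add: e_def)
  have "integral (cbox 0 1) (\<lambda>p. f (p + s *\<^sub>R e)) = integral (cbox (s *\<^sub>R e) (1 + s *\<^sub>R e)) f"
    using integral_shift_cbox[of "s *\<^sub>R e" "s *\<^sub>R e" "1 + s *\<^sub>R e" f] by simp
  also have "\<dots> = integral (cbox (s *\<^sub>R e) (1 + s *\<^sub>R e) \<inter> {x. x \<bullet> e \<le> 1}) f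
      + integral (cbox (s *\<^sub>R e) (1 + s *\<^sub>R e) \<inter> {x. x \<bullet> e \<ge> 1}) f"
    by (rule integral_split[OF int e])
  also have "cbox (s *\<^sub>R e) (1 + s *\<^sub>R e) \<inter> {x. x \<bullet> e \<le> 1} = cbox (s *\<^sub>R e) 1"
    using s by (intro set_eqI, simp add: mem_box_cart e_def inner_axis, subst (1 2) split) (auto simp: axis_def)
  also have "cbox (s *\<^sub>R e) (1 + s *\<^sub>R e) \<inter> {x. x \<bullet> e \<ge> 1} = cbox e (1 + s *\<^sub>R e)"
    using s by (intro set_eqI, simp add: mem_box_cart e_def inner_axis, subst (1 2) split) (auto simp: axis_def)
  also have "integral (cbox e (1 + s *\<^sub>R e)) f = integral (cbox 0 (1 + s *\<^sub>R e - e)) f"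
    using integral_shift_cbox[of e e "1 + s *\<^sub>R e" f] per by (simp add: e_def)
  also have "cbox 0 (1 + s *\<^sub>R e - e) = cbox 0 1 \<inter> {x. x \<bullet> e \<le> s}"
    using s by (intro set_eqI, simp add: mem_box_cart e_def inner_axis, subst (1 2) split) (auto simp: axis_def)
  also have "cbox (s *\<^sub>R e) 1 = cbox 0 1 \<inter> {x. x \<bullet> e \<ge> s}"
    using s by (intro set_eqI, simp add: mem_box_cart e_def inner_axis, subst (1 2) split) (auto simp: axis_def)
  also have "integral (cbox 0 1 \<inter> {x. x \<bullet> e \<ge> s}) f + integral (cbox 0 1 \<inter> {x. x \<bullet> e \<le> s}) f = integral (cbox 0 1) f"
    using integral_split[OF int e, of 0 1 s] by (simp add: add.commute)
  finally show ?thesis by (simp add: e_def)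
qed

text \<open>Averaging along a periodic direction first turns the integral of a derivative into one
  of differences between endpoints.\<close>

lemma cube_integral_average:
  fixes f :: "real^'n \<Rightarrow> complex"
  assumes c: "continuous_on UNIV f" and per: "\<And>p. f (p + axis i 1) = f p"
  shows "integral (cbox 0 1) (\<lambda>p. integral {0..1} (\<lambda>s. f (p + s *\<^sub>R axis i 1))) = integral (cbox 0 1) f"
proof -
  have "integral (cbox 0 1) (\<lambda>p. integral (cbox 0 1) (\<lambda>s. f (p + s *\<^sub>R axis i 1))) =
      integral (cbox 0 1) (\<lambda>s. integral (cbox 0 1) (\<lambda>p. f (p + s *\<^sub>R axis i 1)))"
  proof (rule integral_swap_continuous)
    show "continuous_on (cbox (0, 0) (1, 1)) (\<lambda>(p, s). f (p + s *\<^sub>R axis i 1))"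
      unfolding split_beta by (intro continuous_on_compose2[OF c] continuous_intros) auto
  qed
  also have "\<dots> = integral (cbox 0 (1::real)) (\<lambda>s. integral (cbox 0 1) f)"
    by (intro integral_cong cube_integral_shift[OF c per]) auto
  finally show ?thesis by simp
qed

lemma cube_integral_dird:
  fixes f :: "real^'n \<Rightarrow> complex"
  assumes f: "smooth f" and per: "\<And>p. f (p + axis i 1) = f p"
  shows "integral (cbox 0 1) (dird (axis i 1) f) = 0"
proof -
  have per': "dird (axis i 1) f (p + axis i 1) = dird (axis i 1) f p" for p
    using dird_translate[OF f, of "axis i 1" "axis i 1" p] by (simp add: per)
  have "integral {0..1} (\<lambda>s. dird (axis i 1) f (p + s *\<^sub>R axis i 1)) = 0" for p
    using integral_dird[OF f, of 0 1 "axis i 1" p] by (simp add: per)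
  then show ?thesis
    using cube_integral_average[OF smooth_continuous[OF smooth_dird[OF f]] per'] by simp
qed

lemma axis_in_lattice: "axis i 1 \<in> lattice"
  by (auto simp: lattice_def axis_def)

lemma quotient_function_periodic:
  assumes f: "quotient_function f" and i: "i \<notin> {Cx1, Cx2}"
  shows "f (p + axis i 1) = f p"
proof -
  have "gmul (axis i 1) p = p + axis i 1"
    using i by (cases i) (auto simp: gmul_def axis_def vec_eq_iff split: coord.split)
  then show ?thesis using quotient_function_invariant[OF f axis_in_lattice] by metis
qed

text \<open>Left translation by a unit in direction x_i also adds y_i to z. Periodicity in x_i
  therefore holds only up to a compensating shift of z.\<close>

lemma quotient_function_shear:
  assumes f: "quotient_function f" and ij: "(i, j) \<in> {(Cx1, Cy1), (Cx2, Cy2)}"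
  shows "f (p + axis i 1 + s *\<^sub>R axis Cz 1) = f (p + (s - p $ j) *\<^sub>R axis Cz 1)"
proof -
  have "gmul (axis i 1) (p + (s - p $ j) *\<^sub>R axis Cz 1) = p + axis i 1 + s *\<^sub>R axis Cz 1"
    using ij by (auto simp: gmul_def axis_def vec_eq_iff split: coord.split)
  then show ?thesis using quotient_function_invariant[OF f axis_in_lattice] by metis
qed

text \<open>The function itself is not periodic in \<open>i\<close>, but its average
  \<open>F\<close> over z is, because the shear merely translates the variable of integration.
  Averaging commutes with the derivative and preserves the cube integral.\<close>

lemma cube_integral_dird_x:
  assumes f: "quotient_function f" and ij: "(i, j) \<in> {(Cx1, Cy1), (Cx2, Cy2)}"
  shows "cube_integral (dird (axis i 1) f) = 0"
proof -
  have sf: "smooth f" by (rule quotient_function_smooth[OF f])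
  define F where "F = (\<lambda>p. integral {0..1} (\<lambda>s. 1 * f (p + s *\<^sub>R axis Cz 1)))"
  have F: "smooth F" unfolding F_def by (intro smooth_line_integral sf continuous_intros)
  have pz: "f (p + axis Cz 1) = f p" for p by (rule quotient_function_periodic[OF f]) simp
  have "F (p + axis i 1) = F p" for p
  proof -
    have "F (p + axis i 1) = integral {0..1} (\<lambda>s. f (p + (s + - p $ j) *\<^sub>R axis Cz 1))"
      by (simp add: F_def quotient_function_shear[OF f ij])
    also have "\<dots> = F p"
      unfolding F_def mult_1
    proof (rule periodic_integral_translate)
      show "continuous_on UNIV (\<lambda>s. f (p + s *\<^sub>R axis Cz 1))"
        by (intro continuous_on_compose2[OF smooth_continuous[OF sf, of UNIV]] continuous_intros) auto
      show "f (p + (x + 1) *\<^sub>R axis Cz 1) = f (p + x *\<^sub>R axis Cz 1)" for x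
        using pz[of "p + x *\<^sub>R axis Cz 1"] by (simp add: algebra_simps)
    qed
    finally show ?thesis .
  qed
  then have "cube_integral (dird (axis i 1) F) = 0" by (rule cube_integral_dird[OF F])
  moreover have "dird (axis i 1) F = (\<lambda>p. integral {0..1} (\<lambda>s. dird (axis i 1) f (p + s *\<^sub>R axis Cz 1)))"
    unfolding F_def by (subst dird_line_integral[OF sf]) (auto intro: continuous_intros)
  moreover have "dird (axis i 1) f (p + axis Cz 1) = dird (axis i 1) f p" for p
    using dird_translate[OF sf, of "axis i 1" "axis Cz 1" p] by (simp add: pz)
  ultimately show ?thesis
    using cube_integral_average[OF smooth_continuous[OF smooth_dird[OF sf]], of "axis i 1" Cz] by simp
qed

lemma cube_integral_lder:
  assumes f: "quotient_function f"
  shows "cube_integral (lder k f) = 0"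
proof -
  have sf: "smooth f" by (rule quotient_function_smooth[OF f])
  \<comment> \<open>The coefficient \<open>p $ i\<close> does not change along z, so the second
    summand is the z-derivative of a function that is itself periodic in z.\<close>
  have y: "cube_integral (\<lambda>p. dird (axis j 1) f p + of_real (p $ i) * dird (axis Cz 1) f p) = 0"
    if ij: "(i, j) \<in> {(Cx1, Cy1), (Cx2, Cy2)}" for i j
  proof -
    have "dird (axis Cz 1) (\<lambda>p. of_real (p $ i) * f p) = (\<lambda>p. of_real (p $ i) * dird (axis Cz 1) f p)"
      using ij by (auto simp: dird_coordinate_mult[OF sf] axis_def)
    moreover have "cube_integral (dird (axis Cz 1) (\<lambda>p. of_real (p $ i) * f p)) = 0"
    proof (rule cube_integral_dird)
      show "smooth (\<lambda>p. of_real (p $ i) * f p)" by (intro smooth_intros sf)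
      show "complex_of_real ((p + axis Cz 1) $ i) * f (p + axis Cz 1) = of_real (p $ i) * f p" for p
        using ij quotient_function_periodic[OF f, of Cz p] by (auto simp: axis_def)
    qed
    moreover have "cube_integral (dird (axis j 1) f) = 0"
      using ij by (intro cube_integral_dird[OF sf] quotient_function_periodic[OF f]) auto
    ultimately show ?thesis
      by (subst integral_add)
        (auto intro!: integrable_continuous continuous_intros smooth_continuous smooth_intros sf)
  qed
  show ?thesis
    using cube_integral_dird_x[OF f, of Cx1 Cy1] cube_integral_dird_x[OF f, of Cx2 Cy2]
      cube_integral_dird[OF sf quotient_function_periodic[OF f], of Cz]
      cube_integral_dird[OF sf quotient_function_periodic[OF f], of Ct] y[of Cx1 Cy1] y[of Cx2 Cy2]
    by (cases k) (simp_all add: lder_eq[OF sf])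
qed

lemma lattice_translate_into_cube: "\<exists>\<gamma>\<in>lattice. gmul \<gamma> p \<in> cbox 0 1"
proof -
  \<comment> \<open>The z-entry is chosen last: its integer part is taken after the shear caused by
    the x-entries.\<close>
  define \<gamma> :: point where "\<gamma> = (\<chi> i. if i = Cz
     then - of_int \<lfloor>p $ Cz - of_int \<lfloor>p $ Cx1\<rfloor> * p $ Cy1 - of_int \<lfloor>p $ Cx2\<rfloor> * p $ Cy2\<rfloor>
     else - of_int \<lfloor>p $ i\<rfloor>)"
  have "\<gamma> \<in> lattice" by (auto simp: lattice_def \<gamma>_def)
  moreover have "gmul \<gamma> p \<in> cbox 0 1"
  proof -
    have *: "0 \<le> x - of_int \<lfloor>x\<rfloor> \<and> x - of_int \<lfloor>x\<rfloor> \<le> 1" for x :: real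
      by (metis frac_def frac_ge_0 frac_lt_1 less_imp_le)
    have "gmul \<gamma> p $ i = (if i = Cz then (let x = p $ Cz - of_int \<lfloor>p $ Cx1\<rfloor> * p $ Cy1 - of_int \<lfloor>p $ Cx2\<rfloor> * p $ Cy2 in x - of_int \<lfloor>x\<rfloor>)
        else p $ i - of_int \<lfloor>p $ i\<rfloor>)" for i
      by (cases i) (simp_all add: gmul_def \<gamma>_def Let_def)
    then show ?thesis unfolding mem_box_cart using * by (simp add: Let_def)
  qed
  ultimately show ?thesis by blast
qed

text \<open>Continuity gives vanishing on the cube only; every other point has a lattice translate
  there.\<close>

lemma quotient_function_nonneg_integral_zero:
  assumes f: "quotient_function f" and nonneg: "\<And>p. Re (f p) \<ge> 0" and 0: "cube_integral f = 0"
  shows "Re (f p) = 0"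
proof -
  have c: "continuous_on S f" for S
    by (intro smooth_continuous quotient_function_smooth[OF f])
  have "integral (cbox 0 1) (\<lambda>p. Re (f p)) = Re (cube_integral f)"
    by (rule integral_linear[OF integrable_continuous[OF c] bounded_linear_Re, unfolded o_def])
  then have "integral (cbox 0 1) (\<lambda>p. Re (f p)) = 0" using 0 by simp
  moreover have "(\<chi> i. 1/2) \<in> box (0::point) 1" by (simp add: mem_box_cart)
  then have "box (0::point) 1 \<noteq> {}" by blast
  moreover have "continuous_on (cbox 0 1) (\<lambda>p. Re (f p))" by (intro continuous_on_Re c)
  ultimately have *: "\<forall>q\<in>cbox 0 1. Re (f q) = 0"
    using integral_cbox_eq_0_iff nonneg by blast
  obtain \<gamma> where \<gamma>: "\<gamma> \<in> lattice" "gmul \<gamma> p \<in> cbox 0 1" using lattice_translate_into_cube by blast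
  then show ?thesis using * quotient_function_invariant[OF f \<gamma>(1)] by metis
qed

lemma quotient_function_l2_zero:
  assumes f: "quotient_function f" and 0: "cube_integral (\<lambda>p. f p * cnj (f p)) = 0"
  shows "f p = 0"
proof -
  have "Re (f p * cnj (f p)) = 0"
    by (rule quotient_function_nonneg_integral_zero[OF _ _ 0]) (auto intro!: quotient_function_intros f)
  then show ?thesis by (auto simp: complex_eq_iff sum_squares_eq_zero_iff)
qed

lemma constant_integral_zero:
  assumes "cube_integral (\<lambda>p. k) = 0" shows "k = 0"
proof (rule quotient_function_l2_zero[where f = "\<lambda>p. k"])
  show "quotient_function (\<lambda>p. k)" by (rule quotient_function_const)
  have "cube_integral (\<lambda>p. cnj k * k) = cnj k * cube_integral (\<lambda>p. k)" by (rule integral_mult_right)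
  then show "cube_integral (\<lambda>p. k * cnj k) = 0" by (simp only: assms mult_zero_right mult.commute[of k])
qed


section \<open>Invariant complex vector fields\<close>

definition dop :: "(coord \<Rightarrow> complex) \<Rightarrow> (point \<Rightarrow> complex) \<Rightarrow> point \<Rightarrow> complex" where
  "dop \<kappa> f p = (\<Sum>k\<in>UNIV. \<kappa> k * lder k f p)"

lemma quotient_function_dop: "quotient_function f \<Longrightarrow> quotient_function (dop \<kappa> f)"
  unfolding dop_def[abs_def] by (intro quotient_function_intros)

lemma smooth_dop: "smooth f \<Longrightarrow> smooth (dop \<kappa> f)"
  unfolding dop_def[abs_def] by (intro smooth_intros smooth_lder)

lemma dop_const [simp]: "dop \<kappa> (\<lambda>p. k) = (\<lambda>p. 0)"
  by (simp add: dop_def fun_eq_iff)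

lemma dop_add: "smooth f \<Longrightarrow> smooth g \<Longrightarrow> dop \<kappa> (\<lambda>p. f p + g p) = (\<lambda>p. dop \<kappa> f p + dop \<kappa> g p)"
  by (simp add: dop_def fun_eq_iff lder_add sum.distrib distrib_left)

lemma dop_diff: "smooth f \<Longrightarrow> smooth g \<Longrightarrow> dop \<kappa> (\<lambda>p. f p - g p) = (\<lambda>p. dop \<kappa> f p - dop \<kappa> g p)"
  by (simp add: dop_def fun_eq_iff lder_diff sum_subtractf right_diff_distrib)

lemma dop_mult:
  "smooth f \<Longrightarrow> smooth g \<Longrightarrow> dop \<kappa> (\<lambda>p. f p * g p) = (\<lambda>p. f p * dop \<kappa> g p + dop \<kappa> f p * g p)"
  by (simp add: dop_def fun_eq_iff lder_mult sum.distrib[symmetric] sum_distrib_left sum_distrib_right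
      distrib_left mult_ac)

lemma dop_cmult: "smooth f \<Longrightarrow> dop \<kappa> (\<lambda>p. k * f p) = (\<lambda>p. k * dop \<kappa> f p)"
  by (simp add: dop_mult smooth_const)

lemma dop_sum:
  "(\<And>i. i \<in> I \<Longrightarrow> smooth (f i)) \<Longrightarrow> dop \<kappa> (\<lambda>p. \<Sum>i\<in>I. f i p) = (\<lambda>p. \<Sum>i\<in>I. dop \<kappa> (f i) p)"
  by (induction I rule: infinite_finite_induct) (simp_all add: dop_add smooth_sum)

lemma dop_cnj: "smooth f \<Longrightarrow> dop \<kappa> (\<lambda>p. cnj (f p)) = (\<lambda>p. cnj (dop (\<lambda>k. cnj (\<kappa> k)) f p))"
  by (simp add: dop_def fun_eq_iff lder_cnj)

lemma quotient_function_continuous: "quotient_function f \<Longrightarrow> continuous_on S f"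
  by (intro smooth_continuous quotient_function_smooth)

lemma quotient_function_integrable: "quotient_function f \<Longrightarrow> f integrable_on cbox u v"
  by (intro integrable_continuous quotient_function_continuous)

lemma cube_integral_dop:
  assumes "quotient_function f" shows "cube_integral (dop \<kappa> f) = 0"
proof -
  have "cube_integral (dop \<kappa> f) = (\<Sum>k\<in>UNIV. cube_integral (\<lambda>p. \<kappa> k * lder k f p))"
    unfolding dop_def[abs_def]
    by (intro integral_sum quotient_function_integrable quotient_function_intros assms) simp
  then show ?thesis by (simp add: cube_integral_lder[OF assms])
qed

lemma cube_integral_dop_by_parts:
  assumes f: "quotient_function f" and g: "quotient_function g"
  shows "cube_integral (\<lambda>p. dop \<kappa> f p * g p) = - cube_integral (\<lambda>p. f p * dop \<kappa> g p)"
proof -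
  have "0 = cube_integral (dop \<kappa> (\<lambda>p. f p * g p))"
    by (simp add: cube_integral_dop quotient_function_mult f g)
  also have "\<dots> = cube_integral (\<lambda>p. f p * dop \<kappa> g p + dop \<kappa> f p * g p)"
    by (simp add: dop_mult quotient_function_smooth f g)
  also have "\<dots> = cube_integral (\<lambda>p. f p * dop \<kappa> g p) + cube_integral (\<lambda>p. dop \<kappa> f p * g p)"
    by (intro integral_add quotient_function_integrable quotient_function_mult quotient_function_dop f g)
  finally show ?thesis by (simp add: eq_neg_iff_add_eq_0 add.commute)
qed

text \<open>The Z-coefficient of the bracket of the left-invariant complex fields with coefficients
  \<open>\<kappa>\<close> and \<open>\<mu>\<close>; the other components of the bracket are
  0.\<close>

definition bracket_z :: "(coord \<Rightarrow> complex) \<Rightarrow> (coord \<Rightarrow> complex) \<Rightarrow> complex" where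
  "bracket_z \<kappa> \<mu> = \<kappa> Cx1 * \<mu> Cy1 - \<kappa> Cy1 * \<mu> Cx1 + \<kappa> Cx2 * \<mu> Cy2 - \<kappa> Cy2 * \<mu> Cx2"

lemma dop_commute:
  assumes f: "smooth f"
  shows "dop \<kappa> (dop \<mu> f) p = dop \<mu> (dop \<kappa> f) p + bracket_z \<kappa> \<mu> * lder Cz f p"
proof -
  have expand: "dop \<kappa> (dop \<mu> f) p = (\<Sum>k\<in>UNIV. \<Sum>l\<in>UNIV. \<kappa> k * \<mu> l * lder k (lder l f) p)" for \<kappa> \<mu>
  proof -
    have "lder k (dop \<mu> f) p = (\<Sum>l\<in>UNIV. \<mu> l * lder k (lder l f) p)" for k
      unfolding dop_def[abs_def]
      by (subst lder_sum) (auto intro!: smooth_intros smooth_lder f simp: lder_mult smooth_const smooth_lder f)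
    then show ?thesis by (simp add: dop_def sum_distrib_left mult.assoc)
  qed
  have "dop \<mu> (dop \<kappa> f) p = (\<Sum>k\<in>UNIV. \<Sum>l\<in>UNIV. \<kappa> k * \<mu> l * lder l (lder k f) p)"
    unfolding expand by (subst sum.swap) (simp add: mult_ac)
  then have "dop \<kappa> (dop \<mu> f) p - dop \<mu> (dop \<kappa> f) p =
      (\<Sum>k\<in>UNIV. \<Sum>l\<in>UNIV. \<kappa> k * \<mu> l * (lder k (lder l f) p - lder l (lder k f) p))"
    unfolding expand[of \<kappa> \<mu>] by (simp add: sum_subtractf[symmetric] right_diff_distrib)
  also have "\<dots> = bracket_z \<kappa> \<mu> * lder Cz f p"
    by (simp add: lder_commute[OF f] sum_coord bracket_coeff_def bracket_z_def algebra_simps)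
  finally show ?thesis by (simp add: algebra_simps)
qed

lemma dop_commute_eq:
  assumes "smooth f" "\<And>p. bracket_z \<kappa> \<mu> * lder Cz f p = 0"
  shows "dop \<kappa> (dop \<mu> f) = dop \<mu> (dop \<kappa> f)"
  by (rule ext) (simp only: dop_commute[OF assms(1), of \<kappa> \<mu>] assms(2) add_0_right)

section \<open>The (0, 1)-frame: brackets and energy identities\<close>

datatype idx = I1 | I2 | I3

lemma UNIV_idx: "UNIV = {I1, I2, I3}"
  using idx.exhaust by auto

instance idx :: finite
  by standard (simp add: UNIV_idx)

lemma sum_idx: "(\<Sum>i\<in>UNIV. f i) = f I1 + f I2 + (f I3 :: 'a::comm_monoid_add)"
  by (simp add: UNIV_idx add.assoc)

lemma forall_idx: "(\<forall>i. P i) \<longleftrightarrow> P I1 \<and> P I2 \<and> P I3"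
  by (metis idx.exhaust)

text \<open>The coefficients, in the left-invariant frame, of the \<open>(0, 1)\<close>-vector fields
  \<open>1/2 (X\<^sub>1 + i a X\<^sub>2)\<close>, \<open>1/2 (Y\<^sub>1 + i b Y\<^sub>2)\<close>, \<open>1/2 (T + i c Z)\<close> dual to the conjugates of
  \<open>\<phi>\<^sup>1, \<phi>\<^sup>2, \<phi>\<^sup>3\<close>.\<close>

definition nu :: "real \<Rightarrow> real \<Rightarrow> real \<Rightarrow> idx \<Rightarrow> coord \<Rightarrow> complex" where
  "nu a b c i k = (case i of
       I1 \<Rightarrow> (if k = Cx1 then 1/2 else if k = Cx2 then \<i> * a / 2 else 0)
     | I2 \<Rightarrow> (if k = Cy1 then 1/2 else if k = Cy2 then \<i> * b / 2 else 0)
     | I3 \<Rightarrow> (if k = Ct then 1/2 else if k = Cz then \<i> * c / 2 else 0))"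

locale structure_constants =
  fixes a b c :: real
  assumes nonzero: "a \<noteq> 0" "b \<noteq> 0" "c \<noteq> 0"
begin

definition vbar :: "idx \<Rightarrow> (point \<Rightarrow> complex) \<Rightarrow> point \<Rightarrow> complex" where
  "vbar i = dop (nu a b c i)"

definition vhol :: "idx \<Rightarrow> (point \<Rightarrow> complex) \<Rightarrow> point \<Rightarrow> complex" where
  "vhol i = dop (\<lambda>k. cnj (nu a b c i k))"

text \<open>The coefficient of conj phi1 wedge conj phi2 in dbar of conj phi3. It comes from
  [conj V1, conj V2] = (1 - a b) / 4 times Z, where Z has conj V3-component
  \<open>1 / (\<i> c)\<close>.\<close>

definition curvature :: complex where
  "curvature = \<i> * (1 - a * b) / (4 * c)"

lemma vbar_eq:
  "vbar I1 f p = (lder Cx1 f p + \<i> * a * lder Cx2 f p) / 2"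
  "vbar I2 f p = (lder Cy1 f p + \<i> * b * lder Cy2 f p) / 2"
  "vbar I3 f p = (lder Ct f p + \<i> * c * lder Cz f p) / 2"
  by (simp_all add: vbar_def dop_def nu_def sum_coord field_simps)

lemma vhol_eq:
  "vhol I1 f p = (lder Cx1 f p - \<i> * a * lder Cx2 f p) / 2"
  "vhol I2 f p = (lder Cy1 f p - \<i> * b * lder Cy2 f p) / 2"
  "vhol I3 f p = (lder Ct f p - \<i> * c * lder Cz f p) / 2"
  by (simp_all add: vhol_def dop_def nu_def sum_coord field_simps)

lemmas vbar_rules = dop_add[of _ _ "nu a b c i" for i, folded vbar_def] dop_diff[of _ _ "nu a b c i" for i, folded vbar_def]
  dop_cmult[of _ "nu a b c i" for i, folded vbar_def]

lemma quotient_function_vbar: "quotient_function f \<Longrightarrow> quotient_function (vbar i f)"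
  and quotient_function_vhol: "quotient_function f \<Longrightarrow> quotient_function (vhol i f)"
  by (simp_all add: vbar_def vhol_def quotient_function_dop)

lemma smooth_vbar: "smooth f \<Longrightarrow> smooth (vbar i f)"
  and smooth_vhol: "smooth f \<Longrightarrow> smooth (vhol i f)"
  by (simp_all add: vbar_def vhol_def smooth_dop)

lemma vbar_const [simp]: "vbar i (\<lambda>p. k) = (\<lambda>p. 0)" and vhol_const [simp]: "vhol i (\<lambda>p. k) = (\<lambda>p. 0)"
  by (simp_all add: vbar_def vhol_def)

lemma vbar_cnj: "smooth f \<Longrightarrow> vbar i (\<lambda>p. cnj (f p)) = (\<lambda>p. cnj (vhol i f p))"
  and vhol_cnj: "smooth f \<Longrightarrow> vhol i (\<lambda>p. cnj (f p)) = (\<lambda>p. cnj (vbar i f p))"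
  by (simp_all add: vbar_def vhol_def dop_cnj)

lemma vbar_vhol_zero_iff:
  "vbar I1 f p = 0 \<and> vhol I1 f p = 0 \<longleftrightarrow> lder Cx1 f p = 0 \<and> lder Cx2 f p = 0"
  "vbar I2 f p = 0 \<and> vhol I2 f p = 0 \<longleftrightarrow> lder Cy1 f p = 0 \<and> lder Cy2 f p = 0"
  "vbar I3 f p = 0 \<and> vhol I3 f p = 0 \<longleftrightarrow> lder Ct f p = 0 \<and> lder Cz f p = 0"
proof -
  have *: "(x + \<i> * of_real r * y) / 2 = 0 \<and> (x - \<i> * of_real r * y) / 2 = 0 \<longleftrightarrow> x = 0 \<and> y = 0"
    if "r \<noteq> 0" for r x y
  proof -
    have "x = 0 \<and> \<i> * of_real r * y = 0" if "x + \<i> * of_real r * y = 0" "x - \<i> * of_real r * y = 0"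
    proof -
      have "2 * x = (x + \<i> * of_real r * y) + (x - \<i> * of_real r * y)" by simp
      then have "x = 0" using that by simp
      then show ?thesis using that(1) by simp
    qed
    then show ?thesis using \<open>r \<noteq> 0\<close> by auto
  qed
  show "vbar I1 f p = 0 \<and> vhol I1 f p = 0 \<longleftrightarrow> lder Cx1 f p = 0 \<and> lder Cx2 f p = 0"
    "vbar I2 f p = 0 \<and> vhol I2 f p = 0 \<longleftrightarrow> lder Cy1 f p = 0 \<and> lder Cy2 f p = 0"
    "vbar I3 f p = 0 \<and> vhol I3 f p = 0 \<longleftrightarrow> lder Ct f p = 0 \<and> lder Cz f p = 0"
    unfolding vbar_eq vhol_eq using nonzero by (simp_all only: * not_False_eq_True)
qed

text \<open>All brackets are multiples of Z. They vanish when V3 or its conjugate is involved, these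
  being central, and between V_i and its own conjugate. The bracket of conj V1 with conj V2 carries
  the factor 1 - a b, and the mixed brackets vanish on functions annihilated by Z.\<close>

lemma commute:
  assumes f: "smooth f"
  shows vbar3_commute: "vbar I3 (vbar j f) = vbar j (vbar I3 f)"
    and vbar3_vhol_commute: "vbar I3 (vhol j f) = vhol j (vbar I3 f)"
    and vhol3_vbar_commute: "vhol I3 (vbar j f) = vbar j (vhol I3 f)"
    and vhol_vbar_self_commute: "vhol i (vbar i f) = vbar i (vhol i f)"
    and vhol_vbar_commute: "(\<And>p. lder Cz f p = 0) \<Longrightarrow> vhol i (vbar j f) = vbar j (vhol i f)"
    and vbar_commute: "(a * b = 1 \<or> (\<forall>p. lder Cz f p = 0)) \<Longrightarrow> vbar i (vbar j f) = vbar j (vbar i f)"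
proof -
  show "vbar I3 (vbar j f) = vbar j (vbar I3 f)" "vbar I3 (vhol j f) = vhol j (vbar I3 f)"
    "vhol I3 (vbar j f) = vbar j (vhol I3 f)"
    unfolding vbar_def vhol_def
    by (rule dop_commute_eq[OF f]; cases j; simp add: bracket_z_def nu_def)+
  show "vhol i (vbar i f) = vbar i (vhol i f)"
    unfolding vbar_def vhol_def
    by (rule dop_commute_eq[OF f]; cases i; simp add: bracket_z_def nu_def)
  show "(\<And>p. lder Cz f p = 0) \<Longrightarrow> vhol i (vbar j f) = vbar j (vhol i f)"
    unfolding vbar_def vhol_def by (rule dop_commute_eq[OF f]) simp
  assume *: "a * b = 1 \<or> (\<forall>p. lder Cz f p = 0)"
  have "bracket_z (nu a b c i) (nu a b c j) * lder Cz f p = 0" for p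
  proof (cases "a * b = 1")
    case True
    then have "complex_of_real a * of_real b = 1" by (metis of_real_1 of_real_mult)
    then show ?thesis by (cases i; cases j) (auto simp: bracket_z_def nu_def mult.commute mult.left_commute[of _ \<i>] mult.assoc[symmetric])
  qed (use * in auto)
  then show "vbar i (vbar j f) = vbar j (vbar i f)"
    unfolding vbar_def by (rule dop_commute_eq[OF f])
qed

text \<open>Integrating \<open>|V_i f|^2\<close> by parts produces conj V_i V_i f; the two fields
  commute, so this is V_i applied to conj V_i f = 0.\<close>

lemma vbar_zero_imp_vhol_zero:
  assumes f: "quotient_function f" and 0: "\<And>p. vbar i f p = 0"
  shows "vhol i f p = 0"
proof (rule quotient_function_l2_zero[where f = "vhol i f"])
  have sf: "smooth f" by (rule quotient_function_smooth[OF f])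
  show q: "quotient_function (vhol i f)" by (rule quotient_function_vhol[OF f])
  have "cube_integral (\<lambda>p. vbar i (vhol i f) p * cnj (f p)) =
      - cube_integral (\<lambda>p. vhol i f p * vbar i (\<lambda>p. cnj (f p)) p)"
    unfolding vbar_def by (intro cube_integral_dop_by_parts q quotient_function_cnj f)
  moreover have "vbar i f = (\<lambda>p. 0)" using 0 by auto
  then have "vbar i (vhol i f) = (\<lambda>p. 0)" by (simp add: vhol_vbar_self_commute[OF sf, symmetric])
  ultimately show "cube_integral (\<lambda>p. vhol i f p * cnj (vhol i f p)) = 0" by (simp add: vbar_cnj[OF sf])
qed

lemma vbar_zero_imp_constant:
  assumes f: "quotient_function f" and 0: "\<And>i p. vbar i f p = 0"
  shows "f p = f q"
proof (rule dird_zero_imp_constant[where f = f])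
  show sf: "smooth f" by (rule quotient_function_smooth[OF f])
  fix v p
  have "vhol i f p = 0" for i by (rule vbar_zero_imp_vhol_zero[OF f 0])
  then have "lder k f p = 0" for k
    using vbar_vhol_zero_iff[of f p] 0 by (cases k) auto
  then show "dird v f p = 0" by (simp add: dird_eq_lder[OF sf])
qed

text \<open>A derivative along an invariant field has mean zero. This separates constant forms from
  exact ones.\<close>

lemma constant_exact_imp_zero:
  assumes "quotient_function u" "\<And>p. vbar i u p = k"
  shows "k = 0"
proof (rule constant_integral_zero)
  have "vbar i u = (\<lambda>p. k)" using assms(2) by auto
  then show "cube_integral (\<lambda>p. k) = 0"
    using cube_integral_dop[OF assms(1), of "nu a b c i"] by (simp only: vbar_def)
qed

text \<open>Green's identity: paired with \<open>f\<close>, the second-order expression becomes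
  minus the conjugate of the energy, so the energy density vanishes. By definiteness all conj V_i
  annihilate \<open>f\<close>.\<close>

lemma laplace_kernel_constant:
  fixes h :: "idx \<Rightarrow> idx \<Rightarrow> complex"
  assumes nonneg: "\<And>x. Re (\<Sum>i\<in>UNIV. \<Sum>j\<in>UNIV. h i j * x i * cnj (x j)) \<ge> 0"
    and definite: "\<And>x i. Re (\<Sum>i\<in>UNIV. \<Sum>j\<in>UNIV. h i j * x i * cnj (x j)) = 0 \<Longrightarrow> x i = 0"
    and f: "quotient_function f"
    and lap: "\<And>p. (\<Sum>i\<in>UNIV. \<Sum>j\<in>UNIV. cnj (h i j) * vhol i (vbar j f) p) = 0"
  shows "f p = f q"
proof -
  have sf: "smooth f" by (rule quotient_function_smooth[OF f])
  define F where "F = (\<lambda>p. \<Sum>i\<in>UNIV. \<Sum>j\<in>UNIV. h i j * vbar i f p * cnj (vbar j f p))"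
  have F: "quotient_function F"
    unfolding F_def by (intro quotient_function_intros quotient_function_vbar f)
  \<comment> \<open>After conjugation the V_i-derivative sits on conj f, from where integration by
    parts moves it onto the other factor and creates the operator in \<open>lap\<close>.\<close>
  have "cnj (cube_integral F) = cube_integral (\<lambda>p. \<Sum>i\<in>UNIV. \<Sum>j\<in>UNIV. cnj (h i j) * (vhol i (\<lambda>p. cnj (f p)) p * vbar j f p))"
    by (simp add: integral_cnj F_def vhol_cnj[OF sf] mult_ac)
  also have "\<dots> = (\<Sum>i\<in>UNIV. \<Sum>j\<in>UNIV. cnj (h i j) * cube_integral (\<lambda>p. vhol i (\<lambda>p. cnj (f p)) p * vbar j f p))"
    by (subst integral_sum, (auto intro!: quotient_function_integrable quotient_function_intros
          quotient_function_vbar quotient_function_vhol f)[2], rule sum.cong[OF refl],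
        subst integral_sum) (auto intro!: quotient_function_integrable quotient_function_intros
          quotient_function_vbar quotient_function_vhol f)
  also have "\<dots> = (\<Sum>i\<in>UNIV. \<Sum>j\<in>UNIV. - cube_integral (\<lambda>p. cnj (h i j) * (cnj (f p) * vhol i (vbar j f) p)))"
    unfolding vhol_def
    by (subst cube_integral_dop_by_parts) (auto intro!: quotient_function_cnj quotient_function_vbar f)
  also have "\<dots> = - cube_integral (\<lambda>p. \<Sum>i\<in>UNIV. \<Sum>j\<in>UNIV. cnj (h i j) * (cnj (f p) * vhol i (vbar j f) p))"
    by (subst integral_sum, (auto intro!: quotient_function_integrable quotient_function_intros
          quotient_function_vbar quotient_function_vhol f)[2],
        subst integral_sum) (auto intro!: quotient_function_integrable quotient_function_intros
          quotient_function_vbar quotient_function_vhol f simp: sum_negf)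
  also have "(\<lambda>p. \<Sum>i\<in>UNIV. \<Sum>j\<in>UNIV. cnj (h i j) * (cnj (f p) * vhol i (vbar j f) p)) =
      (\<lambda>p. cnj (f p) * (\<Sum>i\<in>UNIV. \<Sum>j\<in>UNIV. cnj (h i j) * vhol i (vbar j f) p))"
    by (simp add: sum_distrib_left mult.left_commute)
  also have "\<dots> = (\<lambda>p. 0)" by (simp only: lap mult_zero_right)
  finally have "cube_integral F = 0" by simp
  then have "Re (F p) = 0" for p
    by (rule quotient_function_nonneg_integral_zero[OF F, rotated]) (simp only: F_def nonneg)
  then have "vbar i f p = 0" for i p unfolding F_def by (rule definite)
  then show ?thesis by (rule vbar_zero_imp_constant[OF f])
qed

theorem harmonic_imp_constant:
  fixes h :: "idx \<Rightarrow> idx \<Rightarrow> complex"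
  assumes nonneg: "\<And>x. Re (\<Sum>i\<in>UNIV. \<Sum>j\<in>UNIV. h i j * x i * cnj (x j)) \<ge> 0"
    and definite: "\<And>x i. Re (\<Sum>i\<in>UNIV. \<Sum>j\<in>UNIV. h i j * x i * cnj (x j)) = 0 \<Longrightarrow> x i = 0"
    and f: "\<And>i. quotient_function (f i)"
    and closed12: "\<And>p. vbar I1 (f I2) p - vbar I2 (f I1) p + curvature * f I3 p = 0"
    and closed3: "\<And>i p. vbar i (f I3) p = vbar I3 (f i) p"
    and coclosed: "\<And>p. (\<Sum>i\<in>UNIV. \<Sum>j\<in>UNIV. cnj (h i j) * vhol i (f j) p) = 0"
  shows "f i p = f i q" "curvature * f I3 p = 0"
proof -
  have sf: "smooth (f i)" for i by (rule quotient_function_smooth[OF f])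
  have coclosed': "(\<Sum>i\<in>UNIV. \<Sum>j\<in>UNIV. cnj (h i j) * vbar m (vhol i (f j)) p) = 0" for m p
  proof -
    have "vbar m (\<lambda>p. \<Sum>i\<in>UNIV. \<Sum>j\<in>UNIV. cnj (h i j) * vhol i (f j) p) p =
        (\<Sum>i\<in>UNIV. \<Sum>j\<in>UNIV. cnj (h i j) * vbar m (vhol i (f j)) p)"
      unfolding vbar_def by (simp add: dop_sum dop_cmult smooth_intros smooth_vhol sf)
    then show ?thesis by (simp only: coclosed vbar_const)
  qed
  have f3: "f I3 p = f I3 q" for p q
  proof (rule laplace_kernel_constant[where h = h and f = "f I3"])
    fix p
    have "vhol i (vbar j (f I3)) = vbar I3 (vhol i (f j))" for i j
    proof -
      have "vbar j (f I3) = vbar I3 (f j)" by (rule ext) (rule closed3)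
      then show ?thesis by (simp only: vbar3_vhol_commute[OF sf])
    qed
    then show "(\<Sum>i\<in>UNIV. \<Sum>j\<in>UNIV. cnj (h i j) * vhol i (vbar j (f I3)) p) = 0"
      by (simp only: coclosed')
  qed (use nonneg definite f in blast)+
  then have f3': "f I3 = (\<lambda>p. f I3 0)" by auto
  have vb3: "vbar I3 (f i) p = 0" for i p
    using closed3[of i p] f3' by (metis vbar_const)
  \<comment> \<open>From here on no component depends on z, so every bracket of the frame fields
    acts on the components as zero.\<close>
  have Z: "lder Cz (f i) p = 0" for i p
    using vbar_vhol_zero_iff(3)[of "f i" p] vb3 vbar_zero_imp_vhol_zero[OF f vb3] by blast
  have curv: "curvature * f I3 p = 0" for p
  proof -
    have "curvature * f I3 0 = 0"
    proof (rule constant_integral_zero)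
      have "curvature * f I3 0 = vbar I2 (f I1) p - vbar I1 (f I2) p" for p
        using closed12[of p] f3[of p 0] by (simp add: algebra_simps add_eq_0_iff)
      then have "cube_integral (\<lambda>p. curvature * f I3 0) = cube_integral (\<lambda>p. vbar I2 (f I1) p - vbar I1 (f I2) p)"
        by (intro arg_cong[where f = cube_integral] ext)
      also have "\<dots> = cube_integral (vbar I2 (f I1)) - cube_integral (vbar I1 (f I2))"
        by (intro integral_diff quotient_function_integrable quotient_function_vbar f)
      finally show "cube_integral (\<lambda>p. curvature * f I3 0) = 0"
        unfolding vbar_def by (simp only: cube_integral_dop[OF f] diff_self)
    qed
    then show ?thesis using f3[of p 0] by simp
  qed
  then show "curvature * f I3 p = 0" .
  \<comment> \<open>With the curvature term gone, closedness says that the derivatives are symmetric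
    in the two indices. This is what turns the differentiated coclosedness equation into the
    constant-coefficient equation for each component.\<close>
  have sym: "vbar i (f j) = vbar j (f i)" for i j
    using closed12 closed3 curv by (cases i; cases j) (auto simp: fun_eq_iff)
  show "f i p = f i q"
  proof (rule laplace_kernel_constant[where h = h and f = "f i"])
    fix p
    have "vhol k (vbar j (f i)) = vbar i (vhol k (f j))" for k j
      using vhol_vbar_commute[OF sf Z, of k i j] sym[of j i] by simp
    then show "(\<Sum>k\<in>UNIV. \<Sum>j\<in>UNIV. cnj (h k j) * vhol k (vbar j (f i)) p) = 0"
      by (simp only: coclosed')
  qed (use nonneg definite f in blast)+
qed

end


section \<open>Solving the equation \<open>\<partial>-bar u = f\<close> in the integrable case\<close>

lemma dird_zero_imp_translation_invariant:
  fixes f :: "point \<Rightarrow> complex"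
  assumes f: "smooth f" and 0: "\<And>p. dird v f p = 0"
  shows "f (p + s *\<^sub>R v) = f p"
proof -
  have pos: "f (q + r *\<^sub>R v) = f q" if "r \<ge> 0" for q r
    using integral_dird[OF f that, of v q] by (simp add: 0)
  show ?thesis
  proof (cases "s \<ge> 0")
    case False
    then show ?thesis using pos[of "- s" "p + s *\<^sub>R v"] by simp
  qed (rule pos)
qed

lemma translation_invariant_imp_dird_zero:
  fixes f :: "point \<Rightarrow> complex"
  assumes f: "smooth f" and inv: "\<And>p s. f (p + s *\<^sub>R v) = f p"
  shows "dird v f p = 0"
proof -
  have "((\<lambda>s. f (p + s *\<^sub>R v)) has_vector_derivative dird v f (p + 0 *\<^sub>R v)) (at 0)"
    by (rule smooth_along_line[OF f])
  moreover have "((\<lambda>s. f (p + s *\<^sub>R v)) has_vector_derivative 0) (at 0)"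
    by (simp add: inv)
  ultimately show ?thesis using vector_derivative_unique_at by fastforce
qed

text \<open>Moving along y changes the shear term of the group law, so the y-directions are not
  among these; \<open>solve_y\<close> has to argue differently.\<close>

lemma gmul_add_axis:
  "i \<in> {Cx1, Cx2, Cz, Ct} \<Longrightarrow> gmul \<gamma> (p + s *\<^sub>R axis i 1) = gmul \<gamma> p + s *\<^sub>R axis i 1"
  by (auto simp: gmul_def axis_def vec_eq_iff split: coord.split)

lemma gmul_eq_translation:
  "gmul \<gamma> p = p + \<gamma> + (\<gamma> $ Cx1 * p $ Cy1 + \<gamma> $ Cx2 * p $ Cy2) *\<^sub>R axis Cz 1"
  by (auto simp: gmul_def axis_def vec_eq_iff split: coord.split)

context structure_constants
begin

text \<open>By \<open>eq\<close> the square norm of conj V_j f is a pairing of conj V_i g with conj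
  V_j f. Integration by parts moves V_i onto conj V_j f, and commuting it through reaches V_i f = 0.
  Thus closedness spreads vanishing from one direction to the others.\<close>

lemma mixed_zero:
  assumes f: "quotient_function f" and g: "quotient_function g"
    and eq: "\<And>p. vbar j f p = vbar i g p" and comm: "vhol i (vbar j f) = vbar j (vhol i f)"
    and 0: "\<And>p. vhol i f p = 0"
  shows "vbar j f p = 0"
proof (rule quotient_function_l2_zero[where f = "vbar j f"])
  have sf: "smooth f" by (rule quotient_function_smooth[OF f])
  show q: "quotient_function (vbar j f)" by (rule quotient_function_vbar[OF f])
  have "cube_integral (\<lambda>p. vbar i g p * cnj (vbar j f p)) =
      - cube_integral (\<lambda>p. g p * vbar i (\<lambda>p. cnj (vbar j f p)) p)"
    unfolding vbar_def[of i] by (intro cube_integral_dop_by_parts quotient_function_cnj q g)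
  moreover have "vhol i f = (\<lambda>p. 0)" using 0 by auto
  then have "vhol i (vbar j f) = (\<lambda>p. 0)" by (simp add: comm)
  ultimately show "cube_integral (\<lambda>p. vbar j f p * cnj (vbar j f p)) = 0"
    by (simp add: eq vbar_cnj[OF quotient_function_smooth[OF q]] cong: integral_cong)
      (simp add: eq[symmetric] vbar_cnj[OF quotient_function_smooth[OF q]])
qed

text \<open>When a b = 1 the curvature term is absent, and the symmetry condition is dbar-closedness
  of the (0, 1)-form with coefficients \<open>f\<close>.\<close>

definition compatible_system :: "(idx \<Rightarrow> point \<Rightarrow> complex) \<Rightarrow> bool" where
  "compatible_system f \<longleftrightarrow>
     (\<forall>i. quotient_function (f i)) \<and> (\<forall>i j p. vbar i (f j) p = vbar j (f i) p)"

lemma compatible_system_diff_exact: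
  assumes ab: "a * b = 1" and f: "compatible_system f" and u: "quotient_function u"
  shows "compatible_system (\<lambda>i p. f i p - vbar i u p)"
proof -
  have sf: "smooth (f i)" "quotient_function (f i)" for i
    using f quotient_function_smooth by (auto simp: compatible_system_def)
  have su: "smooth u" by (rule quotient_function_smooth[OF u])
  have "vbar i (\<lambda>p. f j p - vbar j u p) p = vbar i (f j) p - vbar i (vbar j u) p" for i j p
    by (simp add: vbar_rules(2) sf smooth_vbar su)
  moreover have "vbar i (vbar j u) = vbar j (vbar i u)" for i j
    using vbar_commute[OF su] ab by blast
  ultimately show ?thesis
    using f by (auto simp: compatible_system_def intro!: quotient_function_diff sf quotient_function_vbar u)
qed

text \<open>The three complex directions are treated one after the other: a torus equation in the
  direction of the fibre makes one component constant along that fibre, and an energy argument then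
  shows that it is constant and that the other components are constant along the fibre.\<close>

lemma solve_fibre:
  assumes ab: "a * b = 1" and f: "compatible_system f"
  obtains u where "quotient_function u"
    "\<And>p q. f I3 p - vbar I3 u p = f I3 q - vbar I3 u q"
    "\<And>i p. vbar I3 (\<lambda>p. f i p - vbar i u p) p = 0"
proof -
  have q: "quotient_function (f i)" for i using f by (auto simp: compatible_system_def)
  interpret torus_directions "axis Ct 1 :: point" "axis Cz 1 :: point" .
  \<comment> \<open>The factor 2 compensates the 1/2 in \<open>vbar\<close>: the torus operator in
    these directions is twice conj V3.\<close>
  have F: "quotient_function (\<lambda>p. 2 * f I3 p)" by (intro quotient_function_intros q)
  obtain u where u: "smooth u"
    and ut: "\<And>p. dird (axis Ct 1) (\<lambda>p. 2 * f I3 p - (dird (axis Ct 1) u p + \<i> * of_real c * dird (axis Cz 1) u p)) p = 0"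
    and uz: "\<And>p. dird (axis Cz 1) (\<lambda>p. 2 * f I3 p - (dird (axis Ct 1) u p + \<i> * of_real c * dird (axis Cz 1) u p)) p = 0"
    and inv: "\<And>T p. (\<And>p s r. T (p + s *\<^sub>R axis Ct 1 + r *\<^sub>R axis Cz 1) = T p + s *\<^sub>R axis Ct 1 + r *\<^sub>R axis Cz 1) \<Longrightarrow>
      (\<And>p. 2 * f I3 (T p) = 2 * f I3 p) \<Longrightarrow> u (T p) = u p"
    using torus_equation_solvable[OF nonzero(3) quotient_function_smooth[OF F]
        quotient_function_periodic[OF F, of Ct] quotient_function_periodic[OF F, of Cz]] by simp blast
  have "u (gmul \<gamma> p) = u p" if "\<gamma> \<in> lattice" for \<gamma> p
    by (rule inv) (simp_all add: gmul_add_axis quotient_function_invariant[OF q that])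
  then have qu: "quotient_function u" using u by (simp add: quotient_function_def)
  define f' where "f' = (\<lambda>i p. f i p - vbar i u p)"
  have f': "compatible_system f'" unfolding f'_def by (rule compatible_system_diff_exact[OF ab f qu])
  have q': "quotient_function (f' i)" for i using f' by (auto simp: compatible_system_def)
  note s' = quotient_function_smooth[OF q']
  have "(\<lambda>p. 2 * f I3 p - (dird (axis Ct 1) u p + \<i> * of_real c * dird (axis Cz 1) u p)) = (\<lambda>p. 2 * f' I3 p)"
    by (simp add: f'_def vbar_eq lder_eq[OF u] fun_eq_iff algebra_simps)
  then have "lder Ct (f' I3) p = 0" "lder Cz (f' I3) p = 0" for p
    using ut[of p] uz[of p] by (simp_all add: lder_eq[OF s'] dird_cmult[OF s'])
  then have v3: "vbar I3 (f' I3) p = 0" "vhol I3 (f' I3) p = 0" for p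
    using vbar_vhol_zero_iff(3)[of "f' I3" p] by auto
  have sym: "vbar i (f' j) p = vbar j (f' i) p" for i j p using f' by (auto simp: compatible_system_def)
  have v0: "vbar j (f' I3) p = 0" for j p
    by (rule mixed_zero[OF q' q' _ vhol3_vbar_commute[OF s'] v3(2)])
      (use f' in \<open>auto simp: compatible_system_def\<close>)
  have "f' I3 p = f' I3 q" for p q by (rule vbar_zero_imp_constant[OF q' v0])
  moreover have "vbar I3 (f' j) p = 0" for j p by (simp only: sym[of I3] v0)
  ultimately show ?thesis using qu by (intro that) (auto simp: f'_def)
qed

lemma lder_z_zero:
  assumes f: "quotient_function f" and 0: "\<And>p. vbar I3 f p = 0"
  shows "lder Cz f p = 0" "lder Ct f p = 0"
  using vbar_vhol_zero_iff(3)[of f p] vbar_zero_imp_vhol_zero[OF f 0] 0 by blast+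

lemma solve_x:
  assumes ab: "a * b = 1" and f: "compatible_system f" and 3: "\<And>i p. vbar I3 (f i) p = 0"
  obtains u where "quotient_function u"
    "\<And>p q. f I1 p - vbar I1 u p = f I1 q - vbar I1 u q"
    "\<And>p. vbar I1 (\<lambda>p. f I2 p - vbar I2 u p) p = 0"
    "\<And>p. vbar I3 u p = 0"
proof -
  have q: "quotient_function (f i)" for i using f by (auto simp: compatible_system_def)
  note s = quotient_function_smooth[OF q]
  have fz: "f i (p + r *\<^sub>R axis Cz 1) = f i p" "f i (p + r *\<^sub>R axis Ct 1) = f i p" for i p r
    using lder_z_zero[OF q 3] by (intro dird_zero_imp_translation_invariant[OF s]; simp add: lder_eq[OF s])+
  interpret torus_directions "axis Cx1 1 :: point" "axis Cx2 1 :: point" .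
  have F: "quotient_function (\<lambda>p. 2 * f I1 p)" by (intro quotient_function_intros q)
  \<comment> \<open>Periodicity in the x-directions holds here because the components no longer
    depend on z, so the shift of z in the shear has no effect.\<close>
  have fx: "2 * f I1 (p + axis Cx1 1) = 2 * f I1 p" "2 * f I1 (p + axis Cx2 1) = 2 * f I1 p" for p
    using quotient_function_shear[OF q, of Cx1 Cy1 I1 p 0] quotient_function_shear[OF q, of Cx2 Cy2 I1 p 0]
      fz(1)[of I1 p "- p $ Cy1"] fz(1)[of I1 p "- p $ Cy2"]
    by simp_all
  obtain u where u: "smooth u"
    and u1: "\<And>p. dird (axis Cx1 1) (\<lambda>p. 2 * f I1 p - (dird (axis Cx1 1) u p + \<i> * of_real a * dird (axis Cx2 1) u p)) p = 0"
    and u2: "\<And>p. dird (axis Cx2 1) (\<lambda>p. 2 * f I1 p - (dird (axis Cx1 1) u p + \<i> * of_real a * dird (axis Cx2 1) u p)) p = 0"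
    and inv: "\<And>T p. (\<And>p s r. T (p + s *\<^sub>R axis Cx1 1 + r *\<^sub>R axis Cx2 1) = T p + s *\<^sub>R axis Cx1 1 + r *\<^sub>R axis Cx2 1) \<Longrightarrow>
      (\<And>p. 2 * f I1 (T p) = 2 * f I1 p) \<Longrightarrow> u (T p) = u p"
    using torus_equation_solvable[OF nonzero(1) quotient_function_smooth[OF F] fx] by simp blast
  have "u (gmul \<gamma> p) = u p" if "\<gamma> \<in> lattice" for \<gamma> p
    by (rule inv) (simp_all add: gmul_add_axis quotient_function_invariant[OF q that])
  then have qu: "quotient_function u" using u by (simp add: quotient_function_def)
  \<comment> \<open>Translations along z and t are symmetries of the right-hand side that commute
    with x-translations, hence symmetries of \<open>u\<close>. The fibre independence already
    achieved is thus not spoiled.\<close>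
  have uz: "u (p + r *\<^sub>R axis Cz 1) = u p" "u (p + r *\<^sub>R axis Ct 1) = u p" for p r
    by (rule inv[of "\<lambda>p. p + r *\<^sub>R axis Cz 1"] inv[of "\<lambda>p. p + r *\<^sub>R axis Ct 1"]; simp add: fz algebra_simps)+
  have u3: "vbar I3 u p = 0" for p
    using translation_invariant_imp_dird_zero[OF u uz(1)] translation_invariant_imp_dird_zero[OF u uz(2)]
    by (simp add: vbar_eq lder_eq[OF u])
  define f' where "f' = (\<lambda>i p. f i p - vbar i u p)"
  have f': "compatible_system f'" unfolding f'_def by (rule compatible_system_diff_exact[OF ab f qu])
  have q': "quotient_function (f' i)" for i using f' by (auto simp: compatible_system_def)
  note s' = quotient_function_smooth[OF q']
  have h3': "vbar I3 (f' i) p = 0" for i p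
  proof -
    have "vbar I3 (f' i) p = vbar I3 (f i) p - vbar i (vbar I3 u) p"
      unfolding f'_def by (simp add: vbar_rules(2) s smooth_vbar u vbar3_commute[OF u])
    moreover have "vbar I3 u = (\<lambda>p. 0)" using u3 by auto
    ultimately show ?thesis by (simp add: 3)
  qed
  have "(\<lambda>p. 2 * f I1 p - (dird (axis Cx1 1) u p + \<i> * of_real a * dird (axis Cx2 1) u p)) = (\<lambda>p. 2 * f' I1 p)"
    by (simp add: f'_def vbar_eq lder_eq[OF u] fun_eq_iff algebra_simps)
  then have "lder Cx1 (f' I1) p = 0" "lder Cx2 (f' I1) p = 0" for p
    using u1[of p] u2[of p] by (simp_all add: lder_eq[OF s'] dird_cmult[OF s'])
  then have v1: "vbar I1 (f' I1) p = 0" "vhol I1 (f' I1) p = 0" for p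
    using vbar_vhol_zero_iff(1)[of "f' I1" p] by auto
  have sym: "vbar i (f' j) p = vbar j (f' i) p" for i j p using f' by (auto simp: compatible_system_def)
  have v0: "vbar j (f' I1) p = 0" for j p
    by (rule mixed_zero[OF q' q' _ vhol_vbar_commute[OF s' lder_z_zero(1)[OF q' h3']] v1(2)])
      (use f' in \<open>auto simp: compatible_system_def\<close>)
  have "f' I1 p = f' I1 q" for p q by (rule vbar_zero_imp_constant[OF q' v0])
  moreover have "vbar I1 (f' I2) p = 0" for p by (simp only: sym[of I1] v0)
  ultimately show ?thesis using qu u3 by (intro that) (auto simp: f'_def)
qed

lemma solve_y:
  assumes f: "quotient_function f" and 1: "\<And>p. vbar I1 f p = 0" and 3: "\<And>p. vbar I3 f p = 0"
  obtains u where "quotient_function u"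
    "\<And>p q. f p - vbar I2 u p = f q - vbar I2 u q" "\<And>p. vbar I1 u p = 0" "\<And>p. vbar I3 u p = 0"
proof -
  note s = quotient_function_smooth[OF f]
  have z: "lder Cz f p = 0" "lder Ct f p = 0" for p using lder_z_zero[OF f 3] .
  have x: "lder Cx1 f p = 0" "lder Cx2 f p = 0" for p
    using vbar_vhol_zero_iff(1)[of f p] vbar_zero_imp_vhol_zero[OF f 1] 1 by blast+
  have inv0: "f (p + r *\<^sub>R axis i 1) = f p" if "i \<in> {Cx1, Cx2, Cz, Ct}" for i p r
    using that x z by (intro dird_zero_imp_translation_invariant[OF s]) (auto simp: lder_eq[OF s])
  interpret torus_directions "axis Cy1 1 :: point" "axis Cy2 1 :: point" .
  have F: "quotient_function (\<lambda>p. 2 * f p)" by (intro quotient_function_intros f)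
  obtain u where u: "smooth u"
    and u1: "\<And>p. dird (axis Cy1 1) (\<lambda>p. 2 * f p - (dird (axis Cy1 1) u p + \<i> * of_real b * dird (axis Cy2 1) u p)) p = 0"
    and u2: "\<And>p. dird (axis Cy2 1) (\<lambda>p. 2 * f p - (dird (axis Cy1 1) u p + \<i> * of_real b * dird (axis Cy2 1) u p)) p = 0"
    and inv: "\<And>T p. (\<And>p s r. T (p + s *\<^sub>R axis Cy1 1 + r *\<^sub>R axis Cy2 1) = T p + s *\<^sub>R axis Cy1 1 + r *\<^sub>R axis Cy2 1) \<Longrightarrow>
      (\<And>p. 2 * f (T p) = 2 * f p) \<Longrightarrow> u (T p) = u p"
    using torus_equation_solvable[OF nonzero(2) quotient_function_smooth[OF F]
        quotient_function_periodic[OF F, of Cy1] quotient_function_periodic[OF F, of Cy2]] by simp blast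
  have utrans: "u (p + d) = u p" if "\<And>p. f (p + d) = f p" for p d
    by (rule inv[of "\<lambda>p. p + d"]) (simp_all add: that algebra_simps)
  have ux: "u (p + r *\<^sub>R axis i 1) = u p" if "i \<in> {Cx1, Cx2, Cz, Ct}" for i p r
    using inv0[OF that] by (intro utrans)
  \<comment> \<open>Left translation by \<open>\<gamma>\<close> does not commute with translations
    along y. It is split into the plain translation by \<open>\<gamma>\<close> and a shift of z,
    each of which leaves \<open>f\<close>, and hence \<open>u\<close>, unchanged.\<close>
  have "u (gmul \<gamma> p) = u p" if \<gamma>: "\<gamma> \<in> lattice" for \<gamma> p
  proof -
    have "f (q + \<gamma>) = f q" for q
      using quotient_function_invariant[OF f \<gamma>, of q] by (simp add: gmul_eq_translation inv0)
    then have "u (p + \<gamma>) = u p" by (rule utrans)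
    then show ?thesis by (simp add: gmul_eq_translation ux)
  qed
  then have qu: "quotient_function u" using u by (simp add: quotient_function_def)
  have ud: "dird (axis i 1) u p = 0" if "i \<in> {Cx1, Cx2, Cz, Ct}" for i p
    by (rule translation_invariant_imp_dird_zero[OF u ux[OF that]])
  have u13: "vbar I1 u p = 0" "vbar I3 u p = 0" for p
    by (simp_all add: vbar_eq lder_eq[OF u] ud)
  have uz: "\<forall>p. lder Cz u p = 0" by (simp add: lder_eq[OF u] ud)
  define f' where "f' = (\<lambda>p. f p - vbar I2 u p)"
  have q': "quotient_function f'"
    unfolding f'_def by (intro quotient_function_diff f quotient_function_vbar qu)
  note s' = quotient_function_smooth[OF q']
  have v: "vbar i f' p = 0" if "i \<in> {I1, I3}" for i p
  proof -
    have "vbar i f' p = vbar i f p - vbar I2 (vbar i u) p"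
      unfolding f'_def using vbar_commute[OF u, of i I2] uz
      by (simp add: vbar_rules(2) s smooth_vbar u)
    moreover have "vbar i u = (\<lambda>p. 0)" using u13 that by auto
    ultimately show ?thesis using 1 3 that by auto
  qed
  have z': "lder Cz f' p = 0" for p using lder_z_zero(1)[OF q'] v by simp
  then have z'': "dird (axis Cz 1) f' p = 0" for p by (simp add: lder_eq[OF s'])
  have "(\<lambda>p. 2 * f p - (dird (axis Cy1 1) u p + \<i> * of_real b * dird (axis Cy2 1) u p)) = (\<lambda>p. 2 * f' p)"
    by (simp add: f'_def vbar_eq lder_eq[OF u] ud fun_eq_iff algebra_simps)
  then have "lder Cy1 f' p = 0" "lder Cy2 f' p = 0" for p
    using u1[of p] u2[of p] z'' by (simp_all add: lder_eq[OF s'] dird_cmult[OF s'])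
  then have "vbar I2 f' p = 0" for p by (simp add: vbar_eq)
  then have "vbar i f' p = 0" for i p using v by (cases i) auto
  then have "f' p = f' q" for p q by (rule vbar_zero_imp_constant[OF q'])
  then show ?thesis using qu u13 by (intro that) (auto simp: f'_def)
qed

theorem closed_imp_constant_plus_exact:
  assumes ab: "a * b = 1" and f: "compatible_system f"
  obtains u k where "quotient_function u" "\<And>i p. f i p = k i + vbar i u p"
proof -
  obtain u1 where u1: "quotient_function u1" "\<And>p q. f I3 p - vbar I3 u1 p = f I3 q - vbar I3 u1 q"
    "\<And>i p. vbar I3 (\<lambda>p. f i p - vbar i u1 p) p = 0"
    using solve_fibre[OF ab f] by blast
  define f1 where "f1 = (\<lambda>i p. f i p - vbar i u1 p)"
  have f1: "compatible_system f1" unfolding f1_def by (rule compatible_system_diff_exact[OF ab f u1(1)])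
  have 31: "vbar I3 (f1 i) p = 0" for i p using u1(3) by (simp add: f1_def)
  obtain u2 where u2: "quotient_function u2" "\<And>p q. f1 I1 p - vbar I1 u2 p = f1 I1 q - vbar I1 u2 q"
    "\<And>p. vbar I1 (\<lambda>p. f1 I2 p - vbar I2 u2 p) p = 0" "\<And>p. vbar I3 u2 p = 0"
    using solve_x[OF ab f1 31] by blast
  define f2 where "f2 = (\<lambda>i p. f1 i p - vbar i u2 p)"
  have f2: "compatible_system f2" unfolding f2_def by (rule compatible_system_diff_exact[OF ab f1 u2(1)])
  have q: "quotient_function (f i)" "quotient_function (f1 i)" "quotient_function (f2 i)" for i
    using f f1 f2 by (auto simp: compatible_system_def)
  have 12: "vbar I1 (f2 I2) p = 0" for p using u2(3) by (simp add: f2_def)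
  \<comment> \<open>The second correction has no conj V3-derivative, so the third component is still
    constant; closedness then transfers this to the second component.\<close>
  have 32: "vbar I3 (f2 I2) p = 0" for p
  proof -
    have "f2 I3 p = f1 I3 p" for p by (simp add: f2_def u2(4))
    then have "f2 I3 p = f2 I3 q" for p q using u1(2) by (simp add: f1_def)
    then have "f2 I3 = (\<lambda>p. f2 I3 0)" by auto
    then have "vbar I2 (f2 I3) p = 0" by (metis vbar_const)
    then show ?thesis using f2 by (simp add: compatible_system_def)
  qed
  obtain u3 where u3: "quotient_function u3" "\<And>p q. f2 I2 p - vbar I2 u3 p = f2 I2 q - vbar I2 u3 q"
    "\<And>p. vbar I1 u3 p = 0" "\<And>p. vbar I3 u3 p = 0"
    using solve_y[OF q(3) 12 32] by blast
  define u where "u = (\<lambda>p. u1 p + (u2 p + u3 p))"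
  have u: "quotient_function u" unfolding u_def by (intro quotient_function_intros u1 u2 u3)
  have vu: "vbar i u p = vbar i u1 p + (vbar i u2 p + vbar i u3 p)" for i p
    unfolding u_def by (simp add: vbar_rules(1) smooth_add quotient_function_smooth u1(1) u2(1) u3(1))
  \<comment> \<open>\<open>u2\<close> is annihilated by conj V3, and \<open>u3\<close> by conj V1
    and conj V3, so later corrections do not disturb components made constant earlier.\<close>
  have const: "f i p - vbar i u p = f i 0 - vbar i u 0" for i p
    using u1(2)[of p 0] u2(2)[of p 0] u3(2)[of p 0] u2(4) u3(3,4)
    by (cases i) (simp_all add: vu f1_def f2_def algebra_simps)
  then have "f i p = (f i 0 - vbar i u 0) + vbar i u p" for i p
    by (metis diff_add_cancel)
  then show ?thesis using that[OF u, of "\<lambda>i. f i 0 - vbar i u 0"] by blast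
qed

end


section \<open>Forms of type \<open>(0, q)\<close>\<close>

lemma pq_part_0: "pq_part j 0 q A vs = (if length vs = q then A (map (proj01 j) vs) else 0)"
proof -
  have "{S. S \<subseteq> {..<0 + q} \<and> card S = 0} = {{}}"
    using finite_subset[OF _ finite_lessThan] by (auto simp: card_eq_0_iff)
  moreover have "map (\<lambda>i. proj01 j (vs ! i)) [0..<q] = map (proj01 j) vs" if "length vs = q"
    using that map_nth[of vs] by (metis list.map_comp comp_def map_eq_conv)
  ultimately show ?thesis by (simp add: pq_part_def)
qed

lemma one_form_in_covectors:
  assumes "\<And>u v. f p (u + v) = f p u + f p v" "\<And>k v. f p (k *s v) = k * f p v"
  shows "one_form f p \<in> covectors 1"
proof -
  have "one_form f p vs = 0" if "length vs \<noteq> 1" for vs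
    using that by (auto simp: one_form_def split: list.split)
  moreover have "one_form f p (vs[i := u]) = f p u" if "length vs = 1" "i < 1" for vs i u
    using that by (auto simp: one_form_def length_Suc_conv split: list.split)
  ultimately show ?thesis by (auto simp: covectors_def assms)
qed

lemma covector_1_linear:
  assumes "A \<in> covectors 1"
  shows "A [u + v] = A [u] + A [v]" "A [k *s v] = k * A [v]"
proof -
  have add: "A (vs[i := u + w]) = A (vs[i := u]) + A (vs[i := w])"
    and scale: "A (vs[i := k *s u]) = k * A (vs[i := u])" if "length vs = 1" "i < 1" for vs i u w k
    using assms that by (auto simp: covectors_def)
  show "A [u + v] = A [u] + A [v]" using add[of "[u]" 0 u v] by simp
  show "A [k *s v] = k * A [v]" using scale[of "[v]" 0 k v] by simp
qed

lemma covector_1_sum: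
  assumes "A \<in> covectors 1"
  shows "A [(\<Sum>i\<in>I. k i *s v i)] = (\<Sum>i\<in>I. k i * A [v i])"
proof (induction I rule: infinite_finite_induct)
  case empty
  then show ?case using covector_1_linear(2)[OF assms, of 0 0] by simp
next
  case (infinite I)
  then show ?case using covector_1_linear(2)[OF assms, of 0 0] by simp
qed (simp add: covector_1_linear[OF assms])

lemma cderiv_dird: "cderiv f p v = dird (re_vec v) f p + \<i> * dird (im_vec v) f p"
  by (simp add: cderiv_def dird_def)

lemma cderiv_eq:
  assumes f: "smooth f"
  shows "cderiv f p v = v $ Cx1 * lder Cx1 f p + v $ Cx2 * lder Cx2 f p
    + v $ Cy1 * lder Cy1 f p + v $ Cy2 * lder Cy2 f p
    + (v $ Cz - p $ Cx1 * v $ Cy1 - p $ Cx2 * v $ Cy2) * lder Cz f p + v $ Ct * lder Ct f p"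
  unfolding cderiv_dird by (simp add: dird_eq_lder[OF f] re_vec_def im_vec_def complex_eq_iff algebra_simps)

lemma cderiv_mult:
  assumes "smooth f" "smooth g"
  shows "cderiv (\<lambda>q. f q * g q) p v = f p * cderiv g p v + cderiv f p v * g p"
  unfolding cderiv_dird by (simp add: dird_mult[OF assms] algebra_simps)

lemma cderiv_sum:
  assumes "\<And>i. i \<in> I \<Longrightarrow> smooth (f i)"
  shows "cderiv (\<lambda>q. \<Sum>i\<in>I. f i q) p v = (\<Sum>i\<in>I. cderiv (f i) p v)"
  unfolding cderiv_dird by (simp add: dird_sum[OF assms] sum.distrib sum_distrib_left)

lemma dird_coordinate: "dird v (\<lambda>p::point. complex_of_real (p $ i)) = (\<lambda>p. of_real (v $ i))"
  using dird_coordinate_mult[OF smooth_const[of 1], of v i] by simp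

section \<open>Pointwise linear algebra of the almost complex structure\<close>

locale kt6_structure = structure_constants +
  fixes J :: "point \<Rightarrow> point \<Rightarrow> point"
  assumes J_acs: "almost_complex J"
    and J_x: "\<And>p. J p (frame Cx1 p) = a *\<^sub>R frame Cx2 p"
    and J_y: "\<And>p. J p (frame Cy1 p) = b *\<^sub>R frame Cy2 p"
    and J_t: "\<And>p. J p (frame Ct p) = c *\<^sub>R frame Cz p"
begin

text \<open>The three prescribed values together with \<open>J^2 = -1\<close> determine
  \<open>J\<close> on the whole left-invariant frame; the formula is this, rewritten in standard
  coordinates.\<close>

lemma J_eq:
  "J p v = (\<chi> i. case i of
       Cx1 \<Rightarrow> - v $ Cx2 / a | Cx2 \<Rightarrow> a * v $ Cx1
     | Cy1 \<Rightarrow> - v $ Cy2 / b | Cy2 \<Rightarrow> b * v $ Cy1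
     | Cz \<Rightarrow> c * v $ Ct - p $ Cx1 * v $ Cy2 / b + p $ Cx2 * b * v $ Cy1
     | Ct \<Rightarrow> - (v $ Cz - p $ Cx1 * v $ Cy1 - p $ Cx2 * v $ Cy2) / c)"
proof -
  have lin: "linear (J p)" and sq: "\<And>v. J p (J p v) = - v"
    using J_acs by (auto simp: almost_complex_def)
  have inverse: "J p w = (- (1 / r)) *\<^sub>R u" if "J p u = r *\<^sub>R w" "r \<noteq> 0" for u w r
  proof -
    have "r *\<^sub>R J p w = - u" using sq[of u] that(1) by (simp add: linear_scale[OF lin])
    then have "(1 / r) *\<^sub>R (r *\<^sub>R J p w) = (1 / r) *\<^sub>R (- u)" by simp
    then show ?thesis using that(2) by simp
  qed
  have v: "v = v $ Cx1 *\<^sub>R frame Cx1 p + (v $ Cx2 *\<^sub>R frame Cx2 p + (v $ Cy1 *\<^sub>R frame Cy1 p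
      + (v $ Cy2 *\<^sub>R frame Cy2 p + ((v $ Cz - p $ Cx1 * v $ Cy1 - p $ Cx2 * v $ Cy2) *\<^sub>R frame Cz p
      + v $ Ct *\<^sub>R frame Ct p))))"
    by (simp add: vec_eq_iff forall_coord axis_def frame_def)
  have "J p v = v $ Cx1 *\<^sub>R a *\<^sub>R frame Cx2 p + (v $ Cx2 *\<^sub>R (- (1 / a)) *\<^sub>R frame Cx1 p
      + (v $ Cy1 *\<^sub>R b *\<^sub>R frame Cy2 p + (v $ Cy2 *\<^sub>R (- (1 / b)) *\<^sub>R frame Cy1 p
      + ((v $ Cz - p $ Cx1 * v $ Cy1 - p $ Cx2 * v $ Cy2) *\<^sub>R (- (1 / c)) *\<^sub>R frame Ct p
      + v $ Ct *\<^sub>R c *\<^sub>R frame Cz p))))"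
    by (subst v) (simp only: linear_add[OF lin] linear_scale[OF lin] J_x J_y J_t
        inverse[OF J_x nonzero(1)] inverse[OF J_y nonzero(2)] inverse[OF J_t nonzero(3)])
  also have "\<dots> = (\<chi> i. case i of
       Cx1 \<Rightarrow> - v $ Cx2 / a | Cx2 \<Rightarrow> a * v $ Cx1
     | Cy1 \<Rightarrow> - v $ Cy2 / b | Cy2 \<Rightarrow> b * v $ Cy1
     | Cz \<Rightarrow> c * v $ Ct - p $ Cx1 * v $ Cy2 / b + p $ Cx2 * b * v $ Cy1
     | Ct \<Rightarrow> - (v $ Cz - p $ Cx1 * v $ Cy1 - p $ Cx2 * v $ Cy2) / c)"
    using nonzero by (simp add: vec_eq_iff forall_coord axis_def frame_def field_simps)
  finally show ?thesis .
qed

lemma complexify_J: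
  "complexify (J p) v = (\<chi> i. case i of
       Cx1 \<Rightarrow> - v $ Cx2 / a | Cx2 \<Rightarrow> a * v $ Cx1
     | Cy1 \<Rightarrow> - v $ Cy2 / b | Cy2 \<Rightarrow> b * v $ Cy1
     | Cz \<Rightarrow> c * v $ Ct - p $ Cx1 * v $ Cy2 / b + p $ Cx2 * b * v $ Cy1
     | Ct \<Rightarrow> - (v $ Cz - p $ Cx1 * v $ Cy1 - p $ Cx2 * v $ Cy2) / c)"
  by (simp add: vec_eq_iff forall_coord complexify_def of_real_vec_def re_vec_def im_vec_def J_eq complex_eq_iff)

text \<open>The coframe of conjugates of \<open>\<phi>\<^sup>1, \<phi>\<^sup>2, \<phi>\<^sup>3\<close> and its dual frame of \<open>(0, 1)\<close>-vectors.\<close>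

definition pb :: "idx \<Rightarrow> point \<Rightarrow> cvec \<Rightarrow> complex" where
  "pb i p v = (case i of
       I1 \<Rightarrow> v $ Cx1 - \<i> / a * v $ Cx2
     | I2 \<Rightarrow> v $ Cy1 - \<i> / b * v $ Cy2
     | I3 \<Rightarrow> v $ Ct - \<i> / c * (v $ Cz - p $ Cx1 * v $ Cy1 - p $ Cx2 * v $ Cy2))"

definition cframe :: "coord \<Rightarrow> point \<Rightarrow> cvec" where
  "cframe k p = of_real_vec (frame k p)"

definition vb_vec :: "idx \<Rightarrow> point \<Rightarrow> cvec" where
  "vb_vec i p = (\<Sum>k\<in>UNIV. nu a b c i k *s cframe k p)"

lemma cframe_nth: "cframe k p $ i =
    (if i = k then 1 else 0) + (if i = Cz \<and> k = Cy1 then of_real (p $ Cx1) else 0)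
      + (if i = Cz \<and> k = Cy2 then of_real (p $ Cx2) else 0)"
  by (cases k; cases i) (simp_all add: cframe_def of_real_vec_def frame_def axis_def)

lemma vb_vec_nth: "vb_vec i p $ j = nu a b c i j + (if j = Cz then p $ Cx1 * nu a b c i Cy1 + p $ Cx2 * nu a b c i Cy2 else 0)"
  by (cases j) (simp_all add: vb_vec_def cframe_nth sum_coord algebra_simps)

lemma pb_add: "pb i p (u + v) = pb i p u + pb i p v"
  by (cases i) (simp_all add: pb_def algebra_simps)

lemma pb_scale: "pb i p (k *s v) = k * pb i p v"
  by (cases i) (simp_all add: pb_def algebra_simps)

lemma pb_dual: "pb i p (vb_vec j p) = (if i = j then 1 else 0)"
  using nonzero by (cases i; cases j) (simp_all add: pb_def vb_vec_nth nu_def field_simps)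

lemma proj01_eq: "proj01 (J p) v = (\<Sum>i\<in>UNIV. pb i p v *s vb_vec i p)"
  using nonzero
  by (simp add: vec_eq_iff forall_coord proj01_def complexify_J sum_idx vb_vec_nth pb_def nu_def field_simps)

lemma pb_proj01: "pb i p (proj01 (J p) v) = pb i p v"
  unfolding proj01_eq sum_idx by (simp add: pb_add pb_scale pb_dual) (cases i; simp)

lemma complexify_dtrans: "complexify (dtrans \<gamma> p) v =
    v + (\<gamma> $ Cx1 * v $ Cy1 + \<gamma> $ Cx2 * v $ Cy2) *s axis Cz 1"
  unfolding dtrans_eq
  by (simp add: vec_eq_iff forall_coord complexify_def of_real_vec_def re_vec_def im_vec_def axis_def complex_eq_iff)

lemma pb_invariant: "pb i (gmul \<gamma> p) (complexify (dtrans \<gamma> p) v) = pb i p v"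
  unfolding complexify_dtrans by (cases i) (simp_all add: pb_def gmul_def axis_def algebra_simps)

lemma cframe_invariant: "complexify (dtrans \<gamma> p) (cframe k p) = cframe k (gmul \<gamma> p)"
  unfolding complexify_dtrans
  by (cases k) (simp_all add: vec_eq_iff forall_coord cframe_nth gmul_def axis_def)

lemma smooth_pb: "smooth (\<lambda>p. pb i p v)"
  unfolding pb_def by (cases i; simp only: idx.case; intro smooth_intros)

section \<open>Forms of type (0, 0), (0, 1) and (0, 2) through coefficient functions\<close>

definition fform :: "(point \<Rightarrow> complex) \<Rightarrow> form" where
  "fform f = (\<lambda>p vs. case vs of [] \<Rightarrow> f p | _ \<Rightarrow> 0)"

definition sform :: "(idx \<Rightarrow> point \<Rightarrow> complex) \<Rightarrow> form" where
  "sform f = one_form (\<lambda>p v. \<Sum>i\<in>UNIV. f i p * pb i p v)"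

definition wedge :: "idx \<Rightarrow> idx \<Rightarrow> point \<Rightarrow> cvec \<Rightarrow> cvec \<Rightarrow> complex" where
  "wedge i j p u v = pb i p u * pb j p v - pb i p v * pb j p u"

text \<open>The components of a \<open>(0, 2)\<close>-form along the pairs \<open>(1, 2)\<close>, \<open>(1, 3)\<close>, \<open>(2, 3)\<close> are
  labelled \<open>I1\<close>, \<open>I2\<close>, \<open>I3\<close>.\<close>

definition pair_wedge :: "idx \<Rightarrow> point \<Rightarrow> cvec \<Rightarrow> cvec \<Rightarrow> complex" where
  "pair_wedge m = (case m of I1 \<Rightarrow> wedge I1 I2 | I2 \<Rightarrow> wedge I1 I3 | I3 \<Rightarrow> wedge I2 I3)"

definition tform :: "(idx \<Rightarrow> point \<Rightarrow> complex) \<Rightarrow> form" where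
  "tform d = (\<lambda>p vs. case vs of [u, v] \<Rightarrow> (\<Sum>m\<in>UNIV. d m p * pair_wedge m p u v) | _ \<Rightarrow> 0)"

lemma sform_singleton [simp]: "sform f p [v] = (\<Sum>i\<in>UNIV. f i p * pb i p v)"
  by (simp add: sform_def one_form_def)

lemma sform_in_pq_forms:
  assumes f: "\<And>i. quotient_function (f i)"
  shows "sform f \<in> pq_forms J 0 1"
proof -
  have cov: "sform f p \<in> covectors 1" for p
    unfolding sform_def by (rule one_form_in_covectors)
      (simp_all add: pb_add pb_scale distrib_left sum.distrib sum_distrib_left mult_ac)
  have smooth: "smooth (\<lambda>p. sform f p vs)" for vs
  proof (cases "\<exists>v. vs = [v]")
    case True
    then show ?thesis by (auto intro!: smooth_intros quotient_function_smooth[OF f] smooth_pb)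
  next
    case False
    then have "(\<lambda>p. sform f p vs) = (\<lambda>p. 0)"
      by (auto simp: sform_def one_form_def split: list.split)
    then show ?thesis by (simp add: smooth_const)
  qed
  have "pullback \<gamma> (sform f) p vs = sform f p vs" if "\<gamma> \<in> lattice" for \<gamma> p vs
    unfolding pullback_def sform_def one_form_def
    by (auto split: list.split simp: pb_invariant quotient_function_invariant[OF f that])
  then have pull: "pullback \<gamma> (sform f) = sform f" if "\<gamma> \<in> lattice" for \<gamma>
    using that by (simp add: fun_eq_iff)
  have "pq_part (J p) 0 1 (sform f p) vs = sform f p vs" for p vs
    unfolding pq_part_0
    by (auto simp: length_Suc_conv pb_proj01 sform_def one_form_def split: list.split)
  then show ?thesis using cov smooth pull by (auto simp: pq_forms_def forms_def pq_covectors_def fun_eq_iff)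
qed

lemma pq_forms_01:
  assumes \<omega>: "\<omega> \<in> pq_forms J 0 1"
  obtains f where "\<And>i. quotient_function (f i)" "\<omega> = sform f"
proof -
  have cov: "\<omega> p \<in> covectors 1" and part: "pq_part (J p) 0 1 (\<omega> p) = \<omega> p"
    and sm: "smooth (\<lambda>p. \<omega> p vs)" for p vs
    using \<omega> by (auto simp: pq_forms_def forms_def pq_covectors_def)
  have pull: "pullback \<gamma> \<omega> = \<omega>" if "\<gamma> \<in> lattice" for \<gamma>
    using \<omega> that by (auto simp: pq_forms_def forms_def)
  \<comment> \<open>Values on the left-invariant frame are invariant under the lattice, whereas
    components in the standard coordinates would mix under the shear.\<close>
  define W where "W = (\<lambda>k p. \<omega> p [cframe k p])"
  have W: "quotient_function (W k)" for k
  proof -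
    have "cframe k p = axis k 1 + (of_real (if k = Cy1 then p $ Cx1 else if k = Cy2 then p $ Cx2 else 0)) *s axis Cz 1" for p
      by (cases k) (simp_all add: vec_eq_iff forall_coord cframe_nth axis_def)
    then have "W k = (\<lambda>p. \<omega> p [axis k 1] + of_real (if k = Cy1 then p $ Cx1 else if k = Cy2 then p $ Cx2 else 0) * \<omega> p [axis Cz 1])"
      by (simp add: W_def covector_1_linear[OF cov])
    moreover have "smooth (\<lambda>p::point. if k = Cy1 then p $ Cx1 else if k = Cy2 then p $ Cx2 else 0)"
      by (cases k) (auto intro: smooth_intros)
    ultimately have "smooth (W k)"
      by (auto intro!: smooth_intros sm simp del: of_real_0)
    moreover have "W k (gmul \<gamma> p) = W k p" if "\<gamma> \<in> lattice" for \<gamma> p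
      using fun_cong[OF fun_cong[OF pull[OF that]], of p "[cframe k p]"]
      by (simp add: W_def pullback_def cframe_invariant)
    ultimately show ?thesis by (simp add: quotient_function_def)
  qed
  define f where "f = (\<lambda>i p. \<omega> p [vb_vec i p])"
  have f: "f i = (\<lambda>p. \<Sum>k\<in>UNIV. nu a b c i k * W k p)" for i
    by (simp add: f_def W_def vb_vec_def covector_1_sum[OF cov])
  have "quotient_function (f i)" for i
    unfolding f by (intro quotient_function_intros W)
  moreover have "\<omega> p vs = sform f p vs" for p vs
  proof (cases "length vs = 1")
    case True
    then obtain v where v: "vs = [v]" by (auto simp: length_Suc_conv)
    have "\<omega> p vs = pq_part (J p) 0 1 (\<omega> p) vs" by (simp only: part)
    also have "\<dots> = \<omega> p [(\<Sum>i\<in>UNIV. pb i p v *s vb_vec i p)]" by (simp add: v pq_part_0 proj01_eq)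
    also have "\<dots> = (\<Sum>i\<in>UNIV. pb i p v * f i p)"
      unfolding f_def by (rule covector_1_sum[OF cov])
    also have "\<dots> = sform f p vs" by (simp add: v mult.commute)
    finally show ?thesis .
  next
    case False
    then have "\<omega> p vs = 0" using cov[of p] by (simp add: covectors_def)
    then show ?thesis using False by (auto simp: sform_def one_form_def split: list.split)
  qed
  ultimately show ?thesis using that by blast
qed

lemma fform_in_pq_forms:
  assumes "quotient_function f"
  shows "fform f \<in> pq_forms J 0 0"
proof -
  have "fform f p \<in> covectors 0" for p
    by (auto simp: covectors_def fform_def split: list.split)
  moreover have "smooth (\<lambda>p. fform f p vs)" for vs
    using quotient_function_smooth[OF assms] by (cases vs) (auto simp: fform_def smooth_const)
  moreover have "pullback \<gamma> (fform f) p vs = fform f p vs" if "\<gamma> \<in> lattice" for \<gamma> p vs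
    by (auto simp: pullback_def fform_def quotient_function_invariant[OF assms that] split: list.split)
  moreover have "pq_part (J p) 0 0 (fform f p) vs = fform f p vs" for p vs
    unfolding pq_part_0 by (auto simp: fform_def split: list.split)
  ultimately show ?thesis by (auto simp: pq_forms_def forms_def pq_covectors_def fun_eq_iff)
qed

lemma pq_forms_00:
  assumes \<omega>: "\<omega> \<in> pq_forms J 0 0"
  obtains f where "quotient_function f" "\<omega> = fform f"
proof -
  have cov: "\<omega> p \<in> covectors 0" and sm: "smooth (\<lambda>p. \<omega> p vs)" for p vs
    using \<omega> by (auto simp: pq_forms_def forms_def pq_covectors_def)
  have pull: "pullback \<gamma> \<omega> = \<omega>" if "\<gamma> \<in> lattice" for \<gamma>
    using \<omega> that by (auto simp: pq_forms_def forms_def)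
  have "\<omega> (gmul \<gamma> p) [] = \<omega> p []" if "\<gamma> \<in> lattice" for \<gamma> p
    using fun_cong[OF fun_cong[OF pull[OF that]], of p "[]"] by (simp add: pullback_def)
  then have "quotient_function (\<lambda>p. \<omega> p [])" by (simp add: quotient_function_def sm)
  moreover have "\<omega> = fform (\<lambda>p. \<omega> p [])"
    using cov by (auto simp: fun_eq_iff fform_def covectors_def split: list.split)
  ultimately show ?thesis using that by blast
qed

section \<open>The operator dbar in the left-invariant coframe\<close>

lemma cderiv_proj01:
  assumes f: "smooth f"
  shows "cderiv f p (proj01 (J p) v) = (\<Sum>i\<in>UNIV. pb i p v * vbar i f p)"
  unfolding cderiv_eq[OF f] proj01_eq vbar_def dop_def
  by (simp add: sum_idx sum_coord vb_vec_nth nu_def algebra_simps)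

text \<open>Only conj phi3 has coefficients that vary with the point. This derivative is the sole
  source of the zeroth-order term of dbar on (0, 1)-forms.\<close>

lemma cderiv_pb: "cderiv (\<lambda>q. pb j q w) p u =
    (if j = I3 then \<i> / c * (u $ Cx1 * w $ Cy1 + u $ Cx2 * w $ Cy2) else 0)"
proof (cases "j = I3")
  case True
  have "dird x (\<lambda>q. pb I3 q w) = (\<lambda>q. \<i> / c * (of_real (x $ Cx1) * w $ Cy1 + of_real (x $ Cx2) * w $ Cy2))" for x
    unfolding pb_def idx.case
    by (subst dird_diff dird_cmult dird_mult; (intro smooth_intros)?)+
      (simp add: dird_coordinate algebra_simps)
  note D = this
  have "cderiv (\<lambda>q. pb I3 q w) p u = \<i> / c * (of_real (Re (u $ Cx1)) * w $ Cy1 + of_real (Re (u $ Cx2)) * w $ Cy2)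
      + \<i> * (\<i> / c * (of_real (Im (u $ Cx1)) * w $ Cy1 + of_real (Im (u $ Cx2)) * w $ Cy2))"
    unfolding cderiv_dird D by (simp add: re_vec_def im_vec_def)
  also have "\<dots> = \<i> / c * ((of_real (Re (u $ Cx1)) + \<i> * of_real (Im (u $ Cx1))) * w $ Cy1
      + (of_real (Re (u $ Cx2)) + \<i> * of_real (Im (u $ Cx2))) * w $ Cy2)"
    by (simp add: algebra_simps)
  finally show ?thesis using True by (simp only: complex_eq[symmetric] if_True simp_thms)
next
  case False
  then have "(\<lambda>q. pb j q w) = (\<lambda>q. pb j 0 w)" by (cases j) (auto simp: pb_def)
  then have "cderiv (\<lambda>q. pb j q w) p u = cderiv (\<lambda>q. pb j 0 w) p u" by simp
  also have "\<dots> = 0" using False by (simp add: cderiv_eq[OF smooth_const])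
  finally show ?thesis using False by simp
qed

theorem dbar_fform:
  assumes f: "smooth f"
  shows "dbar J 0 0 (fform f) = sform (\<lambda>i. vbar i f)"
proof (intro ext)
  fix p vs
  show "dbar J 0 0 (fform f) p vs = sform (\<lambda>i. vbar i f) p vs"
  proof (cases "length vs = 1")
    case True
    then obtain v where v: "vs = [v]" by (auto simp: length_Suc_conv)
    have "(\<lambda>q. fform f q []) = f" by (simp add: fform_def)
    then show ?thesis
      by (simp add: v dbar_def pq_part_0 ext_d_def cderiv_proj01[OF f] mult.commute)
  next
    case False
    then show ?thesis
      by (auto simp: dbar_def pq_part_0 sform_def one_form_def split: list.split)
  qed
qed

definition dbar2 :: "(idx \<Rightarrow> point \<Rightarrow> complex) \<Rightarrow> idx \<Rightarrow> point \<Rightarrow> complex" where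
  "dbar2 f m p = (case m of
       I1 \<Rightarrow> vbar I1 (f I2) p - vbar I2 (f I1) p + curvature * f I3 p
     | I2 \<Rightarrow> vbar I1 (f I3) p - vbar I3 (f I1) p
     | I3 \<Rightarrow> vbar I2 (f I3) p - vbar I3 (f I2) p)"

theorem dbar_sform:
  assumes f: "\<And>i. smooth (f i)"
  shows "dbar J 0 1 (sform f) = tform (dbar2 f)"
proof (intro ext)
  fix p vs
  show "dbar J 0 1 (sform f) p vs = tform (dbar2 f) p vs"
  proof (cases "length vs = 2")
    case True
    then obtain u v where vs: "vs = [u, v]" by (auto simp: length_Suc_conv numeral_2_eq_2)
    define u' v' where "u' = proj01 (J p) u" and "v' = proj01 (J p) v"
    have D: "cderiv (\<lambda>q. sform f q [w]) p x = (\<Sum>j\<in>UNIV. cderiv (f j) p x * pb j p w)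
        + f I3 p * (\<i> / c * (x $ Cx1 * w $ Cy1 + x $ Cx2 * w $ Cy2))" for w x
    proof -
      have "cderiv (\<lambda>q. sform f q [w]) p x = (\<Sum>j\<in>UNIV. cderiv (\<lambda>q. f j q * pb j q w) p x)"
        unfolding sform_singleton by (rule cderiv_sum) (intro smooth_intros f smooth_pb)
      then show ?thesis by (simp add: cderiv_mult[OF f smooth_pb] cderiv_pb sum_idx)
    qed
    have "dbar J 0 1 (sform f) p vs = ext_d (sform f) p [u', v']"
      by (simp add: dbar_def pq_part_0 vs u'_def v'_def)
    also have "\<dots> = cderiv (\<lambda>q. sform f q [v']) p u' - cderiv (\<lambda>q. sform f q [u']) p v'"
      by (simp add: ext_d_def numeral_2_eq_2 del: sform_singleton)
    also have "\<dots> = (\<Sum>j\<in>UNIV. cderiv (f j) p u' * pb j p v') - (\<Sum>j\<in>UNIV. cderiv (f j) p v' * pb j p u')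
        + f I3 p * (\<i> / c * (u' $ Cx1 * v' $ Cy1 + u' $ Cx2 * v' $ Cy2 - v' $ Cx1 * u' $ Cy1 - v' $ Cx2 * u' $ Cy2))"
      unfolding D by (simp add: algebra_simps)
    also have "f I3 p * (\<i> / c * (u' $ Cx1 * v' $ Cy1 + u' $ Cx2 * v' $ Cy2 - v' $ Cx1 * u' $ Cy1 - v' $ Cx2 * u' $ Cy2))
        = curvature * f I3 p * wedge I1 I2 p u v"
    proof -
      \<comment> \<open>On (0, 1)-vectors the x1, y1 pair contributes 1/4 and the x2, y2 pair
        contributes - a b / 4, which together with the factor \<open>\<i> / c\<close> gives
        \<open>curvature\<close>.\<close>
      have comps: "u' $ Cx1 = pb I1 p u / 2" "u' $ Cx2 = \<i> * a * pb I1 p u / 2"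
        "u' $ Cy1 = pb I2 p u / 2" "u' $ Cy2 = \<i> * b * pb I2 p u / 2"
        "v' $ Cx1 = pb I1 p v / 2" "v' $ Cx2 = \<i> * a * pb I1 p v / 2"
        "v' $ Cy1 = pb I2 p v / 2" "v' $ Cy2 = \<i> * b * pb I2 p v / 2"
        by (simp_all add: u'_def v'_def proj01_eq sum_idx vb_vec_nth nu_def)
      show ?thesis
        unfolding comps curvature_def wedge_def using nonzero by (simp add: field_simps)
    qed
    also have "(\<Sum>j\<in>UNIV. cderiv (f j) p u' * pb j p v') - (\<Sum>j\<in>UNIV. cderiv (f j) p v' * pb j p u') =
        (vbar I1 (f I2) p - vbar I2 (f I1) p) * wedge I1 I2 p u v
        + (vbar I1 (f I3) p - vbar I3 (f I1) p) * wedge I1 I3 p u v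
        + (vbar I2 (f I3) p - vbar I3 (f I2) p) * wedge I2 I3 p u v"
      unfolding u'_def v'_def by (simp add: cderiv_proj01[OF f] pb_proj01 sum_idx wedge_def algebra_simps)
    finally show ?thesis
      by (simp add: vs tform_def sum_idx pair_wedge_def dbar2_def algebra_simps)
  next
    case False
    then show ?thesis
      by (auto simp: dbar_def pq_part_0 tform_def split: list.split)
  qed
qed

lemma quotient_function_dbar2: "(\<And>i. quotient_function (f i)) \<Longrightarrow> quotient_function (dbar2 f m)"
  unfolding dbar2_def[abs_def]
  by (cases m) (auto intro!: quotient_function_intros quotient_function_vbar)

lemma pair_wedge_dual:
  "pair_wedge m p (vb_vec I1 p) (vb_vec I2 p) = (if m = I1 then 1 else 0)"
  "pair_wedge m p (vb_vec I1 p) (vb_vec I3 p) = (if m = I2 then 1 else 0)"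
  "pair_wedge m p (vb_vec I2 p) (vb_vec I3 p) = (if m = I3 then 1 else 0)"
  by (cases m; simp add: pair_wedge_def wedge_def pb_dual)+

lemma sform_eq_0_iff: "sform f = 0 \<longleftrightarrow> (\<forall>i p. f i p = 0)"
proof
  assume 0: "sform f = 0"
  have "f i p = sform f p [vb_vec i p]" for i p
    by (cases i) (simp_all add: pb_dual sum_idx)
  then show "\<forall>i p. f i p = 0" by (simp add: 0)
qed (auto simp: sform_def one_form_def fun_eq_iff split: list.split)

lemma tform_eq_0_iff: "tform d = 0 \<longleftrightarrow> (\<forall>m p. d m p = 0)"
proof
  assume 0: "tform d = 0"
  have "d I1 p = tform d p [vb_vec I1 p, vb_vec I2 p]" "d I2 p = tform d p [vb_vec I1 p, vb_vec I3 p]"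
    "d I3 p = tform d p [vb_vec I2 p, vb_vec I3 p]" for p
    by (simp_all add: tform_def pair_wedge_dual sum_idx)
  then have "d m p = 0" for m p by (cases m) (simp_all add: 0)
  then show "\<forall>m p. d m p = 0" by blast
qed (auto simp: tform_def fun_eq_iff split: list.split)

lemma sform_add: "sform f + sform g = sform (\<lambda>i p. f i p + g i p)"
  by (auto simp: sform_def one_form_def fun_eq_iff distrib_right sum.distrib split: list.split)

lemma sform_diff: "sform f - sform g = sform (\<lambda>i p. f i p - g i p)"
  by (auto simp: sform_def one_form_def fun_eq_iff left_diff_distrib sum_subtractf split: list.split)

lemma form_scale_sform: "form_scale k (sform f) = sform (\<lambda>i p. k * f i p)"
  by (auto simp: form_scale_def sform_def one_form_def fun_eq_iff sum_distrib_left mult.assoc split: list.split)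

end


section \<open>Left-invariant metrics\<close>

text \<open>Cholesky factorisation by eliminating one index at a time: the Schur complement
  \<open>Q\<close> is again positive definite. It will provide a left-invariant orthonormal
  frame.\<close>

lemma positive_definite_factorization:
  fixes P :: "'a \<Rightarrow> 'a \<Rightarrow> real"
  assumes "finite S" and "\<And>i j. P i j = P j i"
    and "\<And>x. \<exists>i\<in>S. x i \<noteq> 0 \<Longrightarrow> 0 < (\<Sum>i\<in>S. \<Sum>j\<in>S. P i j * x i * x j)"
  shows "\<exists>B. \<forall>i\<in>S. \<forall>j\<in>S. P i j = (\<Sum>m\<in>S. B m i * B m j)"
  using assms
proof (induction S arbitrary: P rule: finite_induct)
  case (insert s S)
  note sym = insert.prems(1) and pos = insert.prems(2)
  have exp: "(\<Sum>i\<in>insert s S. \<Sum>j\<in>insert s S. P i j * x i * x j) =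
      P s s * (x s)\<^sup>2 + 2 * x s * (\<Sum>j\<in>S. P s j * x j) + (\<Sum>i\<in>S. \<Sum>j\<in>S. P i j * x i * x j)" for x
  proof -
    have "(\<Sum>i\<in>S. P i s * x i * x s) = x s * (\<Sum>j\<in>S. P s j * x j)"
      "(\<Sum>j\<in>S. P s j * x s * x j) = x s * (\<Sum>j\<in>S. P s j * x j)"
      by (simp_all add: sum_distrib_left sym[of _ s] mult_ac)
    then show ?thesis
      using insert.hyps by (simp add: sum.distrib power2_eq_square algebra_simps)
  qed
  define d where "d = P s s"
  have d: "d > 0"
  proof -
    have "(\<Sum>j\<in>S. P s j * (if j = s then 1 else 0)) = 0"
      using insert.hyps by (intro sum.neutral) auto
    moreover have "(\<Sum>i\<in>S. \<Sum>j\<in>S. P i j * (if i = s then 1 else 0) * (if j = s then 1 else 0)) = 0"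
      using insert.hyps by (intro sum.neutral ballI) auto
    ultimately show ?thesis
      using pos[of "\<lambda>i. if i = s then 1 else 0"] unfolding exp d_def by simp
  qed
  define Q where "Q = (\<lambda>i j. P i j - P s i * P s j / d)"
  have "\<exists>B. \<forall>i\<in>S. \<forall>j\<in>S. Q i j = (\<Sum>m\<in>S. B m i * B m j)"
  proof (rule insert.IH)
    show "Q i j = Q j i" for i j using sym[of i j] by (simp add: Q_def mult.commute)
    fix x :: "'a \<Rightarrow> real" assume x: "\<exists>i\<in>S. x i \<noteq> 0"
    define \<beta> where "\<beta> = (\<Sum>j\<in>S. P s j * x j)"
    \<comment> \<open>The new coordinate minimises the quadratic form of \<open>P\<close> for fixed
      \<open>x\<close>, and the minimum is the form of \<open>Q\<close> at \<open>x\<close>.\<close>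
    define y where "y = (\<lambda>i. if i = s then - \<beta> / d else x i)"
    have yS: "i \<in> S \<Longrightarrow> y i = x i" for i using insert.hyps by (auto simp: y_def)
    have "\<exists>i\<in>insert s S. y i \<noteq> 0" using x yS by auto
    then have "0 < d * (y s)\<^sup>2 + 2 * y s * (\<Sum>j\<in>S. P s j * y j) + (\<Sum>i\<in>S. \<Sum>j\<in>S. P i j * y i * y j)"
      using pos[of y] unfolding exp d_def by simp
    also have "(\<Sum>j\<in>S. P s j * y j) = \<beta>" unfolding \<beta>_def by (intro sum.cong) (simp_all add: yS)
    also have "(\<Sum>i\<in>S. \<Sum>j\<in>S. P i j * y i * y j) = (\<Sum>i\<in>S. \<Sum>j\<in>S. P i j * x i * x j)"
      by (intro sum.cong refl) (simp add: yS)
    also have "d * (y s)\<^sup>2 + 2 * y s * \<beta> = - (\<beta> * \<beta>) / d"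
      using d by (simp add: y_def power2_eq_square field_simps)
    also have "- (\<beta> * \<beta>) / d + (\<Sum>i\<in>S. \<Sum>j\<in>S. P i j * x i * x j) = (\<Sum>i\<in>S. \<Sum>j\<in>S. Q i j * x i * x j)"
    proof -
      have "\<beta> * \<beta> / d = (\<Sum>i\<in>S. \<Sum>j\<in>S. P s i * P s j / d * x i * x j)"
        unfolding \<beta>_def by (simp add: sum_product sum_divide_distrib mult_ac)
      then show ?thesis by (simp add: Q_def sum_subtractf left_diff_distrib)
    qed
    finally show "0 < (\<Sum>i\<in>S. \<Sum>j\<in>S. Q i j * x i * x j)" .
  qed
  then obtain B where B: "\<And>i j. i \<in> S \<Longrightarrow> j \<in> S \<Longrightarrow> Q i j = (\<Sum>m\<in>S. B m i * B m j)" by blast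
  define C where "C = (\<lambda>m i. if m = s then P s i / sqrt d else if i = s then 0 else B m i)"
  have "P i j = (\<Sum>m\<in>insert s S. C m i * C m j)" if ij: "i \<in> insert s S" "j \<in> insert s S" for i j
  proof -
    have sq: "P s i / sqrt d * (P s j / sqrt d) = P s i * P s j / d" using d by simp
    have "(\<Sum>m\<in>insert s S. C m i * C m j) = P s i * P s j / d + (\<Sum>m\<in>S. C m i * C m j)"
      using insert.hyps sq by (simp add: C_def)
    also have "(\<Sum>m\<in>S. C m i * C m j) = (if i = s \<or> j = s then 0 else Q i j)"
    proof (cases "i = s \<or> j = s")
      case True
      then show ?thesis using insert.hyps by (auto intro!: sum.neutral simp: C_def)
    next
      case False
      then have "(\<Sum>m\<in>S. C m i * C m j) = (\<Sum>m\<in>S. B m i * B m j)"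
        using insert.hyps by (intro sum.cong) (auto simp: C_def)
      then show ?thesis using False ij B by simp
    qed
    finally show ?thesis using d sym[of i s] by (auto simp: Q_def d_def)
  qed
  then show ?case by blast
qed simp

lemma matrix_inv_eqI:
  fixes A B :: "real^'n^'n"
  assumes "A ** B = mat 1" shows "matrix_inv A = B"
proof -
  have "\<exists>A'. A ** A' = mat 1 \<and> A' ** A = mat 1"
    using assms matrix_left_right_inverse by blast
  then have "matrix_inv A ** A = mat 1" unfolding matrix_inv_def by (rule someI2_ex) blast
  then have "B = matrix_inv A ** (A ** B)" by (simp add: matrix_mul_assoc)
  then show ?thesis by (simp add: assms)
qed

definition frame_matrix :: "point \<Rightarrow> real^coord^coord" where
  "frame_matrix p = (\<chi> i k. frame k p $ i)"

lemma frame_matrix_inverse: "frame_matrix p ** frame_matrix (- p) = mat 1"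
  by (simp add: vec_eq_iff forall_coord matrix_matrix_mult_def sum_coord frame_matrix_def frame_def axis_def mat_def)

text \<open>Reflecting z conjugates the frame matrix at \<open>p\<close> into the one at
  \<open>- p\<close>, which is its inverse. So the determinant equals its own reciprocal; its square
  is what enters the volume density.\<close>

lemma det_frame_matrix_squared: "(det (frame_matrix p))\<^sup>2 = 1"
proof -
  define D :: "real^coord^coord" where "D = (\<chi> i j. if i = j then (if i = Cz then - 1 else 1) else 0)"
  have "D ** frame_matrix p ** D = frame_matrix (- p)"
    by (simp add: vec_eq_iff forall_coord matrix_matrix_mult_def sum_coord frame_matrix_def frame_def axis_def D_def)
  then have "det (frame_matrix (- p)) = det D * det D * det (frame_matrix p)"
    by (metis det_mul mult.commute mult.assoc)
  moreover have "D ** D = mat 1"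
    by (simp add: vec_eq_iff forall_coord matrix_matrix_mult_def sum_coord D_def mat_def)
  then have "det D * det D = 1" by (metis det_mul det_I)
  moreover have "det (frame_matrix p) * det (frame_matrix (- p)) = 1"
    by (metis frame_matrix_inverse det_mul det_I)
  ultimately show ?thesis by (simp add: power2_eq_square)
qed

lemma bilinear_gram:
  assumes "bilinear (g p)"
  shows "g p u v = (\<Sum>i\<in>UNIV. \<Sum>j\<in>UNIV. u $ i * v $ j * gram g p $ i $ j)"
proof -
  have "g p u v = g p (\<Sum>i\<in>UNIV. u $ i *\<^sub>R axis i 1) (\<Sum>j\<in>UNIV. v $ j *\<^sub>R axis j 1)"
    using basis_expansion[of u] basis_expansion[of v] by (simp add: scalar_mult_eq_scaleR)
  also have "\<dots> = (\<Sum>(i, j)\<in>UNIV \<times> UNIV. g p (u $ i *\<^sub>R axis i 1) (v $ j *\<^sub>R axis j 1))"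
    by (rule bilinear_sum[OF assms])
  also have "\<dots> = (\<Sum>i\<in>UNIV. \<Sum>j\<in>UNIV. g p (u $ i *\<^sub>R axis i 1) (v $ j *\<^sub>R axis j 1))"
    by (rule sum.cartesian_product[symmetric])
  also have "\<dots> = (\<Sum>i\<in>UNIV. \<Sum>j\<in>UNIV. u $ i * v $ j * gram g p $ i $ j)"
    by (simp add: bilinear_lmul[OF assms] bilinear_rmul[OF assms] gram_def mult_ac)
  finally show ?thesis .
qed

definition frame_combination :: "(coord \<Rightarrow> coord \<Rightarrow> real) \<Rightarrow> coord \<Rightarrow> point \<Rightarrow> point" where
  "frame_combination B m p = (\<Sum>k\<in>UNIV. B m k *\<^sub>R frame k p)"

text \<open>In the left-invariant frame the Gram matrix is the constant \<open>M\<close>. Factoring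
  its inverse \<open>N\<close> gives vectors \<open>frame_combination B m\<close> that are
  orthonormal for \<open>g\<close>, and the density is the constant \<open>sqrt (det M)\<close>
  because the change of frame has determinant of square 1.\<close>

lemma left_invariant_gram:
  assumes g: "riemannian_metric g" and inv: "left_invariant_metric g"
  obtains B w where
    "\<And>p i j. matrix_inv (gram g p) $ i $ j = (\<Sum>m\<in>UNIV. frame_combination B m p $ i * frame_combination B m p $ j)"
    "\<And>p. invertible (gram g p)" "w \<noteq> 0" "\<And>p. sqrt (det (gram g p)) = w"
proof -
  have bil: "bilinear (g p)" and sym: "g p u v = g p v u" and pos: "u \<noteq> 0 \<Longrightarrow> g p u u > 0" for p u v
    using g by (auto simp: riemannian_metric_def)
  define M where "M = gram g 0"
  define S where "S = frame_matrix"
  have M: "transpose (S p) ** gram g p ** S p = M" for p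
  proof -
    obtain N where N: "\<And>p i j. g p (frame i p) (frame j p) = N i j"
      using inv by (auto simp: left_invariant_metric_def)
    have frame0: "frame i 0 = axis i 1" for i by (cases i) (simp_all add: frame_def)
    have "M $ k $ l = (transpose (S p) ** gram g p ** S p) $ k $ l" for k l
    proof -
      have "M $ k $ l = g p (frame k p) (frame l p)"
        using N[of 0 k l] N[of p k l] by (simp add: M_def gram_def frame0)
      also have "\<dots> = (\<Sum>j\<in>UNIV. \<Sum>i\<in>UNIV. frame k p $ i * frame l p $ j * gram g p $ i $ j)"
        unfolding bilinear_gram[of g p, OF bil] by (rule sum.swap)
      also have "\<dots> = (transpose (S p) ** gram g p ** S p) $ k $ l"
        by (simp add: matrix_matrix_mult_def transpose_def S_def frame_matrix_def sum_distrib_left mult_ac)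
      finally show ?thesis .
    qed
    then show ?thesis by (simp add: vec_eq_iff)
  qed
  have S: "S p ** S (- p) = mat 1" "S (- p) ** S p = mat 1" for p
    using frame_matrix_inverse[of p] frame_matrix_inverse[of "- p"] by (simp_all add: S_def)
  have St: "transpose (S (- p)) ** transpose (S p) = mat 1" for p
    using S(1)[of p] by (metis matrix_transpose_mul transpose_mat)
  have G: "gram g p = transpose (S (- p)) ** M ** S (- p)" for p
  proof -
    have "transpose (S (- p)) ** M ** S (- p) =
        (transpose (S (- p)) ** transpose (S p)) ** gram g p ** (S p ** S (- p))"
      by (simp add: M[of p, symmetric] matrix_mul_assoc)
    then show ?thesis by (simp add: S St)
  qed
  have ker: "x = 0" if "M *v x = 0" for x
  proof (rule ccontr)
    assume "x \<noteq> 0"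
    then have "0 < g 0 x x" by (rule pos)
    also have "g 0 x x = x \<bullet> (M *v x)"
      by (simp add: bilinear_gram[of g 0, OF bil] inner_vec_def matrix_vector_mult_def M_def sum_distrib_left mult_ac)
    finally show False by (simp add: that)
  qed
  then obtain N where NM: "N ** M = mat 1" using matrix_left_invertible_ker by blast
  then have MN: "M ** N = mat 1" using matrix_left_right_inverse by blast
  have Mt: "transpose M = M"
    by (simp add: vec_eq_iff transpose_def M_def gram_def sym[of 0 "axis _ 1" "axis _ 1"])
  have Nt: "transpose N = N"
  proof -
    have "transpose N ** M = mat 1" using MN Mt by (metis matrix_transpose_mul transpose_mat)
    then have "transpose N ** M ** N = N" by simp
    then show ?thesis by (simp add: matrix_mul_assoc[symmetric] MN)
  qed
  have "\<exists>B :: coord \<Rightarrow> coord \<Rightarrow> real. \<forall>i\<in>UNIV. \<forall>j\<in>UNIV. N $ i $ j = (\<Sum>m\<in>UNIV. B m i * B m j)"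
  proof (rule positive_definite_factorization[where P = "\<lambda>i j. N $ i $ j"])
    show "N $ i $ j = N $ j $ i" for i j using Nt by (metis transpose_def vec_lambda_beta)
    fix x :: "coord \<Rightarrow> real" assume x: "\<exists>i\<in>UNIV. x i \<noteq> 0"
    define X :: point where "X = (\<chi> i. x i)"
    define y where "y = N *v X"
    have X: "M *v y = X" by (simp add: y_def matrix_vector_mul_assoc MN)
    have "X \<noteq> 0" using x by (auto simp: X_def vec_eq_iff)
    then have "y \<noteq> 0" using X by auto
    then have "0 < g 0 y y" by (rule pos)
    also have "g 0 y y = y \<bullet> (M *v y)"
      by (simp add: bilinear_gram[of g 0, OF bil] inner_vec_def matrix_vector_mult_def M_def sum_distrib_left mult_ac)
    also have "\<dots> = X \<bullet> (N *v X)" unfolding X by (simp add: y_def inner_commute)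
    also have "\<dots> = (\<Sum>i\<in>UNIV. \<Sum>j\<in>UNIV. N $ i $ j * x i * x j)"
      by (simp add: inner_vec_def matrix_vector_mult_def X_def sum_distrib_left mult_ac)
    finally show "0 < (\<Sum>i\<in>UNIV. \<Sum>j\<in>UNIV. N $ i $ j * x i * x j)" .
  qed simp
  then obtain B :: "coord \<Rightarrow> coord \<Rightarrow> real" where B: "\<And>i j. N $ i $ j = (\<Sum>m\<in>UNIV. B m i * B m j)" by auto
  have GI: "gram g p ** (S p ** N ** transpose (S p)) = mat 1" for p
  proof -
    have "gram g p ** (S p ** N ** transpose (S p)) =
        transpose (S (- p)) ** (M ** ((S (- p) ** S p) ** N)) ** transpose (S p)"
      by (simp add: G matrix_mul_assoc)
    then show ?thesis by (simp add: S MN St)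
  qed
  show ?thesis
  proof
    fix p
    show "invertible (gram g p)" using GI[of p] invertible_def matrix_left_right_inverse by blast
    show "matrix_inv (gram g p) $ i $ j = (\<Sum>m\<in>UNIV. frame_combination B m p $ i * frame_combination B m p $ j)" for i j
    proof -
      have "matrix_inv (gram g p) $ i $ j = (S p ** N ** transpose (S p)) $ i $ j"
        by (simp only: matrix_inv_eqI[OF GI])
      also have "\<dots> = (\<Sum>l\<in>UNIV. \<Sum>k\<in>UNIV. \<Sum>m\<in>UNIV. frame k p $ i * (B m k * B m l) * frame l p $ j)"
        by (simp add: matrix_matrix_mult_def transpose_def S_def frame_matrix_def B sum_distrib_left sum_distrib_right)
      also have "\<dots> = (\<Sum>m\<in>UNIV. \<Sum>k\<in>UNIV. \<Sum>l\<in>UNIV. (B m k * frame k p $ i) * (B m l * frame l p $ j))"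
        by (subst sum.swap, subst (2) sum.swap, subst sum.swap) (simp add: mult_ac)
      also have "\<dots> = (\<Sum>m\<in>UNIV. frame_combination B m p $ i * frame_combination B m p $ j)"
        by (simp add: frame_combination_def sum_product)
      finally show ?thesis .
    qed
    have "det (gram g p) = det M * (det (S (- p)))\<^sup>2"
      by (simp add: G det_mul det_transpose power2_eq_square mult_ac)
    then show "sqrt (det (gram g p)) = sqrt (det M)" by (simp add: S_def det_frame_matrix_squared)
  next
    have "invertible M" using NM invertible_left_inverse by blast
    then show "sqrt (det M) \<noteq> 0" by (simp add: invertible_det_nz)
  qed
qed

lemma sum_lists_1: "(\<Sum>I | length I = Suc 0. F I) = (\<Sum>i\<in>UNIV. F [i::'a::finite])"
  by (rule sum.reindex_bij_witness[of _ "\<lambda>i. [i]" hd]) (auto simp: length_Suc_conv)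

lemma sum_lists_2:
  fixes F :: "'a::finite list \<Rightarrow> 'b::comm_monoid_add"
  shows "(\<Sum>I | length I = 2. F I) = (\<Sum>i\<in>UNIV. \<Sum>j\<in>UNIV. F [i, j])"
proof -
  have "(\<Sum>I | length I = 2. F I) = (\<Sum>x\<in>UNIV \<times> UNIV. F [fst x, snd x])"
    by (rule sum.reindex_bij_witness[of _ "\<lambda>x. [fst x, snd x]" "\<lambda>I. (I ! 0, I ! 1)"])
      (auto simp: length_Suc_conv numeral_2_eq_2)
  then show ?thesis by (simp add: sum.cartesian_product split_beta)
qed


section \<open>The formal adjoint and harmonic forms\<close>

definition herm :: "(idx \<Rightarrow> idx \<Rightarrow> complex) \<Rightarrow> (idx \<Rightarrow> complex) \<Rightarrow> (idx \<Rightarrow> complex) \<Rightarrow> complex" where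
  "herm h x y = (\<Sum>i\<in>UNIV. \<Sum>j\<in>UNIV. h i j * x i * cnj (y j))"

definition positive_hermitian :: "(idx \<Rightarrow> idx \<Rightarrow> complex) \<Rightarrow> bool" where
  "positive_hermitian h \<longleftrightarrow> (\<forall>x y. cnj (herm h x y) = herm h y x) \<and> (\<forall>x. 0 \<le> Re (herm h x x)) \<and>
     (\<forall>x. Re (herm h x x) = 0 \<longrightarrow> (\<forall>i. x i = 0))"

lemma herm_gram:
  fixes e :: "idx \<Rightarrow> 'm::finite \<Rightarrow> complex"
  shows "herm (\<lambda>i j. \<Sum>m\<in>UNIV. e i m * cnj (e j m)) x y =
    (\<Sum>m\<in>UNIV. (\<Sum>i\<in>UNIV. x i * e i m) * cnj (\<Sum>j\<in>UNIV. y j * e j m))"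
proof -
  have "herm (\<lambda>i j. \<Sum>m\<in>UNIV. e i m * cnj (e j m)) x y =
      (\<Sum>i\<in>UNIV. \<Sum>j\<in>UNIV. \<Sum>m\<in>UNIV. (x i * e i m) * cnj (y j * e j m))"
    by (simp add: herm_def sum_distrib_right sum_distrib_left mult_ac)
  also have "\<dots> = (\<Sum>i\<in>UNIV. \<Sum>m\<in>UNIV. \<Sum>j\<in>UNIV. (x i * e i m) * cnj (y j * e j m))"
    by (intro sum.cong refl sum.swap)
  also have "\<dots> = (\<Sum>m\<in>UNIV. \<Sum>i\<in>UNIV. \<Sum>j\<in>UNIV. (x i * e i m) * cnj (y j * e j m))"
    by (rule sum.swap)
  also have "\<dots> = (\<Sum>m\<in>UNIV. (\<Sum>i\<in>UNIV. x i * e i m) * cnj (\<Sum>j\<in>UNIV. y j * e j m))"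
    by (simp add: sum_product)
  finally show ?thesis .
qed

lemma positive_hermitian_gram:
  fixes e :: "idx \<Rightarrow> 'm::finite \<Rightarrow> complex"
  assumes "\<And>x i. (\<And>m. (\<Sum>i\<in>UNIV. x i * e i m) = 0) \<Longrightarrow> x i = 0"
  shows "positive_hermitian (\<lambda>i j. \<Sum>m\<in>UNIV. e i m * cnj (e j m))"
proof -
  define y where "y = (\<lambda>x m. \<Sum>i\<in>UNIV. x i * e i m)"
  have y: "herm (\<lambda>i j. \<Sum>m\<in>UNIV. e i m * cnj (e j m)) x z = (\<Sum>m\<in>UNIV. y x m * cnj (y z m))" for x z
    unfolding y_def by (rule herm_gram)
  have re: "Re (v * cnj v) = (cmod v)\<^sup>2" for v
    by (metis Re_complex_of_real complex_norm_square)
  show ?thesis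
    unfolding positive_hermitian_def y
  proof (intro conjI allI impI)
    show "cnj (\<Sum>m\<in>UNIV. y x m * cnj (y z m)) = (\<Sum>m\<in>UNIV. y z m * cnj (y x m))" for x z
      by (simp add: mult.commute)
    show "0 \<le> Re (\<Sum>m\<in>UNIV. y x m * cnj (y x m))" for x
      unfolding Re_sum re by (intro sum_nonneg) simp
    fix x i assume "Re (\<Sum>m\<in>UNIV. y x m * cnj (y x m)) = 0"
    then have "\<forall>m\<in>UNIV. (cmod (y x m))\<^sup>2 = 0"
      unfolding Re_sum re by (subst (asm) sum_nonneg_eq_0_iff) auto
    then show "x i = 0" using assms[of x i] by (simp add: y_def)
  qed
qed

text \<open>A form \<open>q\<close> with prescribed pairings \<open>r\<close> is recovered by
  inverting the conjugate of \<open>h\<close>; invertibility is definiteness applied to a kernel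
  vector.\<close>

lemma positive_hermitian_inverse:
  assumes "positive_hermitian h"
  obtains N where "\<And>r i. (\<Sum>j\<in>UNIV. cnj (h i j) * (\<Sum>k\<in>UNIV. N j k * r k)) = r i"
proof -
  define H :: "complex^idx^idx" where "H = (\<chi> i j. cnj (h i j))"
  have "x = 0" if "H *v x = 0" for x
  proof -
    have 0: "(\<Sum>j\<in>UNIV. cnj (h i j) * x $ j) = 0" for i
      using that by (simp add: H_def matrix_vector_mult_def vec_eq_iff)
    then have *: "(\<Sum>j\<in>UNIV. h i j * cnj (x $ j)) = 0" for i
    proof -
      have "cnj (\<Sum>j\<in>UNIV. cnj (h i j) * x $ j) = 0" by (simp only: 0 complex_cnj_zero)
      then show ?thesis by (simp only: cnj_sum complex_cnj_mult complex_cnj_cnj)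
    qed
    have "herm h (\<lambda>i. x $ i) (\<lambda>i. x $ i) = (\<Sum>i\<in>UNIV. x $ i * (\<Sum>j\<in>UNIV. h i j * cnj (x $ j)))"
      by (simp add: herm_def sum_distrib_left mult_ac)
    also have "\<dots> = 0" by (simp only: *) simp
    finally show "x = 0" using assms by (simp add: positive_hermitian_def vec_eq_iff)
  qed
  then obtain N where "N ** H = mat 1" using matrix_left_invertible_ker by blast
  then have N: "H ** N = mat 1" using matrix_left_right_inverse by blast
  have "(\<Sum>j\<in>UNIV. cnj (h i j) * (\<Sum>k\<in>UNIV. N $ j $ k * r k)) = r i" for r i
  proof -
    have "H *v (N *v (\<chi> k. r k)) = (\<chi> k. r k)" by (simp add: matrix_vector_mul_assoc N)
    then show ?thesis by (simp add: H_def matrix_vector_mult_def vec_eq_iff)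
  qed
  then show ?thesis by (rule that)
qed

lemma quotient_function_herm:
  "(\<And>i. quotient_function (f i)) \<Longrightarrow> (\<And>i. quotient_function (k i)) \<Longrightarrow>
    quotient_function (\<lambda>p. herm h (\<lambda>i. f i p) (\<lambda>j. k j p))"
  unfolding herm_def by (intro quotient_function_intros)

lemma pairing_definite:
  assumes h: "positive_hermitian h" and f: "\<And>i. quotient_function (f i)"
    and 0: "cube_integral (\<lambda>p. herm h (\<lambda>i. f i p) (\<lambda>i. f i p)) = 0"
  shows "f i p = 0"
proof -
  have "Re (herm h (\<lambda>i. f i p) (\<lambda>i. f i p)) = 0"
    by (rule quotient_function_nonneg_integral_zero[OF quotient_function_herm[OF f f] _ 0])
      (use h in \<open>simp add: positive_hermitian_def\<close>)
  then show ?thesis using h by (auto simp: positive_hermitian_def)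
qed

lemma herm_diff_right: "herm h x (\<lambda>j. y j - z j) = herm h x y - herm h x z"
  by (simp add: herm_def algebra_simps sum_subtractf)

context structure_constants
begin

text \<open>The adjoint of dbar on functions. The minus sign comes from integration by parts, and
  \<open>h\<close> is conjugated because the pairing is conjugate linear in its second
  argument.\<close>

definition codiff :: "(idx \<Rightarrow> idx \<Rightarrow> complex) \<Rightarrow> (idx \<Rightarrow> point \<Rightarrow> complex) \<Rightarrow> point \<Rightarrow> complex" where
  "codiff h f p = - (\<Sum>i\<in>UNIV. \<Sum>j\<in>UNIV. cnj (h i j) * vhol i (f j) p)"

lemma quotient_function_codiff:
  assumes "\<And>i. quotient_function (f i)" shows "quotient_function (codiff h f)"
proof -
  have "quotient_function (\<lambda>p. 0 - (\<Sum>i\<in>UNIV. \<Sum>j\<in>UNIV. cnj (h i j) * vhol i (f j) p))"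
    by (intro quotient_function_intros quotient_function_vhol assms)
  then show ?thesis unfolding codiff_def[abs_def] by simp
qed

lemma cube_integral_vbar_product:
  assumes "quotient_function f" "quotient_function k"
  shows "cube_integral (\<lambda>p. vbar i f p * cnj (k p) + f p * cnj (vhol i k p)) = 0"
proof -
  have "vbar i (\<lambda>p. f p * cnj (k p)) = (\<lambda>p. vbar i f p * cnj (k p) + f p * cnj (vhol i k p))"
    unfolding vbar_def vhol_def
    by (simp add: dop_mult dop_cnj quotient_function_smooth assms smooth_cnj add.commute)
  then show ?thesis
    using cube_integral_dop[OF quotient_function_mult[OF assms(1) quotient_function_cnj[OF assms(2)]], of "nu a b c i"]
    by (simp only: vbar_def)
qed

lemma cube_integral_eqI:
  assumes "quotient_function f" "quotient_function k" "cube_integral (\<lambda>p. f p - k p) = 0"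
  shows "cube_integral f = cube_integral k"
  using assms by (simp add: integral_diff quotient_function_integrable)

lemma codiff_adjoint:
  assumes u: "quotient_function u" and f: "\<And>i. quotient_function (f i)"
  shows "cube_integral (\<lambda>p. herm h (\<lambda>i. vbar i u p) (\<lambda>j. f j p)) = cube_integral (\<lambda>p. u p * cnj (codiff h f p))"
proof (rule cube_integral_eqI)
  show "quotient_function (\<lambda>p. herm h (\<lambda>i. vbar i u p) (\<lambda>j. f j p))"
    by (intro quotient_function_herm quotient_function_vbar u f)
  show "quotient_function (\<lambda>p. u p * cnj (codiff h f p))"
    by (intro quotient_function_intros quotient_function_codiff u f)
 have "cube_integral (\<lambda>p. herm h (\<lambda>i. vbar i u p) (\<lambda>j. f j p) - u p * cnj (codiff h f p)) =
      cube_integral (\<lambda>p. \<Sum>i\<in>UNIV. \<Sum>j\<in>UNIV. h i j * (vbar i u p * cnj (f j p) + u p * cnj (vhol i (f j) p)))"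
    by (rule arg_cong[where f = cube_integral])
      (simp add: herm_def codiff_def sum_distrib_left sum.distrib distrib_left mult_ac)
  also have "\<dots> = (\<Sum>i\<in>UNIV. cube_integral (\<lambda>p. \<Sum>j\<in>UNIV. h i j * (vbar i u p * cnj (f j p) + u p * cnj (vhol i (f j) p))))"
    by (intro integral_sum quotient_function_integrable quotient_function_intros quotient_function_vbar
        quotient_function_vhol u f) simp
  also have "\<dots> = (\<Sum>i\<in>UNIV. \<Sum>j\<in>UNIV. cube_integral (\<lambda>p. h i j * (vbar i u p * cnj (f j p) + u p * cnj (vhol i (f j) p))))"
    by (intro sum.cong refl integral_sum quotient_function_integrable quotient_function_intros quotient_function_vbar
        quotient_function_vhol u f) simp
  also have "\<dots> = 0" by (simp only: integral_mult_right cube_integral_vbar_product[OF u f]) simp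
  finally show "cube_integral (\<lambda>p. herm h (\<lambda>i. vbar i u p) (\<lambda>j. f j p) - u p * cnj (codiff h f p)) = 0" .
qed

end

context kt6_structure
begin

text \<open>Only the existence of an adjoint is recorded. Integrating by parts yields the functional
  \<open>r\<close> on coefficients, and solving the linear system of \<open>h1\<close> pointwise
  turns it into \<open>q\<close>.\<close>

lemma dbar2_adjoint:
  assumes h1: "positive_hermitian h1" and d: "\<And>m. quotient_function (d m)"
  obtains q where "\<And>i. quotient_function (q i)"
    "\<And>f. (\<And>i. quotient_function (f i)) \<Longrightarrow>
      cube_integral (\<lambda>p. herm h2 (\<lambda>m. dbar2 f m p) (\<lambda>n. d n p)) = cube_integral (\<lambda>p. herm h1 (\<lambda>i. f i p) (\<lambda>j. q j p))"
proof -
  obtain N where N: "\<And>r i. (\<Sum>j\<in>UNIV. cnj (h1 i j) * (\<Sum>k\<in>UNIV. N j k * r k)) = r i"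
    using positive_hermitian_inverse[OF h1] by blast
  define e where "e = (\<lambda>m p. \<Sum>n\<in>UNIV. cnj (h2 m n) * d n p)"
  have e: "quotient_function (e m)" for m unfolding e_def by (intro quotient_function_intros d)
  \<comment> \<open>Each case gathers the terms in which that component of \<open>f\<close> occurs
    in \<open>dbar2\<close>, after the derivative has been moved to \<open>e\<close>; the curvature
    contributes without a derivative.\<close>
  define r where "r = (\<lambda>i p. case i of
      I1 \<Rightarrow> vhol I2 (e I1) p + vhol I3 (e I2) p
    | I2 \<Rightarrow> vhol I3 (e I3) p - vhol I1 (e I1) p
    | I3 \<Rightarrow> cnj curvature * e I1 p - vhol I1 (e I2) p - vhol I2 (e I3) p)"
  have r: "quotient_function (r i)" for i
    by (cases i) (auto simp: r_def intro!: quotient_function_intros quotient_function_vhol e)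
  define q where "q = (\<lambda>j p. \<Sum>k\<in>UNIV. N j k * r k p)"
  have q: "quotient_function (q i)" for i unfolding q_def by (intro quotient_function_intros r)
  have "cube_integral (\<lambda>p. herm h2 (\<lambda>m. dbar2 f m p) (\<lambda>n. d n p)) = cube_integral (\<lambda>p. herm h1 (\<lambda>i. f i p) (\<lambda>j. q j p))"
    if f: "\<And>i. quotient_function (f i)" for f
  proof (rule cube_integral_eqI)
    show "quotient_function (\<lambda>p. herm h2 (\<lambda>m. dbar2 f m p) (\<lambda>n. d n p))"
      by (intro quotient_function_herm quotient_function_dbar2 f d)
    show "quotient_function (\<lambda>p. herm h1 (\<lambda>i. f i p) (\<lambda>j. q j p))"
      by (intro quotient_function_herm f q)
    define T where "T = (\<lambda>i f k p. vbar i f p * cnj (k p) + f p * cnj (vhol i k p))"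
    have T: "quotient_function (T i f k)" "cube_integral (T i f k) = 0"
      if "quotient_function f" "quotient_function k" for i f k
      using cube_integral_vbar_product[OF that]
      by (auto simp: T_def intro!: quotient_function_intros quotient_function_vbar quotient_function_vhol that)
    have 1: "herm h2 x (\<lambda>n. d n p) = (\<Sum>m\<in>UNIV. x m * cnj (e m p))" for x p
      by (simp add: herm_def e_def sum_distrib_left mult_ac)
    have 2: "herm h1 x (\<lambda>j. q j p) = (\<Sum>i\<in>UNIV. x i * cnj (r i p))" for x p
    proof -
      have "herm h1 x (\<lambda>j. q j p) = (\<Sum>i\<in>UNIV. x i * cnj (\<Sum>j\<in>UNIV. cnj (h1 i j) * q j p))"
        by (simp add: herm_def sum_distrib_left mult_ac)
      then show ?thesis by (simp only: q_def N)
    qed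
    have "cube_integral (\<lambda>p. herm h2 (\<lambda>m. dbar2 f m p) (\<lambda>n. d n p) - herm h1 (\<lambda>i. f i p) (\<lambda>j. q j p)) =
        cube_integral (\<lambda>p. (T I1 (f I2) (e I1) p - T I2 (f I1) (e I1) p) + ((T I1 (f I3) (e I2) p - T I3 (f I1) (e I2) p)
          + (T I2 (f I3) (e I3) p - T I3 (f I2) (e I3) p)))"
      unfolding 1 2
      by (rule arg_cong[where f = cube_integral]) (simp add: sum_idx dbar2_def r_def T_def algebra_simps)
    also have "\<dots> = 0"
      by (subst integral_add integral_diff;
          (intro quotient_function_integrable quotient_function_add quotient_function_diff T f e)?)+
        (simp add: T f e)
    finally show "cube_integral (\<lambda>p. herm h2 (\<lambda>m. dbar2 f m p) (\<lambda>n. d n p) - herm h1 (\<lambda>i. f i p) (\<lambda>j. q j p)) = 0" .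
  qed
  then show ?thesis using that q by blast
qed

lemma pb_sum: "pb i p (\<Sum>k\<in>K. x k *s v k) = (\<Sum>k\<in>K. x k * pb i p (v k))"
proof -
  have "pb i p 0 = 0" using pb_scale[of i p 0 0] by simp
  then show ?thesis by (induction K rule: infinite_finite_induct) (simp_all add: pb_add pb_scale)
qed

lemma pb_cframe: "pb i p (cframe k p) = pb i 0 (cframe k 0)"
  by (cases i; cases k) (simp_all add: pb_def cframe_nth)

end

text \<open>The metric enters from here on only through a left-invariant orthonormal frame with
  coefficients \<open>B\<close> and the constant volume density \<open>w\<close>.\<close>

locale kt6_metric = kt6_structure +
  fixes g :: "point \<Rightarrow> point \<Rightarrow> point \<Rightarrow> real" and B :: "coord \<Rightarrow> coord \<Rightarrow> real" and w :: real
  assumes inverse_gram: "\<And>p i j. matrix_inv (gram g p) $ i $ j =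
      (\<Sum>m\<in>UNIV. frame_combination B m p $ i * frame_combination B m p $ j)"
    and invertible_gram: "\<And>p. invertible (gram g p)"
    and w: "w \<noteq> 0" and volume: "\<And>p. sqrt (det (gram g p)) = w"
begin

definition E :: "coord \<Rightarrow> point \<Rightarrow> cvec" where
  "E m p = of_real_vec (frame_combination B m p)"

text \<open>The inverse Gram matrix is the sum of the squares of the vectors \<open>E m p\<close>,
  so a covector that vanishes on all of them lies in its kernel, which is zero.\<close>

lemma E_span:
  assumes "\<And>m. (\<Sum>k\<in>UNIV. E m p $ k * x k) = 0"
  shows "x l = 0"
proof -
  have GI: "gram g p ** matrix_inv (gram g p) = mat 1"
    using invertible_gram[of p] matrix_inv_eqI unfolding invertible_def by metis
  have "(\<Sum>k\<in>UNIV. complex_of_real (matrix_inv (gram g p) $ i $ k) * x k) = 0" for i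
  proof -
    have "(\<Sum>k\<in>UNIV. complex_of_real (matrix_inv (gram g p) $ i $ k) * x k) =
        (\<Sum>k\<in>UNIV. \<Sum>m\<in>UNIV. E m p $ i * (E m p $ k * x k))"
      by (simp add: inverse_gram E_def of_real_vec_def sum_distrib_right mult.assoc)
    also have "\<dots> = (\<Sum>m\<in>UNIV. E m p $ i * (\<Sum>k\<in>UNIV. E m p $ k * x k))"
      by (subst sum.swap) (simp add: sum_distrib_left)
    finally show ?thesis by (simp add: assms)
  qed
  then have "0 = (\<Sum>i\<in>UNIV. complex_of_real (gram g p $ l $ i) *
      (\<Sum>k\<in>UNIV. complex_of_real (matrix_inv (gram g p) $ i $ k) * x k))"
    by simp
  also have "\<dots> = (\<Sum>k\<in>UNIV. \<Sum>i\<in>UNIV. complex_of_real (gram g p $ l $ i) *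
      (complex_of_real (matrix_inv (gram g p) $ i $ k) * x k))"
    by (subst sum.swap) (simp add: sum_distrib_left)
  also have "\<dots> = (\<Sum>k\<in>UNIV. complex_of_real ((gram g p ** matrix_inv (gram g p)) $ l $ k) * x k)"
    by (simp add: matrix_matrix_mult_def sum_distrib_right mult.assoc)
  also have "\<dots> = (\<Sum>k\<in>UNIV. if l = k then x k else 0)"
    unfolding GI mat_def by (intro sum.cong) auto
  finally show ?thesis by simp
qed

lemma gram_sum:
  "(\<Sum>i\<in>UNIV. \<Sum>k\<in>UNIV. complex_of_real (matrix_inv (gram g p) $ i $ k) * (x i * cnj (y k))) =
    (\<Sum>m\<in>UNIV. (\<Sum>i\<in>UNIV. E m p $ i * x i) * cnj (\<Sum>k\<in>UNIV. E m p $ k * y k))"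
proof -
  have "(\<Sum>i\<in>UNIV. \<Sum>k\<in>UNIV. complex_of_real (matrix_inv (gram g p) $ i $ k) * (x i * cnj (y k))) =
      (\<Sum>i\<in>UNIV. \<Sum>k\<in>UNIV. \<Sum>m\<in>UNIV. (E m p $ i * x i) * cnj (E m p $ k * y k))"
    by (simp add: inverse_gram E_def of_real_vec_def sum_distrib_right sum_distrib_left mult_ac)
  also have "\<dots> = (\<Sum>i\<in>UNIV. \<Sum>m\<in>UNIV. \<Sum>k\<in>UNIV. (E m p $ i * x i) * cnj (E m p $ k * y k))"
    by (intro sum.cong refl sum.swap)
  also have "\<dots> = (\<Sum>m\<in>UNIV. \<Sum>i\<in>UNIV. \<Sum>k\<in>UNIV. (E m p $ i * x i) * cnj (E m p $ k * y k))"
    by (rule sum.swap)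
  finally show ?thesis by (simp add: sum_product)
qed

text \<open>The value of the conjugate of phi_i on the \<open>m\<close>-th orthonormal vector. It is
  evaluated at the origin because coframe and frame are both invariant, so it is the same at every
  point (\<open>pb_E\<close>).\<close>

definition eps :: "idx \<Rightarrow> coord \<Rightarrow> complex" where
  "eps i m = (\<Sum>k\<in>UNIV. of_real (B m k) * pb i 0 (cframe k 0))"

lemma pb_E: "pb i p (E m p) = eps i m"
proof -
  have "E m p = (\<Sum>k\<in>UNIV. of_real (B m k) *s cframe k p)"
    by (simp add: vec_eq_iff E_def of_real_vec_def frame_combination_def cframe_def)
  then show ?thesis by (simp add: pb_sum pb_cframe[of i p] eps_def)
qed

lemma pb_E_axis: "(\<Sum>k\<in>UNIV. E m p $ k * pb i p (axis k 1)) = eps i m"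
  using pb_sum[of i p "\<lambda>k. E m p $ k" "\<lambda>k. axis k 1" UNIV] by (simp add: basis_expansion pb_E)

definition eps2 :: "idx \<Rightarrow> coord \<times> coord \<Rightarrow> complex" where
  "eps2 r mn = pair_wedge r 0 (E (fst mn) 0) (E (snd mn) 0)"

lemma wedge_E: "wedge i j p (E m p) (E n p) = eps i m * eps j n - eps i n * eps j m"
  by (simp add: wedge_def pb_E)

lemma pair_wedge_E: "pair_wedge r p (E m p) (E n p) = eps2 r (m, n)"
  by (cases r) (simp_all add: pair_wedge_def eps2_def wedge_E)

lemma wedge_E_axis:
  "(\<Sum>l\<in>UNIV. E n p $ l * (\<Sum>k\<in>UNIV. E m p $ k * wedge i j p (axis k 1) (axis l 1))) = wedge i j p (E m p) (E n p)"
proof -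
  have "(\<Sum>k\<in>UNIV. E m p $ k * wedge i j p (axis k 1) v) = eps i m * pb j p v - pb i p v * eps j m" for v
    unfolding pb_E_axis[of m p, symmetric]
    by (simp add: wedge_def right_diff_distrib sum_subtractf sum_distrib_right sum_distrib_left mult_ac)
  then have "(\<Sum>l\<in>UNIV. E n p $ l * (\<Sum>k\<in>UNIV. E m p $ k * wedge i j p (axis k 1) (axis l 1))) =
      (\<Sum>l\<in>UNIV. E n p $ l * (eps i m * pb j p (axis l 1) - pb i p (axis l 1) * eps j m))"
    by simp
  also have "\<dots> = eps i m * (\<Sum>l\<in>UNIV. E n p $ l * pb j p (axis l 1)) - (\<Sum>l\<in>UNIV. E n p $ l * pb i p (axis l 1)) * eps j m"
    by (simp add: right_diff_distrib sum_subtractf sum_distrib_right sum_distrib_left mult_ac)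
  finally show ?thesis by (simp add: pb_E_axis wedge_E)
qed

lemma pair_wedge_E_axis:
  "(\<Sum>l\<in>UNIV. E n p $ l * (\<Sum>k\<in>UNIV. E m p $ k * pair_wedge r p (axis k 1) (axis l 1))) = eps2 r (m, n)"
  unfolding pair_wedge_E[of r p m n, symmetric] by (cases r) (simp_all add: pair_wedge_def wedge_E_axis)

definition h1 :: "idx \<Rightarrow> idx \<Rightarrow> complex" where
  "h1 i j = (\<Sum>m\<in>UNIV. eps i m * cnj (eps j m))"

text \<open>The sum runs over ordered pairs and so counts each unordered pair twice; the inner
  product of 2-covectors is half of this, the factor being \<open>1 / 2!\<close>.\<close>

definition h2 :: "idx \<Rightarrow> idx \<Rightarrow> complex" where
  "h2 r s = (\<Sum>mn\<in>UNIV. eps2 r mn * cnj (eps2 s mn))"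

text \<open>Definiteness says that a combination of the coframe that vanishes on the orthonormal
  vectors is trivial: these vectors span, and the dual frame reads off its coefficients.\<close>

lemma positive_hermitian_h1: "positive_hermitian h1"
  unfolding h1_def[abs_def]
proof (rule positive_hermitian_gram)
  fix x i assume 0: "\<And>m. (\<Sum>i\<in>UNIV. x i * eps i m) = 0"
  have axis: "(\<Sum>i\<in>UNIV. x i * pb i 0 (axis k 1)) = 0" for k
  proof (rule E_span[of 0])
    fix m
    have "(\<Sum>k\<in>UNIV. E m 0 $ k * (\<Sum>i\<in>UNIV. x i * pb i 0 (axis k 1))) =
        (\<Sum>k\<in>UNIV. \<Sum>i\<in>UNIV. x i * (E m 0 $ k * pb i 0 (axis k 1)))"
      by (simp add: sum_distrib_left mult.left_commute)
    also have "\<dots> = (\<Sum>i\<in>UNIV. x i * (\<Sum>k\<in>UNIV. E m 0 $ k * pb i 0 (axis k 1)))"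
      by (subst sum.swap) (simp add: sum_distrib_left)
    finally show "(\<Sum>k\<in>UNIV. E m 0 $ k * (\<Sum>i\<in>UNIV. x i * pb i 0 (axis k 1))) = 0"
      by (simp add: pb_E_axis 0)
  qed
  have all: "(\<Sum>i\<in>UNIV. x i * pb i 0 v) = 0" for v
  proof -
    have "(\<Sum>i\<in>UNIV. x i * pb i 0 v) = (\<Sum>i\<in>UNIV. \<Sum>k\<in>UNIV. v $ k * (x i * pb i 0 (axis k 1)))"
      using pb_sum[of _ 0 "\<lambda>k. v $ k" "\<lambda>k. axis k 1" UNIV]
      by (simp add: basis_expansion sum_distrib_left mult.left_commute)
    also have "\<dots> = (\<Sum>k\<in>UNIV. v $ k * (\<Sum>i\<in>UNIV. x i * pb i 0 (axis k 1)))"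
      by (subst sum.swap) (simp add: sum_distrib_left)
    finally show ?thesis by (simp add: axis)
  qed
  show "x i = 0"
    using all[of "vb_vec i 0"] by (cases i) (simp_all add: pb_dual sum_idx)
qed

text \<open>The spanning argument is applied in each of the two slots, and the pairs of dual vectors
  then read off the coefficients.\<close>

lemma positive_hermitian_h2: "positive_hermitian h2"
  unfolding h2_def[abs_def]
proof (rule positive_hermitian_gram)
  fix x i assume 0: "\<And>mn. (\<Sum>r\<in>UNIV. x r * eps2 r mn) = 0"
  define L where "L = (\<lambda>u v. \<Sum>r\<in>UNIV. x r * pair_wedge r 0 u v)"
  have axis: "L (axis k 1) (axis l 1) = 0" for k l
  proof (rule E_span[of 0 "\<lambda>k. L (axis k 1) (axis l 1)"])
    fix m
    show "(\<Sum>k\<in>UNIV. E m 0 $ k * L (axis k 1) (axis l 1)) = 0"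
    proof (rule E_span[of 0 "\<lambda>l. \<Sum>k\<in>UNIV. E m 0 $ k * L (axis k 1) (axis l 1)"])
      fix n
      have "(\<Sum>l\<in>UNIV. E n 0 $ l * (\<Sum>k\<in>UNIV. E m 0 $ k * L (axis k 1) (axis l 1))) =
          (\<Sum>l\<in>UNIV. \<Sum>k\<in>UNIV. \<Sum>r\<in>UNIV. x r * (E n 0 $ l * (E m 0 $ k * pair_wedge r 0 (axis k 1) (axis l 1))))"
        by (simp add: L_def sum_distrib_left mult.left_commute)
      also have "\<dots> = (\<Sum>l\<in>UNIV. \<Sum>r\<in>UNIV. \<Sum>k\<in>UNIV. x r * (E n 0 $ l * (E m 0 $ k * pair_wedge r 0 (axis k 1) (axis l 1))))"
        by (intro sum.cong refl sum.swap)
      also have "\<dots> = (\<Sum>r\<in>UNIV. \<Sum>l\<in>UNIV. \<Sum>k\<in>UNIV. x r * (E n 0 $ l * (E m 0 $ k * pair_wedge r 0 (axis k 1) (axis l 1))))"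
        by (rule sum.swap)
      also have "\<dots> = (\<Sum>r\<in>UNIV. x r * eps2 r (m, n))"
        by (simp add: pair_wedge_E_axis[of n 0 m, symmetric] sum_distrib_left)
      finally show "(\<Sum>l\<in>UNIV. E n 0 $ l * (\<Sum>k\<in>UNIV. E m 0 $ k * L (axis k 1) (axis l 1))) = 0"
        by (simp add: 0)
    qed
  qed
  have wl: "wedge i j 0 (\<Sum>k\<in>UNIV. y k *s axis k 1) v = (\<Sum>k\<in>UNIV. y k * wedge i j 0 (axis k 1) v)"
    "wedge i j 0 v (\<Sum>k\<in>UNIV. y k *s axis k 1) = (\<Sum>k\<in>UNIV. y k * wedge i j 0 v (axis k 1))" for i j y v
    by (simp_all add: wedge_def pb_sum right_diff_distrib sum_subtractf sum_distrib_right sum_distrib_left mult_ac)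
  have pl: "pair_wedge r 0 u v = (\<Sum>k\<in>UNIV. u $ k * pair_wedge r 0 (axis k 1) v)"
    "pair_wedge r 0 u v = (\<Sum>k\<in>UNIV. v $ k * pair_wedge r 0 u (axis k 1))" for r u v
    using wl(1)[of _ _ "\<lambda>k. u $ k" v] wl(2)[of _ _ u "\<lambda>k. v $ k"]
    by (cases r; simp add: pair_wedge_def basis_expansion)+
  have L1: "L u v = (\<Sum>k\<in>UNIV. u $ k * L (axis k 1) v)" "L u v = (\<Sum>k\<in>UNIV. v $ k * L u (axis k 1))" for u v
  proof -
    have "L u v = (\<Sum>r\<in>UNIV. \<Sum>k\<in>UNIV. u $ k * (x r * pair_wedge r 0 (axis k 1) v))"
      unfolding L_def by (subst pl(1)) (simp add: sum_distrib_left mult.left_commute)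
    also have "\<dots> = (\<Sum>k\<in>UNIV. u $ k * L (axis k 1) v)"
      unfolding L_def by (subst sum.swap) (simp add: sum_distrib_left)
    finally show "L u v = (\<Sum>k\<in>UNIV. u $ k * L (axis k 1) v)" .
    have "L u v = (\<Sum>r\<in>UNIV. \<Sum>k\<in>UNIV. v $ k * (x r * pair_wedge r 0 u (axis k 1)))"
      unfolding L_def by (subst pl(2)) (simp add: sum_distrib_left mult.left_commute)
    also have "\<dots> = (\<Sum>k\<in>UNIV. v $ k * L u (axis k 1))"
      unfolding L_def by (subst sum.swap) (simp add: sum_distrib_left)
    finally show "L u v = (\<Sum>k\<in>UNIV. v $ k * L u (axis k 1))" .
  qed
  have "L (axis k 1) v = 0" for k v by (subst L1(2)) (simp add: axis)
  then have all: "L u v = 0" for u v by (subst L1(1)) simp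
  show "x i = 0"
    using all[of "vb_vec I1 0" "vb_vec I2 0"] all[of "vb_vec I1 0" "vb_vec I3 0"] all[of "vb_vec I2 0" "vb_vec I3 0"]
    by (cases i) (simp_all add: L_def pair_wedge_dual sum_idx)
qed

section \<open>Inner products of forms in terms of coefficients\<close>

lemma covector_inner_0: "covector_inner g p 0 (fform u p) (fform v p) = u p * cnj (v p)"
  by (simp add: covector_inner_def fform_def)

lemma covector_inner_1: "covector_inner g p 1 (sform f p) (sform k p) = herm h1 (\<lambda>i. f i p) (\<lambda>j. k j p)"
proof -
  have *: "(\<Sum>k\<in>UNIV. E m p $ k * (\<Sum>i\<in>UNIV. f i p * pb i p (axis k 1))) = (\<Sum>i\<in>UNIV. f i p * eps i m)" for m f
  proof -
    have "(\<Sum>k\<in>UNIV. E m p $ k * (\<Sum>i\<in>UNIV. f i p * pb i p (axis k 1))) =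
        (\<Sum>k\<in>UNIV. \<Sum>i\<in>UNIV. f i p * (E m p $ k * pb i p (axis k 1)))"
      by (simp add: sum_distrib_left mult.left_commute)
    also have "\<dots> = (\<Sum>i\<in>UNIV. f i p * (\<Sum>k\<in>UNIV. E m p $ k * pb i p (axis k 1)))"
      by (subst sum.swap) (simp add: sum_distrib_left)
    finally show ?thesis by (simp add: pb_E_axis)
  qed
  have "covector_inner g p 1 (sform f p) (sform k p) = (\<Sum>i\<in>UNIV. \<Sum>l\<in>UNIV.
      complex_of_real (matrix_inv (gram g p) $ i $ l) * (sform f p [axis i 1] * cnj (sform k p [axis l 1])))"
    by (simp add: covector_inner_def sum_lists_1 mult.assoc)
  also have "\<dots> = (\<Sum>m\<in>UNIV. (\<Sum>i\<in>UNIV. f i p * eps i m) * cnj (\<Sum>j\<in>UNIV. k j p * eps j m))"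
    unfolding gram_sum sform_singleton * ..
  finally show ?thesis unfolding h1_def[abs_def] herm_gram .
qed

lemma covector_inner_2:
  "covector_inner g p 2 (tform d p) (tform k p) = (1 / 2) * herm h2 (\<lambda>r. d r p) (\<lambda>s. k s p)"
proof -
  define A where "A = (\<lambda>d i j. tform d p [axis i 1, axis j 1])"
  define T where "T = (\<lambda>i j m n. complex_of_real (matrix_inv (gram g p) $ i $ m) *
      (complex_of_real (matrix_inv (gram g p) $ j $ n) * (A d i j * cnj (A k m n))))"
  have prod2: "(\<Prod>m<2. F m) = F 0 * F 1" for F :: "nat \<Rightarrow> real"
    by (simp add: numeral_2_eq_2)
  have *: "(\<Sum>l\<in>UNIV. E n p $ l * (\<Sum>i\<in>UNIV. E m p $ i * A d i l)) = (\<Sum>r\<in>UNIV. d r p * eps2 r (m, n))" for m n d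
  proof -
    have "(\<Sum>l\<in>UNIV. E n p $ l * (\<Sum>i\<in>UNIV. E m p $ i * A d i l)) =
        (\<Sum>l\<in>UNIV. \<Sum>i\<in>UNIV. \<Sum>r\<in>UNIV. d r p * (E n p $ l * (E m p $ i * pair_wedge r p (axis i 1) (axis l 1))))"
      by (simp add: A_def tform_def sum_distrib_left mult.left_commute)
    also have "\<dots> = (\<Sum>l\<in>UNIV. \<Sum>r\<in>UNIV. \<Sum>i\<in>UNIV. d r p * (E n p $ l * (E m p $ i * pair_wedge r p (axis i 1) (axis l 1))))"
      by (intro sum.cong refl sum.swap)
    also have "\<dots> = (\<Sum>r\<in>UNIV. \<Sum>l\<in>UNIV. \<Sum>i\<in>UNIV. d r p * (E n p $ l * (E m p $ i * pair_wedge r p (axis i 1) (axis l 1))))"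
      by (rule sum.swap)
    also have "\<dots> = (\<Sum>r\<in>UNIV. d r p * eps2 r (m, n))"
      by (simp add: pair_wedge_E_axis[of n p m, symmetric] sum_distrib_left)
    finally show ?thesis .
  qed
  have "covector_inner g p 2 (tform d p) (tform k p) = (1 / 2) * (\<Sum>i\<in>UNIV. \<Sum>j\<in>UNIV. \<Sum>m\<in>UNIV. \<Sum>n\<in>UNIV. T i j m n)"
    by (simp add: covector_inner_def sum_lists_2 T_def A_def prod2 fact_2 mult_ac)
  \<comment> \<open>The summations are reordered to bring the two indices of one inverse Gram matrix
    together, so that \<open>gram_sum\<close> can be applied once to each tensor slot.\<close>
  also have "(\<Sum>i\<in>UNIV. \<Sum>j\<in>UNIV. \<Sum>m\<in>UNIV. \<Sum>n\<in>UNIV. T i j m n) = (\<Sum>j\<in>UNIV. \<Sum>i\<in>UNIV. \<Sum>n\<in>UNIV. \<Sum>m\<in>UNIV. T i j m n)"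
    by (subst sum.swap) (intro sum.cong refl sum.swap)
  also have "\<dots> = (\<Sum>j\<in>UNIV. \<Sum>n\<in>UNIV. \<Sum>i\<in>UNIV. \<Sum>m\<in>UNIV. T i j m n)"
    by (intro sum.cong refl sum.swap)
  also have "\<dots> = (\<Sum>j\<in>UNIV. \<Sum>n\<in>UNIV. \<Sum>m\<in>UNIV. complex_of_real (matrix_inv (gram g p) $ j $ n) *
      ((\<Sum>i\<in>UNIV. E m p $ i * A d i j) * cnj (\<Sum>i\<in>UNIV. E m p $ i * A k i n)))"
  proof (rule sum.cong[OF refl], rule sum.cong[OF refl])
    fix j n
    have "(\<Sum>i\<in>UNIV. \<Sum>m\<in>UNIV. T i j m n) = complex_of_real (matrix_inv (gram g p) $ j $ n) *
        (\<Sum>i\<in>UNIV. \<Sum>m\<in>UNIV. complex_of_real (matrix_inv (gram g p) $ i $ m) * (A d i j * cnj (A k m n)))"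
      by (simp add: T_def sum_distrib_left mult.left_commute)
    then show "(\<Sum>i\<in>UNIV. \<Sum>m\<in>UNIV. T i j m n) = (\<Sum>m\<in>UNIV. complex_of_real (matrix_inv (gram g p) $ j $ n) *
        ((\<Sum>i\<in>UNIV. E m p $ i * A d i j) * cnj (\<Sum>i\<in>UNIV. E m p $ i * A k i n)))"
      unfolding gram_sum by (simp only: sum_distrib_left)
  qed
  also have "\<dots> = (\<Sum>j\<in>UNIV. \<Sum>m\<in>UNIV. \<Sum>n\<in>UNIV. complex_of_real (matrix_inv (gram g p) $ j $ n) *
      ((\<Sum>i\<in>UNIV. E m p $ i * A d i j) * cnj (\<Sum>i\<in>UNIV. E m p $ i * A k i n)))"
    by (intro sum.cong refl sum.swap)
  also have "\<dots> = (\<Sum>m\<in>UNIV. \<Sum>j\<in>UNIV. \<Sum>n\<in>UNIV. complex_of_real (matrix_inv (gram g p) $ j $ n) *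
      ((\<Sum>i\<in>UNIV. E m p $ i * A d i j) * cnj (\<Sum>i\<in>UNIV. E m p $ i * A k i n)))"
    by (rule sum.swap)
  also have "\<dots> = (\<Sum>m\<in>UNIV. \<Sum>n\<in>UNIV. (\<Sum>r\<in>UNIV. d r p * eps2 r (m, n)) * cnj (\<Sum>s\<in>UNIV. k s p * eps2 s (m, n)))"
    unfolding gram_sum * ..
  also have "\<dots> = (\<Sum>mn\<in>UNIV. (\<Sum>r\<in>UNIV. d r p * eps2 r mn) * cnj (\<Sum>s\<in>UNIV. k s p * eps2 s mn))"
    unfolding UNIV_Times_UNIV[symmetric] sum.cartesian_product by (simp add: split_beta)
  also have "\<dots> = herm h2 (\<lambda>r. d r p) (\<lambda>s. k s p)"
    unfolding h2_def[abs_def] herm_gram ..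
  finally show ?thesis .
qed

lemma l2_inner_0: "l2_inner g 0 (fform u) (fform v) = of_real w * cube_integral (\<lambda>p. u p * cnj (v p))"
  by (simp add: l2_inner_def covector_inner_0 volume mult.commute)

lemma l2_inner_1: "l2_inner g 1 (sform f) (sform k) = of_real w * cube_integral (\<lambda>p. herm h1 (\<lambda>i. f i p) (\<lambda>j. k j p))"
  unfolding l2_inner_def covector_inner_1 volume by (simp add: mult.commute)

lemma l2_inner_2:
  "l2_inner g 2 (tform d) (tform k) = of_real w * (1 / 2 * cube_integral (\<lambda>p. herm h2 (\<lambda>i. d i p) (\<lambda>j. k j p)))"
  unfolding l2_inner_def covector_inner_2 volume by (simp add: mult.commute)

section \<open>Formal adjoints and the harmonic equation\<close>

lemma dbar_star_sform:
  assumes f: "\<And>i. quotient_function (f i)"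
  shows "dbar_star g J 0 1 (sform f) = fform (codiff h1 f)"
proof -
  have "(THE \<alpha>. \<alpha> \<in> pq_forms J 0 0 \<and>
      (\<forall>\<eta>\<in>pq_forms J 0 0. l2_inner g (0 + 1) (dbar J 0 0 \<eta>) (sform f) = l2_inner g (0 + 0) \<eta> \<alpha>)) = fform (codiff h1 f)"
  proof (rule the_equality)
    have adj: "l2_inner g 1 (dbar J 0 0 (fform u)) (sform f) = l2_inner g 0 (fform u) (fform (codiff h1 f))"
      if "quotient_function u" for u
      unfolding dbar_fform[OF quotient_function_smooth[OF that]] l2_inner_0 l2_inner_1
        codiff_adjoint[of u f h1, OF that f] ..
    show "fform (codiff h1 f) \<in> pq_forms J 0 0 \<and> (\<forall>\<eta>\<in>pq_forms J 0 0.
        l2_inner g (0 + 1) (dbar J 0 0 \<eta>) (sform f) = l2_inner g (0 + 0) \<eta> (fform (codiff h1 f)))"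
    proof (intro conjI ballI)
      show "fform (codiff h1 f) \<in> pq_forms J 0 0"
        by (intro fform_in_pq_forms quotient_function_codiff f)
      fix \<eta> assume "\<eta> \<in> pq_forms J 0 0"
      then obtain u where "quotient_function u" "\<eta> = fform u" using pq_forms_00 by blast
      then show "l2_inner g (0 + 1) (dbar J 0 0 \<eta>) (sform f) = l2_inner g (0 + 0) \<eta> (fform (codiff h1 f))"
        by (simp only: adj add_0)
    qed
    fix \<alpha> assume \<alpha>: "\<alpha> \<in> pq_forms J 0 0 \<and> (\<forall>\<eta>\<in>pq_forms J 0 0.
        l2_inner g (0 + 1) (dbar J 0 0 \<eta>) (sform f) = l2_inner g (0 + 0) \<eta> \<alpha>)"
    then obtain v where v: "quotient_function v" "\<alpha> = fform v" using pq_forms_00 by blast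
    \<comment> \<open>Uniqueness of the adjoint: the difference of two candidates is itself a test
      function, so its norm is 0.\<close>
    define u where "u = (\<lambda>p. v p - codiff h1 f p)"
    have u: "quotient_function u"
      unfolding u_def by (intro quotient_function_diff v quotient_function_codiff f)
    have "l2_inner g 0 (fform u) (fform v) = l2_inner g 0 (fform u) (fform (codiff h1 f))"
      using bspec[OF conjunct2[OF \<alpha>] fform_in_pq_forms[OF u]] adj[OF u] v(2) by (simp only: add_0)
    then have "cube_integral (\<lambda>p. u p * cnj (v p)) = cube_integral (\<lambda>p. u p * cnj (codiff h1 f p))"
      using w by (simp add: l2_inner_0)
    then have "cube_integral (\<lambda>p. u p * cnj (v p) - u p * cnj (codiff h1 f p)) = 0"
      by (subst integral_diff)
        (auto intro!: quotient_function_integrable quotient_function_intros quotient_function_codiff u v f)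
    then have "u p = 0" for p
      by (intro quotient_function_l2_zero[OF u]) (simp add: u_def algebra_simps)
    then have "v = codiff h1 f" by (auto simp: u_def fun_eq_iff)
    then show "\<alpha> = fform (codiff h1 f)" using v by simp
  qed
  then show ?thesis by (simp add: dbar_star_def)
qed

lemma dbar_star_tform:
  assumes d: "\<And>i. quotient_function (d i)"
  obtains q where "\<And>i. quotient_function (q i)" "dbar_star g J 0 2 (tform d) = sform q"
    "\<And>f. (\<And>i. quotient_function (f i)) \<Longrightarrow>
      1 / 2 * cube_integral (\<lambda>p. herm h2 (\<lambda>m. dbar2 f m p) (\<lambda>n. d n p)) = cube_integral (\<lambda>p. herm h1 (\<lambda>i. f i p) (\<lambda>j. q j p))"
proof -
  \<comment> \<open>The factor 1/2 from the inner product of 2-covectors is absorbed into the data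
    before the adjoint is taken.\<close>
  have d': "quotient_function (\<lambda>p. (1 / 2) * d i p)" for i by (intro quotient_function_intros d)
  obtain q where q: "\<And>i. quotient_function (q i)"
    "\<And>f. (\<And>i. quotient_function (f i)) \<Longrightarrow>
      cube_integral (\<lambda>p. herm h2 (\<lambda>m. dbar2 f m p) (\<lambda>n. (1 / 2) * d n p)) = cube_integral (\<lambda>p. herm h1 (\<lambda>i. f i p) (\<lambda>j. q j p))"
    using dbar2_adjoint[OF positive_hermitian_h1, of "\<lambda>i p. (1 / 2) * d i p"] d' by blast
  have half: "herm h2 x (\<lambda>n. (1 / 2) * y n) = 1 / 2 * herm h2 x y" for x y
    by (simp add: herm_def sum_divide_distrib)
  have pairing: "1 / 2 * cube_integral (\<lambda>p. herm h2 (\<lambda>m. dbar2 f m p) (\<lambda>n. d n p)) = cube_integral (\<lambda>p. herm h1 (\<lambda>i. f i p) (\<lambda>j. q j p))"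
    if "\<And>i. quotient_function (f i)" for f
    using q(2)[OF that] unfolding half by simp
  have "(THE \<alpha>. \<alpha> \<in> pq_forms J 0 1 \<and>
      (\<forall>\<eta>\<in>pq_forms J 0 1. l2_inner g (0 + 2) (dbar J 0 1 \<eta>) (tform d) = l2_inner g (0 + 1) \<eta> \<alpha>)) = sform q"
  proof (rule the_equality)
    have adj: "l2_inner g 2 (dbar J 0 1 (sform f)) (tform d) = l2_inner g 1 (sform f) (sform q)"
      if f: "\<And>i. quotient_function (f i)" for f
      unfolding dbar_sform[OF quotient_function_smooth[OF f]] l2_inner_2 l2_inner_1 pairing[OF f] ..
    show "sform q \<in> pq_forms J 0 1 \<and> (\<forall>\<eta>\<in>pq_forms J 0 1.
        l2_inner g (0 + 2) (dbar J 0 1 \<eta>) (tform d) = l2_inner g (0 + 1) \<eta> (sform q))"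
    proof (intro conjI ballI)
      show "sform q \<in> pq_forms J 0 1" by (rule sform_in_pq_forms[OF q(1)])
      fix \<eta> assume "\<eta> \<in> pq_forms J 0 1"
      then obtain f where "\<And>i. quotient_function (f i)" "\<eta> = sform f" using pq_forms_01 by blast
      then show "l2_inner g (0 + 2) (dbar J 0 1 \<eta>) (tform d) = l2_inner g (0 + 1) \<eta> (sform q)"
        by (simp only: adj add_0)
    qed
    fix \<alpha> assume \<alpha>: "\<alpha> \<in> pq_forms J 0 1 \<and> (\<forall>\<eta>\<in>pq_forms J 0 1.
        l2_inner g (0 + 2) (dbar J 0 1 \<eta>) (tform d) = l2_inner g (0 + 1) \<eta> \<alpha>)"
    then obtain v where v: "\<And>i. quotient_function (v i)" "\<alpha> = sform v" using pq_forms_01 by blast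
    define u where "u = (\<lambda>i p. v i p - q i p)"
    have u: "quotient_function (u i)" for i
      unfolding u_def by (intro quotient_function_diff v q)
    have "l2_inner g 1 (sform u) (sform v) = l2_inner g 1 (sform u) (sform q)"
      using bspec[OF conjunct2[OF \<alpha>] sform_in_pq_forms[OF u]] adj[OF u] v(2) by (simp only: add_0)
    then have "cube_integral (\<lambda>p. herm h1 (\<lambda>i. u i p) (\<lambda>j. v j p)) = cube_integral (\<lambda>p. herm h1 (\<lambda>i. u i p) (\<lambda>j. q j p))"
      using w unfolding l2_inner_1 by simp
    then have "cube_integral (\<lambda>p. herm h1 (\<lambda>i. u i p) (\<lambda>j. v j p) - herm h1 (\<lambda>i. u i p) (\<lambda>j. q j p)) = 0"
      by (subst integral_diff) (auto intro!: quotient_function_integrable quotient_function_herm u v q)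
    then have "cube_integral (\<lambda>p. herm h1 (\<lambda>i. u i p) (\<lambda>i. u i p)) = 0"
      by (simp only: u_def herm_diff_right)
    then have "u i p = 0" for i p by (rule pairing_definite[OF positive_hermitian_h1 u])
    then have "v = q" by (auto simp: u_def fun_eq_iff)
    then show "\<alpha> = sform q" using v by simp
  qed
  then have "dbar_star g J 0 2 (tform d) = sform q" by (simp add: dbar_star_def numeral_2_eq_2)
  then show ?thesis using that q(1) pairing by blast
qed

theorem harmonic_iff_constant:
  assumes f: "\<And>i. quotient_function (f i)"
  shows "sform f \<in> harmonic_forms g J 0 1 \<longleftrightarrow> (\<forall>i p q. f i p = f i q) \<and> (\<forall>p. curvature * f I3 p = 0)"
proof -
  note sf = quotient_function_smooth[OF f]
  define u where "u = codiff h1 f"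
  have u: "quotient_function u" unfolding u_def by (rule quotient_function_codiff[OF f])
  define d where "d = dbar2 f"
  have d: "quotient_function (d m)" for m unfolding d_def by (rule quotient_function_dbar2[OF f])
  obtain q where q: "\<And>i. quotient_function (q i)" "dbar_star g J 0 2 (tform d) = sform q"
    and adj: "\<And>f. (\<And>i. quotient_function (f i)) \<Longrightarrow>
      1 / 2 * cube_integral (\<lambda>p. herm h2 (\<lambda>m. dbar2 f m p) (\<lambda>n. d n p)) = cube_integral (\<lambda>p. herm h1 (\<lambda>i. f i p) (\<lambda>j. q j p))"
    by (rule dbar_star_tform[of d, OF d]) blast
  have "dolbeault_laplacian g J 0 1 (sform f) = dbar J 0 0 (dbar_star g J 0 1 (sform f)) + dbar_star g J 0 2 (dbar J 0 1 (sform f))"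
    by (simp add: dolbeault_laplacian_def numeral_2_eq_2)
  also have "\<dots> = sform (\<lambda>i p. vbar i u p + q i p)"
    by (simp only: dbar_star_sform[OF f] u_def[symmetric] dbar_fform[OF quotient_function_smooth[OF u]]
        dbar_sform[OF sf] d_def[symmetric] q(2) sform_add)
  finally have harm: "sform f \<in> harmonic_forms g J 0 1 \<longleftrightarrow> (\<forall>i p. vbar i u p + q i p = 0)"
    using sform_in_pq_forms[OF f] by (simp add: harmonic_forms_def sform_eq_0_iff)
  show ?thesis
  proof
    assume "sform f \<in> harmonic_forms g J 0 1"
    then have 0: "vbar i u p + q i p = 0" for i p using harm by blast
    have sym: "cnj (herm h1 x y) = herm h1 y x" "cnj (herm h2 x y) = herm h2 y x" for x y
      using positive_hermitian_h1 positive_hermitian_h2 by (auto simp: positive_hermitian_def)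
    \<comment> \<open>The integrand of the squared norms of the codifferential and of dbar. Its
      integral is moved by adjointness onto the Laplacian paired with \<open>f\<close>, which is
      0.\<close>
    define F where "F = (\<lambda>p. u p * cnj (u p) + 1 / 2 * herm h2 (\<lambda>m. d m p) (\<lambda>n. d n p))"
    have qh: "quotient_function (\<lambda>p. herm h2 (\<lambda>m. d m p) (\<lambda>n. d n p))" by (intro quotient_function_herm d)
    have F: "quotient_function F" unfolding F_def by (intro quotient_function_intros u qh)
    have "cube_integral F = cube_integral (\<lambda>p. u p * cnj (u p)) + 1 / 2 * cube_integral (\<lambda>p. herm h2 (\<lambda>m. d m p) (\<lambda>n. d n p))"
      unfolding F_def
      by (subst integral_add) (auto intro!: quotient_function_integrable quotient_function_intros u qh)
    also have "cube_integral (\<lambda>p. u p * cnj (u p)) = cube_integral (\<lambda>p. herm h1 (\<lambda>i. vbar i u p) (\<lambda>j. f j p))"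
      using codiff_adjoint[of u f h1, OF u f] by (simp add: u_def)
    also have "1 / 2 * cube_integral (\<lambda>p. herm h2 (\<lambda>m. d m p) (\<lambda>n. d n p)) = cube_integral (\<lambda>p. herm h1 (\<lambda>i. q i p) (\<lambda>j. f j p))"
    proof -
      have "1 / 2 * cube_integral (\<lambda>p. herm h2 (\<lambda>m. d m p) (\<lambda>n. d n p)) =
          cnj (1 / 2 * cube_integral (\<lambda>p. herm h2 (\<lambda>m. d m p) (\<lambda>n. d n p)))"
        by (simp add: integral_cnj sym)
      also have "\<dots> = cnj (cube_integral (\<lambda>p. herm h1 (\<lambda>i. f i p) (\<lambda>j. q j p)))"
        using adj[OF f] by (simp only: d_def)
      finally show ?thesis by (simp add: integral_cnj sym)
    qed
    also have "cube_integral (\<lambda>p. herm h1 (\<lambda>i. vbar i u p) (\<lambda>j. f j p)) + cube_integral (\<lambda>p. herm h1 (\<lambda>i. q i p) (\<lambda>j. f j p)) =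
        cube_integral (\<lambda>p. herm h1 (\<lambda>i. vbar i u p) (\<lambda>j. f j p) + herm h1 (\<lambda>i. q i p) (\<lambda>j. f j p))"
      by (intro integral_add[symmetric] quotient_function_integrable quotient_function_herm quotient_function_vbar u f q)
    also have "(\<lambda>p. herm h1 (\<lambda>i. vbar i u p) (\<lambda>j. f j p) + herm h1 (\<lambda>i. q i p) (\<lambda>j. f j p)) =
        (\<lambda>p. herm h1 (\<lambda>i. vbar i u p + q i p) (\<lambda>j. f j p))"
      by (simp add: herm_def sum.distrib algebra_simps)
    also have "\<dots> = (\<lambda>p. 0)" by (simp add: 0 herm_def)
    finally have IF: "cube_integral F = 0" by simp
    have nonneg: "0 \<le> Re (u p * cnj (u p))" "0 \<le> Re (herm h2 (\<lambda>m. d m p) (\<lambda>n. d n p))" for p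
      using positive_hermitian_h2 by (auto simp: positive_hermitian_def)
    have ReF: "Re (F p) = Re (u p * cnj (u p)) + 1 / 2 * Re (herm h2 (\<lambda>m. d m p) (\<lambda>n. d n p))" for p
      by (simp add: F_def)
    have "Re (F p) = 0" for p
      using nonneg by (intro quotient_function_nonneg_integral_zero[OF F _ IF]) (simp add: ReF)
    then have uu: "Re (u p * cnj (u p)) = 0" and dd: "Re (herm h2 (\<lambda>m. d m p) (\<lambda>n. d n p)) = 0" for p
      using nonneg[of p] ReF[of p] by (simp_all only:)
    have u0: "u p = 0" for p
      using uu[of p] by (simp add: complex_eq_iff sum_squares_eq_zero_iff)
    have d0: "d m p = 0" for m p
      using positive_hermitian_h2 dd[of p] unfolding positive_hermitian_def by blast
    have coclosed: "(\<Sum>i\<in>UNIV. \<Sum>j\<in>UNIV. cnj (h1 i j) * vhol i (f j) p) = 0" for p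
      using u0[of p] unfolding u_def codiff_def neg_equal_0_iff_equal .
    have closed12: "vbar I1 (f I2) p - vbar I2 (f I1) p + curvature * f I3 p = 0" for p
      using d0[of I1 p] by (simp add: d_def dbar2_def)
    have closed3: "vbar i (f I3) p = vbar I3 (f i) p" for i p
      using d0[of I2 p] d0[of I3 p] by (cases i) (simp_all add: d_def dbar2_def)
    have pos: "0 \<le> Re (\<Sum>i\<in>UNIV. \<Sum>j\<in>UNIV. h1 i j * x i * cnj (x j))"
      "Re (\<Sum>i\<in>UNIV. \<Sum>j\<in>UNIV. h1 i j * x i * cnj (x j)) = 0 \<Longrightarrow> x i = 0" for x i
      using positive_hermitian_h1 by (auto simp: positive_hermitian_def herm_def)
    show "(\<forall>i p q. f i p = f i q) \<and> (\<forall>p. curvature * f I3 p = 0)"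
    proof (intro conjI allI)
      show "f i p = f i q" for i p q
        by (rule harmonic_imp_constant(1)[of h1 f]) (fact pos f closed12 closed3 coclosed)+
      show "curvature * f I3 p = 0" for p
        by (rule harmonic_imp_constant(2)[of h1 f]) (fact pos f closed12 closed3 coclosed)+
    qed
  next
    assume *: "(\<forall>i p q. f i p = f i q) \<and> (\<forall>p. curvature * f I3 p = 0)"
    then have fc: "f i = (\<lambda>p. f i 0)" for i by (intro ext) blast
    have curv: "curvature * f I3 p = 0" for p using * by blast
    have v0: "vbar i (f j) p = 0" "vhol i (f j) p = 0" for i j p
      by (subst fc, simp)+
    have u0: "u = (\<lambda>p. 0)" by (simp add: u_def codiff_def v0 fun_eq_iff)
    have "d m p = 0" for m p
      by (cases m) (simp_all add: d_def dbar2_def v0 curv)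
    \<comment> \<open>The adjoint \<open>q\<close> of the zero form is tested against
      itself.\<close>
    then have "cube_integral (\<lambda>p. herm h1 (\<lambda>i. q i p) (\<lambda>j. q j p)) = 0"
      using adj[OF q(1)] by (simp add: herm_def)
    then have "q i p = 0" for i p by (rule pairing_definite[OF positive_hermitian_h1 q(1)])
    then show "sform f \<in> harmonic_forms g J 0 1" unfolding harm u0 by simp
  qed
qed

end


section \<open>Integrability\<close>

lemma lie_bracket_dird: "lie_bracket X Y p = dird (X p) Y p - dird (Y p) X p"
  by (simp add: lie_bracket_def dird_def)

lemma smooth_frame: "smooth (frame k)"
proof (rule smooth_affine)
  show "bounded_linear (\<lambda>p. frame k p - frame k 0)"
    by (intro linear_conv_bounded_linear[THEN iffD1] linearI)
      (cases k; simp add: frame_def vec_eq_iff axis_def algebra_simps)+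
qed simp

lemma vector_field_frame: "vector_field (frame k)"
  by (simp add: vector_field_def smooth_frame frame_left_invariant)

context kt6_structure
begin

text \<open>\<open>J\<close> is affine in the base point; this is its linear part, hence its
  derivative at every point.\<close>

definition J_derivative :: "point \<Rightarrow> point \<Rightarrow> point" where
  "J_derivative u v = (\<chi> i. case i of
       Cz \<Rightarrow> - u $ Cx1 * v $ Cy2 / b + u $ Cx2 * b * v $ Cy1
     | Ct \<Rightarrow> (u $ Cx1 * v $ Cy1 + u $ Cx2 * v $ Cy2) / c
     | _ \<Rightarrow> 0)"

lemma bounded_bilinear_J_derivative: "bounded_bilinear J_derivative"
proof -
  have "bilinear J_derivative"
    unfolding bilinear_def
    by (intro conjI allI linearI)
      (auto simp: J_derivative_def vec_eq_iff add_divide_distrib diff_divide_distrib algebra_simps split: coord.split)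
  then show ?thesis by (simp add: bilinear_conv_bounded_bilinear)
qed

lemma J_eq_affine: "J p v = J 0 v + J_derivative p v"
  by (simp add: J_eq J_derivative_def vec_eq_iff forall_coord diff_divide_distrib add_divide_distrib)

lemma linear_J: "linear (J p)"
  using J_acs by (auto simp: almost_complex_def)

lemma J_J: "J p (J p v) = - v"
  using J_acs by (auto simp: almost_complex_def)

lemma dird_J:
  assumes Y: "smooth Y"
  shows "dird u (\<lambda>q. J q (Y q)) p = J_derivative u (Y p) + J p (dird u Y p)"
proof -
  have L: "bounded_linear (J 0)" using linear_J linear_conv_bounded_linear by blast
  have id: "dird u (\<lambda>x::point. x) = (\<lambda>x. u)"
    by (rule dird_eqI) (rule has_derivative_ident)
  have "dird u (\<lambda>q. J 0 (Y q) + J_derivative q (Y q)) p =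
      J 0 (dird u Y p) + (J_derivative p (dird u Y p) + J_derivative u (Y p))"
    by (subst dird_add)
      (auto intro!: bounded_linear.smooth_linear[OF L] bounded_bilinear.smooth_prod[OF bounded_bilinear_J_derivative]
        smooth_ident Y simp: bounded_linear.dird_linear[OF L Y]
        bounded_bilinear.dird_prod[OF bounded_bilinear_J_derivative smooth_ident Y] id)
  moreover have "(\<lambda>q. J q (Y q)) = (\<lambda>q. J 0 (Y q) + J_derivative q (Y q))"
    using J_eq_affine by (intro ext)
  ultimately show ?thesis using J_eq_affine[of p "dird u Y p"] by simp
qed

text \<open>The derivatives of \<open>X\<close> and \<open>Y\<close> cancel because
  \<open>J^2 = -1\<close>. What remains depends on the values of the fields only, which is the
  tensoriality of the Nijenhuis expression.\<close>

lemma nijenhuis_eq: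
  assumes X: "smooth X" and Y: "smooth Y"
  shows "nijenhuis J X Y p = J_derivative (J p (X p)) (Y p) - J_derivative (J p (Y p)) (X p)
    + J p (J_derivative (Y p) (X p)) - J p (J_derivative (X p) (Y p))"
  unfolding nijenhuis_def lie_bracket_dird dird_J[OF X] dird_J[OF Y]
  by (simp add: linear_add[OF linear_J] linear_diff[OF linear_J] J_J)

theorem integrable_iff: "integrable_acs J \<longleftrightarrow> a * b = 1"
proof
  assume "integrable_acs J"
  \<comment> \<open>The z-component for this pair at the origin is a b - 1.\<close>
  then have "nijenhuis J (frame Cx1) (frame Cy1) 0 = 0"
    using vector_field_frame by (simp add: integrable_acs_def)
  then have "nijenhuis J (frame Cx1) (frame Cy1) 0 $ Cz = 0" by simp
  then show "a * b = 1"
    unfolding nijenhuis_eq[OF smooth_frame smooth_frame]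
    using nonzero by (simp add: J_eq J_derivative_def frame_def axis_def)
next
  assume ab: "a * b = 1"
  then have a: "a = 1 / b" using nonzero by (simp add: field_simps)
  show "integrable_acs J"
    unfolding integrable_acs_def
  proof (intro allI impI)
    fix X Y p assume "vector_field X" "vector_field Y"
    then have "smooth X" "smooth Y" by (auto simp: vector_field_def)
    then show "nijenhuis J X Y p = 0"
      using nonzero
      by (simp add: nijenhuis_eq vec_eq_iff forall_coord J_eq J_derivative_def a diff_divide_distrib add_divide_distrib
          distrib_left)
  qed
qed

end

section \<open>The global frame\<close>

lemma (in vector_space) mem_span_three:
  "x \<in> span {u, v, w} \<longleftrightarrow> (\<exists>r s t. x = scale r u + scale s v + scale t w)"
  by (simp add: span_insert) (metis (no_types, opaque_lifting) add.commute add_diff_cancel_left' diff_add_cancel diff_diff_add)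

lemma (in vector_space) mem_span_two:
  "x \<in> span {u, v} \<longleftrightarrow> (\<exists>r s. x = scale r u + scale s v)"
  by (simp add: span_insert) (metis (no_types, opaque_lifting) add.commute add_diff_cancel_left' diff_add_cancel)

lemma (in vector_space) independent_three:
  assumes "\<And>r s. u \<noteq> scale r v + scale s w" "\<And>r. v \<noteq> scale r w" "w \<noteq> 0"
  shows "independent {u, v, w}"
proof -
  have "u \<notin> span {v, w}" using assms(1) by (simp add: mem_span_two)
  moreover have "v \<notin> span {w}" using assms(2) by (auto simp: span_singleton)
  moreover have "w \<notin> span {}" using assms(3) by simp
  ultimately show ?thesis by (intro independent_insertI independent_empty)
qed

lemma pq_part_1_0: "pq_part j 1 0 A vs = (if length vs = 1 then A [proj10 j (vs ! 0)] else 0)"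
proof -
  have "{S. S \<subseteq> {..<1 + 0} \<and> card S = 1} = {{0::nat}}"
    by (auto simp: card_1_singleton_iff)
  then show ?thesis by (simp add: pq_part_def)
qed

lemma one_form_singleton [simp]: "one_form f p [v] = f p v"
  by (simp add: one_form_def)

context kt6_structure
begin

definition ph :: "idx \<Rightarrow> point \<Rightarrow> cvec \<Rightarrow> complex" where
  "ph i p v = cnj (pb i p (cnj_vec v))"

definition v_vec :: "idx \<Rightarrow> point \<Rightarrow> cvec" where
  "v_vec i p = cnj_vec (vb_vec i p)"

lemma phi_eq: "phi1 a = one_form (ph I1)" "phi2 b = one_form (ph I2)" "phi3 c = one_form (ph I3)"
  by (simp_all add: phi1_def phi2_def phi3_def ph_def[abs_def] pb_def cnj_vec_def)

lemma cnj_vec_linear: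
  "cnj_vec (u + v) = cnj_vec u + cnj_vec v" "cnj_vec (k *s v) = cnj k *s cnj_vec v" "cnj_vec (cnj_vec v) = v"
  by (simp_all add: cnj_vec_def vec_eq_iff)

lemma ph_add: "ph i p (u + v) = ph i p u + ph i p v"
  by (simp add: ph_def cnj_vec_linear pb_add)

lemma ph_scale: "ph i p (k *s v) = k * ph i p v"
  by (simp add: ph_def cnj_vec_linear pb_scale)

lemma ph_dual: "ph i p (v_vec j p) = (if i = j then 1 else 0)"
  by (simp add: ph_def v_vec_def cnj_vec_linear pb_dual)

lemma proj10_eq: "proj10 (J p) v = (\<Sum>i\<in>UNIV. ph i p v *s v_vec i p)"
proof -
  have "complexify (J p) (cnj_vec v) = cnj_vec (complexify (J p) v)"
    by (simp add: complexify_J cnj_vec_def vec_eq_iff forall_coord)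
  then have "proj10 (J p) v = cnj_vec (proj01 (J p) (cnj_vec v))"
    by (simp add: proj10_def proj01_def cnj_vec_def vec_eq_iff)
  also have "\<dots> = (\<Sum>i\<in>UNIV. ph i p v *s v_vec i p)"
    unfolding proj01_eq by (simp add: sum_idx cnj_vec_linear ph_def v_vec_def)
  finally show ?thesis .
qed

lemma ph_proj10: "ph i p (proj10 (J p) v) = ph i p v"
  unfolding proj10_eq sum_idx by (simp add: ph_add ph_scale ph_dual) (cases i; simp)

lemma ph_in_covectors: "one_form (ph i) p \<in> pq_covectors (J p) 1 0"
proof -
  have "one_form (ph i) p \<in> covectors 1"
    by (rule one_form_in_covectors) (simp_all add: ph_add ph_scale)
  moreover have "pq_part (J p) 1 0 (one_form (ph i) p) vs = one_form (ph i) p vs" for vs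
    unfolding pq_part_1_0 by (auto simp: length_Suc_conv ph_proj10 one_form_def split: list.split)
  ultimately show ?thesis by (auto simp: pq_covectors_def)
qed

lemma ph_in_pq_forms: "one_form (ph i) \<in> pq_forms J 1 0"
proof -
  have smooth: "smooth (\<lambda>p. one_form (ph i) p vs)" for vs
  proof (cases "\<exists>v. vs = [v]")
    case True
    then show ?thesis by (auto simp: ph_def intro!: smooth_cnj smooth_pb)
  next
    case False
    then have "(\<lambda>p. one_form (ph i) p vs) = (\<lambda>p. 0)" by (auto simp: one_form_def split: list.split)
    then show ?thesis by (simp add: smooth_const)
  qed
  have "ph i (gmul \<gamma> p) (complexify (dtrans \<gamma> p) v) = ph i p v" for \<gamma> p v
  proof -
    have "cnj_vec (complexify (dtrans \<gamma> p) v) = complexify (dtrans \<gamma> p) (cnj_vec v)"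
      unfolding complexify_dtrans by (simp add: cnj_vec_def vec_eq_iff axis_def)
    then show ?thesis by (simp add: ph_def pb_invariant)
  qed
  then have "pullback \<gamma> (one_form (ph i)) = one_form (ph i)" for \<gamma>
    by (auto simp: pullback_def one_form_def fun_eq_iff split: list.split)
  then show ?thesis
    using smooth ph_in_covectors by (auto simp: pq_forms_def forms_def pq_covectors_def)
qed

lemma covector_10_expansion:
  assumes A: "A \<in> pq_covectors (J p) 1 0"
  shows "A = covector_scale (A [v_vec I1 p]) (one_form (ph I1) p) + covector_scale (A [v_vec I2 p]) (one_form (ph I2) p)
    + covector_scale (A [v_vec I3 p]) (one_form (ph I3) p)"
proof
  fix vs
  have cov: "A \<in> covectors 1" and part: "pq_part (J p) 1 0 A = A"
    using A by (auto simp: pq_covectors_def)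
  show "A vs = (covector_scale (A [v_vec I1 p]) (one_form (ph I1) p) + covector_scale (A [v_vec I2 p]) (one_form (ph I2) p)
    + covector_scale (A [v_vec I3 p]) (one_form (ph I3) p)) vs"
  proof (cases "length vs = 1")
    case True
    then obtain v where v: "vs = [v]" by (auto simp: length_Suc_conv)
    have "A vs = A [(\<Sum>i\<in>UNIV. ph i p v *s v_vec i p)]"
      using fun_cong[OF part, of vs] by (simp add: v pq_part_1_0[unfolded One_nat_def] proj10_eq)
    also have "\<dots> = (\<Sum>i\<in>UNIV. ph i p v * A [v_vec i p])" by (rule covector_1_sum[OF cov])
    finally show ?thesis by (simp add: v sum_idx covector_scale_def mult.commute)
  next
    case False
    then have "A vs = 0" using cov by (simp add: covectors_def)
    then show ?thesis using False by (auto simp: covector_scale_def one_form_def split: list.split)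
  qed
qed

theorem global_frame_phi: "global_frame J 1 0 [phi1 a, phi2 b, phi3 c]"
  unfolding global_frame_def
proof (intro conjI allI)
  show "set [phi1 a, phi2 b, phi3 c] \<subseteq> pq_forms J 1 0"
    using ph_in_pq_forms by (auto simp: phi_eq)
  fix p
  define P where "P = (\<lambda>i. one_form (ph i) p)"
  have ev: "covector_scale k (P i) [v_vec j p] = (if i = j then k else 0)" "P i [v_vec j p] = (if i = j then 1 else 0)" for i j k
    by (simp_all add: covector_scale_def P_def ph_dual)
  have img: "(\<lambda>\<phi>. \<phi> p) ` set [phi1 a, phi2 b, phi3 c] = {P I1, P I2, P I3}"
    by (auto simp: P_def phi_eq)
  have ne: "P i \<noteq> P j" if "i \<noteq> j" for i j
  proof
    assume "P i = P j"
    then have "P i [v_vec i p] = P j [v_vec i p]" by simp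
    then show False using that by (simp add: ev)
  qed
  show "distinct (map (\<lambda>\<phi>. \<phi> p) [phi1 a, phi2 b, phi3 c])"
    using ne by (auto simp: phi_eq P_def)
  show "cov.independent ((\<lambda>\<phi>. \<phi> p) ` set [phi1 a, phi2 b, phi3 c])"
    unfolding img
  proof (rule cov.independent_three)
    show "P I1 \<noteq> covector_scale r (P I2) + covector_scale s (P I3)" for r s
    proof
      assume "P I1 = covector_scale r (P I2) + covector_scale s (P I3)"
      from fun_cong[OF this, of "[v_vec I1 p]"] show False by (simp add: ev)
    qed
    show "P I2 \<noteq> covector_scale r (P I3)" for r
    proof
      assume "P I2 = covector_scale r (P I3)"
      from fun_cong[OF this, of "[v_vec I2 p]"] show False by (simp add: ev)
    qed
    show "P I3 \<noteq> 0"
    proof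
      assume "P I3 = 0"
      from fun_cong[OF this, of "[v_vec I3 p]"] show False by (simp add: ev)
    qed
  qed
  show "cov.span ((\<lambda>\<phi>. \<phi> p) ` set [phi1 a, phi2 b, phi3 c]) = pq_covectors (J p) 1 0"
    unfolding img
  proof (intro set_eqI iffI)
    fix A assume "A \<in> cov.span {P I1, P I2, P I3}"
    then obtain r s t where A: "A = covector_scale r (P I1) + covector_scale s (P I2) + covector_scale t (P I3)"
      unfolding cov.mem_span_three by blast
    define k where "k = (\<lambda>i. case i of I1 \<Rightarrow> r | I2 \<Rightarrow> s | I3 \<Rightarrow> t)"
    have A': "A = one_form (\<lambda>q v. \<Sum>i\<in>UNIV. k i * ph i p v) p"
      unfolding A by (auto simp: fun_eq_iff covector_scale_def P_def one_form_def sum_idx k_def split: list.split)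
    have "A \<in> covectors 1"
      unfolding A' by (rule one_form_in_covectors)
        (simp_all add: ph_add ph_scale distrib_left sum.distrib sum_distrib_left mult_ac)
    moreover have "pq_part (J p) 1 0 A vs = A vs" for vs
      unfolding pq_part_1_0 A' by (auto simp: length_Suc_conv ph_proj10 one_form_def split: list.split)
    ultimately show "A \<in> pq_covectors (J p) 1 0" by (auto simp: pq_covectors_def)
  next
    fix A assume "A \<in> pq_covectors (J p) 1 0"
    then show "A \<in> cov.span {P I1, P I2, P I3}"
      unfolding cov.mem_span_three P_def using covector_10_expansion by blast
  qed
qed

end

section \<open>Dolbeault cohomology and constant forms\<close>

text \<open>A complement of the exact forms inside the closed forms maps isomorphically onto the
  quotient.\<close>

lemma iso_to_cohomologyI:
  assumes Z: "cform.subspace (dbar_closed J p q)" and E: "cform.subspace (dbar_exact J p q)"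
    and V: "cform.subspace V" "V \<subseteq> dbar_closed J p q" and inj: "V \<inter> dbar_exact J p q \<subseteq> {0}"
    and surj: "\<And>z. z \<in> dbar_closed J p q \<Longrightarrow> \<exists>v\<in>V. z - v \<in> dbar_exact J p q"
  shows "iso_to_cohomology J p q V (dolbeault_class J p q)"
proof -
  let ?Z = "dbar_closed J p q" and ?E = "dbar_exact J p q" and ?c = "dolbeault_class J p q"
  have neg: "x - y \<in> ?E \<Longrightarrow> y - x \<in> ?E" for x y
    using cform.subspace_neg[OF E, of "x - y"] by simp
  have trans: "x - y \<in> ?E \<Longrightarrow> y - z \<in> ?E \<Longrightarrow> x - z \<in> ?E" for x y z
    using cform.subspace_add[OF E, of "x - y" "y - z"] by simp
  have cls: "?c x = {y \<in> ?Z. x - y \<in> ?E}" if "x \<in> ?Z" for x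
    using that by (auto simp: dolbeault_class_def cohomologous_def)
  have self: "x \<in> ?c x" if "x \<in> ?Z" for x
    using that cform.subspace_0[OF E] by (simp add: cls)
  have eq: "?c x = ?c y \<longleftrightarrow> x - y \<in> ?E" if "x \<in> ?Z" "y \<in> ?Z" for x y
  proof
    assume "?c x = ?c y"
    then have "y \<in> ?c x" using self[OF that(2)] by simp
    then show "x - y \<in> ?E" by (simp add: cls that)
  next
    assume "x - y \<in> ?E"
    then show "?c x = ?c y"
      unfolding cls[OF that(1)] cls[OF that(2)] using neg[of x y] trans[of x y] trans[of y x] by blast
  qed
  have coh: "dolbeault_cohomology J p q = ?c ` ?Z"
    by (auto simp: dolbeault_cohomology_def quotient_def dolbeault_class_def)
  have "bij_betw ?c V (dolbeault_cohomology J p q)"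
    unfolding bij_betw_def
  proof
    show "inj_on ?c V"
    proof (rule inj_onI)
      fix x y assume xy: "x \<in> V" "y \<in> V" "?c x = ?c y"
      then have "x - y \<in> ?E" using eq[of x y] V(2) by (simp add: subset_iff)
      moreover have "x - y \<in> V" by (rule cform.subspace_diff[OF V(1) xy(1,2)])
      ultimately have "x - y = 0" using inj by blast
      then show "x = y" by simp
    qed
    show "?c ` V = dolbeault_cohomology J p q"
      unfolding coh
    proof
      show "?c ` V \<subseteq> ?c ` ?Z" using V(2) by blast
      show "?c ` ?Z \<subseteq> ?c ` V"
      proof
        fix C assume "C \<in> ?c ` ?Z"
        then obtain z where z: "z \<in> ?Z" "C = ?c z" by blast
        then obtain v where v: "v \<in> V" "z - v \<in> ?E" using surj by blast
        then have "?c z = ?c v" using eq[of z v] z(1) V(2) by (simp add: subset_iff)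
        then show "C \<in> ?c ` V" using z(2) v(1) by (simp only: imageI)
      qed
    qed
  qed
  moreover have "?c (x + y) = class_add J p q (?c x) (?c y)" if "x \<in> V" "y \<in> V" for x y
  proof -
    have xy: "x \<in> ?Z" "y \<in> ?Z" "x + y \<in> ?Z" using that V(2) cform.subspace_add[OF Z] by auto
    have "?c (x' + y') = ?c (x + y)" if "x' \<in> ?c x" "y' \<in> ?c y" for x' y'
    proof -
      have x': "x' \<in> ?Z" "x - x' \<in> ?E" and y': "y' \<in> ?Z" "y - y' \<in> ?E" using that by (auto simp: cls xy)
      have "(x - x') + (y - y') \<in> ?E" by (rule cform.subspace_add[OF E x'(2) y'(2)])
      then have "(x + y) - (x' + y') \<in> ?E" by (simp add: algebra_simps)
      moreover have "x' + y' \<in> ?Z" by (rule cform.subspace_add[OF Z x'(1) y'(1)])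
      ultimately show ?thesis using eq[of "x + y" "x' + y'"] xy(3) by simp
    qed
    \<comment> \<open>The sum of classes is a union over all representatives; it is a single class
      because the family is constant and nonempty.\<close>
    then have "class_add J p q (?c x) (?c y) = (\<Union>\<alpha>\<in>?c x. \<Union>\<beta>\<in>?c y. ?c (x + y))"
      unfolding class_add_def by (intro SUP_cong refl)
    moreover have "?c x \<noteq> {}" "?c y \<noteq> {}" using self[OF xy(1)] self[OF xy(2)] by blast+
    ultimately show ?thesis by (simp only: UN_constant if_False)
  qed
  moreover have "?c (form_scale k x) = class_scale J p q k (?c x)" if "x \<in> V" for x k
  proof -
    have x: "x \<in> ?Z" "form_scale k x \<in> ?Z" using that V(2) cform.subspace_scale[OF Z] by auto
    have "?c (form_scale k x') = ?c (form_scale k x)" if "x' \<in> ?c x" for x'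
    proof -
      have x': "x' \<in> ?Z" "x - x' \<in> ?E" using that by (auto simp: cls x)
      have "form_scale k (x - x') \<in> ?E" by (rule cform.subspace_scale[OF E x'(2)])
      then have "form_scale k x - form_scale k x' \<in> ?E" by (simp add: cform.scale_right_diff_distrib)
      moreover have "form_scale k x' \<in> ?Z" by (rule cform.subspace_scale[OF Z x'(1)])
      ultimately show ?thesis using eq[of "form_scale k x" "form_scale k x'"] x(2) by simp
    qed
    then have "class_scale J p q k (?c x) = (\<Union>\<alpha>\<in>?c x. ?c (form_scale k x))"
      unfolding class_scale_def by (intro SUP_cong refl)
    moreover have "?c x \<noteq> {}" using self[OF x(1)] by blast
    ultimately show ?thesis by (simp only: UN_constant if_False)
  qed
  ultimately show ?thesis using V(1) by (simp add: iso_to_cohomology_def)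
qed

section \<open>Closed, exact and constant (0, 1)-forms\<close>

context kt6_structure
begin

lemma form_cnj_phi:
  "form_cnj (phi1 a) = sform (\<lambda>i p. if i = I1 then 1 else 0)"
  "form_cnj (phi2 b) = sform (\<lambda>i p. if i = I2 then 1 else 0)"
  "form_cnj (phi3 c) = sform (\<lambda>i p. if i = I3 then 1 else 0)"
  by (auto simp: form_cnj_def phi1_def phi2_def phi3_def sform_def one_form_def fun_eq_iff sum_idx pb_def cnj_vec_def
      split: list.split)

definition constant_forms :: "form set" where
  "constant_forms = range (\<lambda>k. sform (\<lambda>i p. k i))"

lemma span_phi123: "cform.span {form_cnj (phi1 a), form_cnj (phi2 b), form_cnj (phi3 c)} = constant_forms"
proof (intro set_eqI iffI)
  fix x assume "x \<in> cform.span {form_cnj (phi1 a), form_cnj (phi2 b), form_cnj (phi3 c)}"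
  then obtain r s t where "x = form_scale r (form_cnj (phi1 a)) + form_scale s (form_cnj (phi2 b)) + form_scale t (form_cnj (phi3 c))"
    unfolding cform.mem_span_three by blast
  then show "x \<in> constant_forms"
    by (simp add: form_cnj_phi form_scale_sform sform_add constant_forms_def)
next
  fix x assume "x \<in> constant_forms"
  then obtain k where k: "x = sform (\<lambda>i p. k i)" by (auto simp: constant_forms_def)
  have "k i = k I1 * (if i = I1 then 1 else 0) + k I2 * (if i = I2 then 1 else 0) + k I3 * (if i = I3 then 1 else 0)" for i
    by (cases i) simp_all
  then have "x = form_scale (k I1) (form_cnj (phi1 a)) + form_scale (k I2) (form_cnj (phi2 b)) + form_scale (k I3) (form_cnj (phi3 c))"
    unfolding k form_cnj_phi form_scale_sform sform_add by (intro arg_cong[where f = sform] ext)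
  then show "x \<in> cform.span {form_cnj (phi1 a), form_cnj (phi2 b), form_cnj (phi3 c)}"
    unfolding cform.mem_span_three by blast
qed

lemma span_phi12:
  "cform.span {form_cnj (phi1 a), form_cnj (phi2 b)} = {sform (\<lambda>i p. k i) | k. k I3 = 0}"
proof (intro set_eqI iffI)
  fix x assume "x \<in> cform.span {form_cnj (phi1 a), form_cnj (phi2 b)}"
  then obtain r s where "x = form_scale r (form_cnj (phi1 a)) + form_scale s (form_cnj (phi2 b))"
    unfolding cform.mem_span_two by blast
  then have "x = sform (\<lambda>i p. r * (if i = I1 then 1 else 0) + s * (if i = I2 then 1 else 0))"
    by (simp only: form_cnj_phi form_scale_sform sform_add)
  then show "x \<in> {sform (\<lambda>i p. k i) | k. k I3 = 0}"
    by (intro CollectI exI[of _ "\<lambda>i. r * (if i = I1 then 1 else 0) + s * (if i = I2 then 1 else 0)"]) simp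
next
  fix x assume "x \<in> {sform (\<lambda>i p. k i) | k. k I3 = 0}"
  then obtain k where k: "x = sform (\<lambda>i p. k i)" "k I3 = 0" by blast
  have "k i = k I1 * (if i = I1 then 1 else 0) + k I2 * (if i = I2 then 1 else 0)" for i
    using k(2) by (cases i) simp_all
  then have "x = form_scale (k I1) (form_cnj (phi1 a)) + form_scale (k I2) (form_cnj (phi2 b))"
    unfolding k(1) form_cnj_phi form_scale_sform sform_add by (intro arg_cong[where f = sform] ext)
  then show "x \<in> cform.span {form_cnj (phi1 a), form_cnj (phi2 b)}"
    unfolding cform.mem_span_two by blast
qed

lemma curvature_eq_0_iff: "curvature = 0 \<longleftrightarrow> a * b = 1"
proof -
  have "curvature = 0 \<longleftrightarrow> complex_of_real (1 - a * b) = 0"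
    using nonzero by (simp add: curvature_def)
  then show ?thesis by (simp only: of_real_eq_0_iff) auto
qed

lemma dbar_exact_eq: "dbar_exact J 0 1 = {sform (\<lambda>i. vbar i u) | u. quotient_function u}"
proof (intro set_eqI iffI)
  fix x assume "x \<in> dbar_exact J 0 1"
  then obtain \<omega> where \<omega>: "\<omega> \<in> pq_forms J 0 0" "x = dbar J 0 0 \<omega>" by (auto simp: dbar_exact_def)
  obtain u where u: "quotient_function u" "\<omega> = fform u" using \<omega>(1) by (rule pq_forms_00)
  then show "x \<in> {sform (\<lambda>i. vbar i u) | u. quotient_function u}"
    unfolding \<omega>(2) u(2) dbar_fform[OF quotient_function_smooth[OF u(1)]] by blast
next
  fix x assume "x \<in> {sform (\<lambda>i. vbar i u) | u. quotient_function u}"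
  then obtain u where u: "quotient_function u" "x = sform (\<lambda>i. vbar i u)" by blast
  then have "x = dbar J 0 0 (fform u)" by (simp only: dbar_fform quotient_function_smooth)
  then show "x \<in> dbar_exact J 0 1" using fform_in_pq_forms[OF u(1)] by (simp add: dbar_exact_def)
qed

lemma dbar_closed_eq:
  assumes "a * b = 1"
  shows "dbar_closed J 0 1 = {sform f | f. compatible_system f}"
proof (intro set_eqI iffI)
  have curv: "curvature = 0" using assms curvature_eq_0_iff by blast
  have closed: "dbar J 0 1 (sform f) = 0 \<longleftrightarrow> compatible_system f" if f: "\<And>i. quotient_function (f i)" for f
    using f unfolding dbar_sform[OF quotient_function_smooth[OF f]] tform_eq_0_iff forall_idx compatible_system_def
    by (auto simp: dbar2_def curv)
  {
    fix x assume "x \<in> dbar_closed J 0 1"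
    then have x: "x \<in> pq_forms J 0 1" "dbar J 0 1 x = 0" by (auto simp: dbar_closed_def)
    obtain f where f: "\<And>i. quotient_function (f i)" "x = sform f" using x(1) by (rule pq_forms_01) blast
    then have "compatible_system f" using x(2) closed[of f, OF f(1)] by simp
    then show "x \<in> {sform f | f. compatible_system f}" using f(2) by blast
  next
    fix x assume "x \<in> {sform f | f. compatible_system f}"
    then obtain f where f: "compatible_system f" "x = sform f" by blast
    then have q: "quotient_function (f i)" for i by (simp add: compatible_system_def)
    show "x \<in> dbar_closed J 0 1"
      using sform_in_pq_forms[of f, OF q] closed[of f, OF q] f by (simp add: dbar_closed_def)
  }
qed

lemma subspace_dbar_exact: "cform.subspace (dbar_exact J 0 1)"
proof (rule cform.subspaceI)
  have "sform (\<lambda>i. vbar i (\<lambda>p. 0)) = 0" by (simp add: sform_eq_0_iff)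
  then show "0 \<in> dbar_exact J 0 1"
    unfolding dbar_exact_eq by (intro CollectI exI[of _ "\<lambda>p. 0"] conjI quotient_function_const) simp
  fix x y assume "x \<in> dbar_exact J 0 1" "y \<in> dbar_exact J 0 1"
  then obtain u v where uv: "quotient_function u" "x = sform (\<lambda>i. vbar i u)" "quotient_function v" "y = sform (\<lambda>i. vbar i v)"
    unfolding dbar_exact_eq by blast
  then have "x + y = sform (\<lambda>i. vbar i (\<lambda>p. u p + v p))"
    by (simp add: sform_add vbar_rules quotient_function_smooth)
  then show "x + y \<in> dbar_exact J 0 1"
    unfolding dbar_exact_eq using quotient_function_add[OF uv(1,3)] by blast
next
  fix k x assume "x \<in> dbar_exact J 0 1"
  then obtain u where u: "quotient_function u" "x = sform (\<lambda>i. vbar i u)"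
    unfolding dbar_exact_eq by blast
  then have "form_scale k x = sform (\<lambda>i. vbar i (\<lambda>p. k * u p))"
    by (simp add: form_scale_sform vbar_rules quotient_function_smooth)
  then show "form_scale k x \<in> dbar_exact J 0 1"
    unfolding dbar_exact_eq using quotient_function_mult[OF quotient_function_const u(1)] by blast
qed

lemma subspace_dbar_closed:
  assumes ab: "a * b = 1" shows "cform.subspace (dbar_closed J 0 1)"
proof (rule cform.subspaceI)
  have "compatible_system (\<lambda>i p. 0)" by (simp add: compatible_system_def quotient_function_const)
  moreover have "sform (\<lambda>i p. 0) = 0" by (simp add: sform_eq_0_iff)
  ultimately show "0 \<in> dbar_closed J 0 1" 
    unfolding dbar_closed_eq[OF ab] by (intro CollectI exI[of _ "\<lambda>i p. 0"]) simp
  fix x y assume "x \<in> dbar_closed J 0 1" "y \<in> dbar_closed J 0 1"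
  then obtain u v where uv: "compatible_system u" "x = sform u" "compatible_system v" "y = sform v"
    unfolding dbar_closed_eq[OF ab] by blast
  then have "compatible_system (\<lambda>i p. u i p + v i p)"
    by (simp add: compatible_system_def quotient_function_add vbar_rules quotient_function_smooth)
  moreover have "x + y = sform (\<lambda>i p. u i p + v i p)" by (simp add: uv sform_add)
  ultimately show "x + y \<in> dbar_closed J 0 1" unfolding dbar_closed_eq[OF ab] by blast
next
  fix k x assume "x \<in> dbar_closed J 0 1"
  then obtain u where u: "compatible_system u" "x = sform u"
    unfolding dbar_closed_eq[OF ab] by blast
  then have "compatible_system (\<lambda>i p. k * u i p)"
    by (simp add: compatible_system_def quotient_function_mult quotient_function_const vbar_rules quotient_function_smooth)
  moreover have "form_scale k x = sform (\<lambda>i p. k * u i p)" by (simp add: u form_scale_sform)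
  ultimately show "form_scale k x \<in> dbar_closed J 0 1" unfolding dbar_closed_eq[OF ab] by blast
qed

text \<open>Constant forms meet the exact ones trivially because derivatives have mean zero, and
  they reach every class because the three torus equations can be solved.\<close>

theorem iso_to_cohomology_constant_forms:
  assumes ab: "a * b = 1"
  shows "iso_to_cohomology J 0 1 constant_forms (dolbeault_class J 0 1)"
proof (rule iso_to_cohomologyI[OF subspace_dbar_closed[OF ab] subspace_dbar_exact])
  show "cform.subspace constant_forms" unfolding span_phi123[symmetric] by (rule cform.subspace_span)
  have "compatible_system (\<lambda>i p. k i)" for k
    by (simp add: compatible_system_def quotient_function_const)
  then show "constant_forms \<subseteq> dbar_closed J 0 1"
    unfolding constant_forms_def dbar_closed_eq[OF ab] by blast
  show "constant_forms \<inter> dbar_exact J 0 1 \<subseteq> {0}"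
  proof
    fix x assume "x \<in> constant_forms \<inter> dbar_exact J 0 1"
    then obtain k u where k: "x = sform (\<lambda>i p. k i)" and u: "quotient_function u" "x = sform (\<lambda>i. vbar i u)"
      unfolding constant_forms_def dbar_exact_eq by blast
    have "sform (\<lambda>i p. vbar i u p - k i) = 0"
      using k u(2) sform_diff[of "\<lambda>i. vbar i u" "\<lambda>i p. k i"] by simp
    then have "vbar i u p = k i" for i p by (simp add: sform_eq_0_iff)
    then have "k i = 0" for i by (rule constant_exact_imp_zero[OF u(1)])
    then show "x \<in> {0}" by (simp add: k sform_eq_0_iff)
  qed
  fix z assume "z \<in> dbar_closed J 0 1"
  then obtain f where f: "compatible_system f" "z = sform f" unfolding dbar_closed_eq[OF ab] by blast
  obtain u k where u: "quotient_function u" "\<And>i p. f i p = k i + vbar i u p"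
    by (rule closed_imp_constant_plus_exact[OF ab f(1)]) blast
  have "z - sform (\<lambda>i p. k i) = sform (\<lambda>i. vbar i u)"
    unfolding f(2) sform_diff by (simp add: u(2))
  then show "\<exists>v\<in>constant_forms. z - v \<in> dbar_exact J 0 1"
    unfolding constant_forms_def dbar_exact_eq using u(1) by blast
qed

end

section \<open>Harmonic forms in the two cases\<close>

context kt6_metric
begin

text \<open>One description serves both cases: a nonzero \<open>curvature\<close> forces the third
  coefficient to vanish, a zero one leaves it free. The metric has disappeared from the right-hand
  side.\<close>

lemma harmonic_forms_eq: "harmonic_forms g J 0 1 = {sform (\<lambda>i p. k i) | k. curvature * k I3 = 0}"
proof (intro set_eqI iffI)
  fix x assume x: "x \<in> harmonic_forms g J 0 1"
  then have "x \<in> pq_forms J 0 1" by (simp add: harmonic_forms_def)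
  then obtain f where f: "\<And>i. quotient_function (f i)" "x = sform f" by (rule pq_forms_01) blast
  then have "(\<forall>i p q. f i p = f i q) \<and> (\<forall>p. curvature * f I3 p = 0)"
    using x harmonic_iff_constant[of f, OF f(1)] by blast
  then have "f = (\<lambda>i p. f i 0)" "curvature * f I3 0 = 0" by blast+
  then show "x \<in> {sform (\<lambda>i p. k i) | k. curvature * k I3 = 0}"
    unfolding f(2) by (intro CollectI exI[of _ "\<lambda>i. f i 0"]) simp
next
  fix x assume "x \<in> {sform (\<lambda>i p. k i) | k. curvature * k I3 = 0}"
  then obtain k where "x = sform (\<lambda>i p. k i)" "curvature * k I3 = 0" by blast
  then show "x \<in> harmonic_forms g J 0 1"
    using harmonic_iff_constant[of "\<lambda>i p. k i", OF quotient_function_const] by simp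
qed

lemma harmonic_forms_nonintegrable:
  assumes "a * b \<noteq> 1"
  shows "harmonic_forms g J 0 1 = cform.span {form_cnj (phi1 a), form_cnj (phi2 b)}"
  unfolding harmonic_forms_eq span_phi12 using assms curvature_eq_0_iff by simp

lemma harmonic_forms_integrable:
  assumes "a * b = 1" shows "harmonic_forms g J 0 1 = constant_forms"
  unfolding harmonic_forms_eq constant_forms_def using assms curvature_eq_0_iff by auto

end

lemma (in kt6_structure) kt6_metric_exists:
  assumes "riemannian_metric g" "left_invariant_metric g"
  shows "\<exists>B w. kt6_metric a b c J g B w"
proof -
  obtain B w where
    "\<And>p i j. matrix_inv (gram g p) $ i $ j = (\<Sum>m\<in>UNIV. frame_combination B m p $ i * frame_combination B m p $ j)"
    "\<And>p. invertible (gram g p)" "w \<noteq> 0" "\<And>p. sqrt (det (gram g p)) = w"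
    by (rule left_invariant_gram[OF assms]) blast
  then have "kt6_metric a b c J g B w" by unfold_locales
  then show ?thesis by blast
qed

theorem corollary7p1:
  fixes a b c :: real and J :: "point \<Rightarrow> point \<Rightarrow> point"
  assumes "a \<noteq> 0" and "b \<noteq> 0" and "c \<noteq> 0"
    and "almost_complex J" and "left_invariant_endo J"
    and "\<And>p. J p (frame Cx1 p) = a *\<^sub>R frame Cx2 p"
    and "\<And>p. J p (frame Cy1 p) = b *\<^sub>R frame Cy2 p"
    and "\<And>p. J p (frame Ct p) = c *\<^sub>R frame Cz p"
  shows "global_frame J 1 0 [phi1 a, phi2 b, phi3 c] \<and>
    (a * b \<noteq> 1 \<longrightarrow>
      (\<forall>g. riemannian_metric g \<longrightarrow> left_invariant_metric g \<longrightarrow> compatible g J \<longrightarrow>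
         harmonic_forms g J 0 1 = cform.span {form_cnj (phi1 a), form_cnj (phi2 b)})) \<and>
    (integrable_acs J \<longleftrightarrow> a * b = 1) \<and>
    (a * b = 1 \<longrightarrow>
      iso_to_cohomology J 0 1
        (cform.span {form_cnj (phi1 a), form_cnj (phi2 b), form_cnj (phi3 c)})
        (dolbeault_class J 0 1) \<and>
      (\<forall>g. riemannian_metric g \<longrightarrow> left_invariant_metric g \<longrightarrow> compatible g J \<longrightarrow>
         iso_to_cohomology J 0 1 (harmonic_forms g J 0 1) (dolbeault_class J 0 1)))"
proof -
  interpret kt6_structure a b c J
    using assms by unfold_locales
  have metric: "\<exists>B w. kt6_metric a b c J g B w" if "riemannian_metric g" "left_invariant_metric g" for g
    using that by (rule kt6_metric_exists)
  show ?thesis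
  proof (intro conjI impI allI)
    show "global_frame J 1 0 [phi1 a, phi2 b, phi3 c]" by (rule global_frame_phi)
    show "integrable_acs J \<longleftrightarrow> a * b = 1" by (rule integrable_iff)
    show "harmonic_forms g J 0 1 = cform.span {form_cnj (phi1 a), form_cnj (phi2 b)}"
      if "a * b \<noteq> 1" "riemannian_metric g" "left_invariant_metric g" for g
      using metric[OF that(2,3)] kt6_metric.harmonic_forms_nonintegrable that(1) by blast
    show "iso_to_cohomology J 0 1
        (cform.span {form_cnj (phi1 a), form_cnj (phi2 b), form_cnj (phi3 c)}) (dolbeault_class J 0 1)"
      if "a * b = 1"
      unfolding span_phi123 by (rule iso_to_cohomology_constant_forms[OF that])
    show "iso_to_cohomology J 0 1 (harmonic_forms g J 0 1) (dolbeault_class J 0 1)"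
      if "a * b = 1" "riemannian_metric g" "left_invariant_metric g" for g
    proof -
      have "harmonic_forms g J 0 1 = constant_forms"
        using metric[OF that(2,3)] kt6_metric.harmonic_forms_integrable that(1) by blast
      then show ?thesis using iso_to_cohomology_constant_forms[OF that(1)] by simp
    qed
  qed
qed

end
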